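(* Let $N=2$ and let $\mu\in H^3((0,1),\mathbb{R})$ be such that $$\mathcal{A}:=\langle\mu\varphi_1,\varphi_1\rangle\langle(\mu')^2\varphi_2,\varphi_2\rangle-\langle\mu\varphi_2,\varphi_2\rangle\langle(\mu')^2\varphi_1,\varphi_1\rangle\neq 0$$ and $\langle\mu\varphi_1,\varphi_1\rangle\neq0$. Let $\alpha:=\operatorname{sign}\big(\mathcal{A}\langle\mu\varphi_1,\varphi_1\rangle\big)\in\{-1,1\}$. There exist $T_*>0$ and $\varepsilon>0$ such that for any $T\in(0,T_* )$ and every $u\in L^2((0,T),\mathbb{R})$ with $\|u\|_{L^2(0,T)}<\varepsilon$, the solution $(\psi^1,\psi^2)$ of $$i\partial_t\psi^j=-\partial^2_{xx}\psi^j-u(t)\mu(x)\psi^j,\quad \psi^j(t,0)=\psi^j(t,1)=0,\quad \psi^j(0,\cdot)=\varphi_j,\qquad j=1,2,$$ on $(0,T)\times(0,1)$ satisfies $$\big(\psi^1(T),\psi^2(T)\big)\neq\Big(\Phi_1(T),\big(\sqrt{1-\delta^2}+i\alpha\delta\big)\Phi_2(T)\Big),\qquad\forall\,\delta\in(0,1].$$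
   Context: $\langle f,g\rangle=\int_0^1 f(x)\overline{g(x)}\,dx$ on $L^2((0,1),\mathbb{C})$. $A\varphi:=-\partial_{xx}^2\varphi$ with domain $H^2\cap H^1_0((0,1),\mathbb{C})$; $\lambda_k:=(k\pi)^2$, $\varphi_k(x):=\sqrt2\sin(k\pi x)$, $\Phi_k(t,x):=\varphi_k(x)e^{-i\lambda_kt}$ for $k\in\mathbb{N}^*=\{1,2,\dots\}$. $H^3_{(0)}((0,1),\mathbb{C}):=\mathcal{D}(A^{3/2})$, with norm $\|\varphi\|_{H^3_{(0)}}=\big(\sum_k|k^3\langle\varphi,\varphi_k\rangle|^2\big)^{1/2}$. Solutions are weak (mild) solutions: for $\mu\in H^3((0,1),\mathbb R)$, $u\in L^2((0,T),\mathbb R)$ and $\psi_0\in H^3_{(0)}$, the solution of $i\partial_t\psi=-\partial_{xx}^2\psi-u\mu\psi$ with Dirichlet boundary conditions and $\psi(0)=\psi_0$ is the unique $\psi\in C^0([0,T],H^3_{(0)})$ with $\psi(t)=e^{-iAt}\psi_0+i\int_0^te^{-iA(t-\tau)}u(\tau)\mu\psi(\tau)\,d\tau$ in $H^3_{(0)}$ for all $t\in[0,T]$. *)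

theory Defs
  imports "HOL-Analysis.Analysis"
begin

text \<open>Elements of \<open>L\<^sup>2\<close> are handled through representatives: functions on the real line whose
  values outside the interval are irrelevant.  Equality in \<open>L\<^sup>2(a,b)\<close> is equality almost
  everywhere on \<open>{a<..<b}\<close>.\<close>

definition L2 :: "real \<Rightarrow> real \<Rightarrow> (real \<Rightarrow> 'a::{banach,second_countable_topology}) \<Rightarrow> bool" where
  "L2 a b f \<longleftrightarrow> f \<in> borel_measurable (lebesgue_on {a<..<b}) \<and>
     integrable (lebesgue_on {a<..<b}) (\<lambda>x. (norm (f x))\<^sup>2)"

definition L2norm :: "real \<Rightarrow> real \<Rightarrow> (real \<Rightarrow> 'a::{banach,second_countable_topology}) \<Rightarrow> real" where
  "L2norm a b f = sqrt (integral\<^sup>L (lebesgue_on {a<..<b}) (\<lambda>x. (norm (f x))\<^sup>2))"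

definition eq_ae :: "(real \<Rightarrow> complex) \<Rightarrow> (real \<Rightarrow> complex) \<Rightarrow> bool" where
  "eq_ae f g \<longleftrightarrow> (AE x in lebesgue_on {0<..<1}. f x = g x)"

definition ip :: "(real \<Rightarrow> complex) \<Rightarrow> (real \<Rightarrow> complex) \<Rightarrow> complex" where
  "ip f g = integral\<^sup>L (lebesgue_on {0<..<1}) (\<lambda>x. f x * cnj (g x))"


subsection \<open>Sobolev spaces on (0,1)\<close>

definition test_function :: "(real \<Rightarrow> real) \<Rightarrow> bool" where
  "test_function \<theta> \<longleftrightarrow> (\<forall>k x. (deriv ^^ k) \<theta> differentiable (at x)) \<and>
     compact (closure {x. \<theta> x \<noteq> 0}) \<and> closure {x. \<theta> x \<noteq> 0} \<subseteq> {0<..<1}"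

definition locally_integrable :: "(real \<Rightarrow> real) \<Rightarrow> bool" where
  "locally_integrable f \<longleftrightarrow>
     (\<forall>K. compact K \<longrightarrow> K \<subseteq> {0<..<1} \<longrightarrow> integrable (lebesgue_on K) f)"

definition weak_deriv :: "nat \<Rightarrow> (real \<Rightarrow> real) \<Rightarrow> (real \<Rightarrow> real) \<Rightarrow> bool" where
  "weak_deriv k f g \<longleftrightarrow> locally_integrable f \<and> locally_integrable g \<and>
     (\<forall>\<theta>. test_function \<theta> \<longrightarrow>
        integral\<^sup>L (lebesgue_on {0<..<1}) (\<lambda>x. f x * (deriv ^^ k) \<theta> x) =
        (- 1) ^ k * integral\<^sup>L (lebesgue_on {0<..<1}) (\<lambda>x. g x * \<theta> x))"

definition sobolev :: "nat \<Rightarrow> (real \<Rightarrow> real) \<Rightarrow> bool" where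
  "sobolev m f \<longleftrightarrow> L2 0 1 f \<and> (\<forall>k\<in>{1..m}. \<exists>g. L2 0 1 g \<and> weak_deriv k f g)"


subsection \<open>Spectral calculus of the Dirichlet Laplacian\<close>

definition eigval :: "nat \<Rightarrow> real" where
  "eigval k = (real k * pi)\<^sup>2"

definition \<phi> :: "nat \<Rightarrow> real \<Rightarrow> complex" where
  "\<phi> k x = complex_of_real (sqrt 2 * sin (real k * pi * x))"

definition \<Phi> :: "nat \<Rightarrow> real \<Rightarrow> real \<Rightarrow> complex" where
  "\<Phi> k t x = \<phi> k x * exp (- \<i> * complex_of_real (eigval k * t))"

lemma phi_boundary: "\<phi> k 0 = 0" "\<phi> k 1 = 0"
  by (simp_all add: \<phi>_def)

lemma phi_eigenfunction:
  obtains d where "\<And>x. (\<phi> k has_vector_derivative d x) (at x)"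
    and "\<And>x. (d has_vector_derivative - (complex_of_real (eigval k) * \<phi> k x)) (at x)"
proof
  define d where
    "d x = complex_of_real (sqrt 2 * (cos (real k * pi * x) * (real k * pi)))" for x
  have "((\<lambda>x. sqrt 2 * sin (real k * pi * x)) has_real_derivative
      sqrt 2 * (cos (real k * pi * x) * (real k * pi))) (at x)" for x
    by (auto intro!: derivative_eq_intros)
  from has_vector_derivative_of_real[OF this]
  show "(\<phi> k has_vector_derivative d x) (at x)" for x
    unfolding \<phi>_def[abs_def] d_def by simp
  have "((\<lambda>x. sqrt 2 * (cos (real k * pi * x) * (real k * pi))) has_real_derivative
      - (eigval k * (sqrt 2 * sin (real k * pi * x)))) (at x)" for x
    unfolding eigval_def
    by (auto intro!: derivative_eq_intros simp: power2_eq_square)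
  from has_vector_derivative_of_real[OF this]
  show "(d has_vector_derivative - (complex_of_real (eigval k) * \<phi> k x)) (at x)" for x
    unfolding \<phi>_def d_def[abs_def] by simp
qed

text \<open>The functions \<open>\<phi> k\<close> with \<open>k \<ge> 1\<close> form a Hilbert basis of \<open>L\<^sup>2((0,1),\<complex>)\<close>
  of eigenfunctions of the positive self-adjoint operator \<open>A = -\<partial>\<^sub>x\<^sub>x\<close> with domain
  \<open>H\<^sup>2 \<inter> H\<^sup>1\<^sub>0\<close>, for the eigenvalues \<open>eigval k\<close>.  The powers of \<open>A\<close> and the unitary
  group \<open>exp (- \<i> A t)\<close> are given by the functional calculus of \<open>A\<close> in this basis:
  \<open>dom_A_powr s\<close> is the domain of \<open>A\<close> to the power \<open>s\<close>.\<close>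

definition dom_A_powr :: "real \<Rightarrow> (real \<Rightarrow> complex) set" where
  "dom_A_powr s = {f. L2 0 1 f \<and>
     (\<lambda>k. (cmod (complex_of_real (eigval k powr s) * ip f (\<phi> k)))\<^sup>2) summable_on {1..}}"

abbreviation H30 :: "(real \<Rightarrow> complex) set" where
  "H30 \<equiv> dom_A_powr (3/2)"

definition H30norm :: "(real \<Rightarrow> complex) \<Rightarrow> real" where
  "H30norm f = sqrt (\<Sum>\<^sub>\<infinity>k\<in>{1..}. (cmod (of_nat (k ^ 3) * ip f (\<phi> k)))\<^sup>2)"

text \<open>A representative of \<open>exp (- \<i> A t) f\<close>, the sum of its eigenfunction expansion
  converging in \<open>L\<^sup>2\<close>; it is determined up to equality almost everywhere.\<close>

definition group_A :: "real \<Rightarrow> (real \<Rightarrow> complex) \<Rightarrow> real \<Rightarrow> complex" where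
  "group_A t f = (SOME g. L2 0 1 g \<and>
     (\<lambda>n. L2norm 0 1 (\<lambda>x. g x -
        (\<Sum>k=1..n. exp (- \<i> * complex_of_real (eigval k * t)) * ip f (\<phi> k) * \<phi> k x)))
     \<longlonglongrightarrow> 0)"


subsection \<open>Mild solutions\<close>

text \<open>\<open>I\<close> is the integral over \<open>(a,b)\<close> of the \<open>L\<^sup>2((0,1),\<complex>)\<close>-valued map \<open>F\<close>.  Since
  \<open>L\<^sup>2\<close> is separable, weak measurability is strong measurability by Pettis' theorem; together
  with integrability of the norm this is Bochner integrability, and the Bochner integral is the
  vector \<open>I\<close> singled out by the duality relation.\<close>

definition has_L2_integral ::
    "real \<Rightarrow> real \<Rightarrow> (real \<Rightarrow> real \<Rightarrow> complex) \<Rightarrow> (real \<Rightarrow> complex) \<Rightarrow> bool" where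
  "has_L2_integral a b F I \<longleftrightarrow> L2 0 1 I \<and>
     (AE \<tau> in lebesgue_on {a<..<b}. L2 0 1 (F \<tau>)) \<and>
     integrable (lebesgue_on {a<..<b}) (\<lambda>\<tau>. L2norm 0 1 (F \<tau>)) \<and>
     (\<forall>g. L2 0 1 g \<longrightarrow> integrable (lebesgue_on {a<..<b}) (\<lambda>\<tau>. ip (F \<tau>) g) \<and>
        ip I g = integral\<^sup>L (lebesgue_on {a<..<b}) (\<lambda>\<tau>. ip (F \<tau>) g))"

text \<open>The integrand \<open>u(\<tau>) \<mu> \<psi>(\<tau>)\<close> does not take values in \<open>H30\<close> in general (the second
  derivative of \<open>\<mu> \<psi>(\<tau>)\<close> need not vanish at the boundary), so the integral is taken in \<open>L\<^sup>2\<close>.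
  Both sides of the Duhamel formula lie in \<open>H30\<close> because \<open>\<psi> t\<close> does.\<close>

definition mild_solution ::
    "real \<Rightarrow> (real \<Rightarrow> real) \<Rightarrow> (real \<Rightarrow> real) \<Rightarrow> (real \<Rightarrow> complex) \<Rightarrow> (real \<Rightarrow> real \<Rightarrow> complex) \<Rightarrow> bool"
  where
  "mild_solution T \<mu> u \<psi>\<^sub>0 \<psi> \<longleftrightarrow>
     (\<forall>t\<in>{0..T}. \<psi> t \<in> H30) \<and>
     (\<forall>t\<in>{0..T}. ((\<lambda>s. H30norm (\<lambda>x. \<psi> s x - \<psi> t x)) \<longlongrightarrow> 0) (at t within {0..T})) \<and>
     (\<forall>t\<in>{0..T}. \<exists>I.
        has_L2_integral 0 t
          (\<lambda>\<tau>. group_A (t - \<tau>)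
             (\<lambda>x. complex_of_real (u \<tau>) * complex_of_real (\<mu> x) * \<psi> \<tau> x)) I \<and>
        eq_ae (\<psi> t) (\<lambda>x. group_A t \<psi>\<^sub>0 x + \<i> * I x))"


subsection \<open>The coefficients of the statement\<close>

text \<open>The inner products below are real numbers.\<close>

definition diag :: "(real \<Rightarrow> real) \<Rightarrow> nat \<Rightarrow> real" where
  "diag \<mu> k = Re (ip (\<lambda>x. complex_of_real (\<mu> x) * \<phi> k x) (\<phi> k))"

lemma of_real_diag:
  "complex_of_real (diag \<mu> k) = ip (\<lambda>x. complex_of_real (\<mu> x) * \<phi> k x) (\<phi> k)"
proof -
  have "(\<lambda>x. complex_of_real (\<mu> x) * \<phi> k x * cnj (\<phi> k x)) =
      (\<lambda>x. complex_of_real (\<mu> x * (sqrt 2 * sin (real k * pi * x))\<^sup>2))"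
    by (simp add: \<phi>_def power2_eq_square mult_ac)
  then show ?thesis
    by (simp add: diag_def ip_def del: of_real_mult of_real_power)
qed

definition coeff_A :: "(real \<Rightarrow> real) \<Rightarrow> (real \<Rightarrow> real) \<Rightarrow> real" where
  "coeff_A \<mu> \<mu>' =
     diag \<mu> 1 * diag (\<lambda>x. (\<mu>' x)\<^sup>2) 2 - diag \<mu> 2 * diag (\<lambda>x. (\<mu>' x)\<^sup>2) 1"

end

theory Submission
  imports Defs
begin

text \<open>Let \<open>s\<close> be the primitive of the control with \<open>s 0 = 0\<close> and let \<open>M\<close> be the \<open>C\<^sup>2\<close>
  representative of \<open>\<mu>\<close>.  Instead of expanding the solution \<open>\<psi>\<^sup>j\<close> in powers of \<open>u\<close>, compare it with
  \<open>\<Theta> = exp (\<i> s M) \<Phi>\<^sub>j\<close>.  This function solves the same equation up to the source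
  \<open>R = \<Theta>'' + \<lambda>\<^sub>j \<Theta>\<close>, which does not contain \<open>u\<close> and is bounded in \<open>L\<^sup>2\<close> by a multiple of \<open>\<bar>s\<bar>\<close>.
  Since the Schroedinger operator is symmetric, \<open>\<langle>\<psi>\<^sup>j, \<Theta>\<rangle>(T) = 1 + \<i> \<integral> \<langle>\<psi>\<^sup>j, R\<rangle>\<close>, and a direct
  computation gives \<open>\<langle>\<Theta>, R\<rangle> = - s\<^sup>2 D\<^sub>j\<close> with \<open>D\<^sub>j = \<langle>(M')\<^sup>2 \<phi>\<^sub>j, \<phi>\<^sub>j\<rangle>\<close>.  As \<open>\<psi>\<^sup>j\<close> has norm 1, the
  same identity bounds \<open>\<parallel>\<psi>\<^sup>j - \<Theta>\<parallel>\<close> by \<open>2 \<integral> \<parallel>R\<parallel>\<close>, so that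
  \<open>\<langle>\<psi>\<^sup>j, \<Theta>\<rangle>(T) = 1 - \<i> D\<^sub>j S + O(T S)\<close> where \<open>S = \<integral> s\<^sup>2\<close>.  If \<open>\<psi>\<^sup>j(T) = c\<^sub>j \<Phi>\<^sub>j(T)\<close>, the left side is
  \<open>c\<^sub>j (1 - \<i> s(T) d\<^sub>j + O(s(T)\<^sup>2))\<close> with \<open>d\<^sub>j = \<langle>M \<phi>\<^sub>j, \<phi>\<^sub>j\<rangle>\<close>.  For \<open>j = 1\<close> and \<open>c\<^sub>1 = 1\<close> this gives
  \<open>d\<^sub>1 s(T) = D\<^sub>1 S + o(S)\<close>; inserting it for \<open>j = 2\<close> yields
  \<open>d\<^sub>1 Im c\<^sub>2 = - (d\<^sub>1 D\<^sub>2 - d\<^sub>2 D\<^sub>1) S + o(S)\<close>, which determines the sign of \<open>Im c\<^sub>2\<close>.\<close>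

subsection \<open>Primitives of integrable functions\<close>

text \<open>The obstacle is low regularity in time: \<open>u\<close> is only square integrable, so
  expanding in powers of \<open>u\<close> leaves remainders measured in \<open>u\<close>, while the
  decisive quantity is the integral of \<open>s\<^sup>2\<close>, which may be far smaller. In
  \<open>\<Theta>\<close> the control is absorbed exactly, and every remainder is measured in
  \<open>s\<close>. Two cancellations make this sharp enough. The part of \<open>R\<close> linear in
  \<open>s\<close> contributes to the pairing of \<open>\<Theta>\<close> and \<open>R\<close> only
  the integral of the derivative of \<open>M' * \<phi>\<^sub>j\<^sup>2\<close>, which is zero by the
  boundary condition. The quadratic term that is left is real, so it enters the overlap as an
  imaginary number and leaves the real part alone, which is all that the distance of two unit
  vectors depends on. Hence this distance is of the order of the integral of |s|, and Cauchy-Schwarz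
  supplies the factor \<open>T\<close> in the remainder. \<open>\<Theta>\<close> vanishes at the
  boundary but its second derivative need not, so it is in general outside \<open>H30\<close>; this
  is why both functions are paired through their sine coefficients, where the eigenvalues cancel
  before any limit is taken.\<close>

abbreviation leb :: "real \<Rightarrow> real \<Rightarrow> real measure" where
  "leb a b \<equiv> lebesgue_on {a<..<b}"

abbreviation lint ::
    "real \<Rightarrow> real \<Rightarrow> (real \<Rightarrow> 'a) \<Rightarrow> 'a::{banach,second_countable_topology}" where
  "lint a b \<equiv> integral\<^sup>L (leb a b)"

lemma AE_leb_cong: "AE x in leb a b. P x" if "\<And>x. a < x \<Longrightarrow> x < b \<Longrightarrow> P x"
  using that by (auto intro!: AE_I2)

lemma integrable_lebesgue_on_subset:
  fixes f :: "real \<Rightarrow> 'a::{banach,second_countable_topology}"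
  assumes "integrable (lebesgue_on S) f" "A \<subseteq> S" "A \<in> sets lebesgue" "S \<in> sets lebesgue"
  shows "integrable (lebesgue_on A) f"
proof -
  have "set_integrable lebesgue S f"
    using assms by (simp add: integrable_restrict_space set_integrable_def)
  from set_integrable_subset[OF this assms(3,2)] show ?thesis
    using assms by (simp add: integrable_restrict_space set_integrable_def)
qed

lemma integrable_leb_subset:
  fixes f :: "real \<Rightarrow> 'a::{banach,second_countable_topology}"
  assumes "integrable (leb a b) f" "a \<le> c" "d \<le> b"
  shows "integrable (leb c d) f"
  by (rule integrable_lebesgue_on_subset[OF assms(1)]) (use assms in auto)

lemma integral_leb_split:
  fixes f :: "real \<Rightarrow> 'a::{banach,second_countable_topology}"
  assumes "integrable (leb a b) f" "a \<le> c" "c \<le> b"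
  shows "lint a b f = lint a c f + lint c b f"
proof -
  have i: "set_integrable lebesgue {a<..<c} f" "set_integrable lebesgue {c<..<b} f"
    using integrable_leb_subset[OF assms(1), of a c] integrable_leb_subset[OF assms(1), of c b] assms
    by (simp_all add: integrable_restrict_space set_integrable_def)
  have "lint a b f = integral\<^sup>L lebesgue (\<lambda>x. indicator {a<..<b} x *\<^sub>R f x)"
    by (rule integral_restrict_space) auto
  also have "\<dots> = integral\<^sup>L lebesgue (\<lambda>x. indicator ({a<..<c} \<union> {c<..<b}) x *\<^sub>R f x)"
  proof (rule integral_cong_AE)
    show "(\<lambda>x. indicator {a<..<b} x *\<^sub>R f x) \<in> borel_measurable lebesgue"
      using assms(1) by (simp add: integrable_restrict_space)
    show "(\<lambda>x. indicator ({a<..<c} \<union> {c<..<b}) x *\<^sub>R f x) \<in> borel_measurable lebesgue"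
      using set_integrable_Un[OF i] unfolding set_integrable_def
      by (rule borel_measurable_integrable[OF _]) auto
    \<comment> \<open>Open intervals drop their endpoints, so the two pieces miss at most the null
      point \<open>c\<close>.\<close>
    have "AE x in lebesgue. x \<noteq> c"
      by (rule AE_not_in[of "{c}", simplified]) auto
    then show "AE x in lebesgue. indicator {a<..<b} x *\<^sub>R f x
        = indicator ({a<..<c} \<union> {c<..<b}) x *\<^sub>R f x"
      by eventually_elim (use assms in \<open>auto simp: indicator_def\<close>)
  qed
  also have "\<dots> = lint a c f + lint c b f"
    using set_integral_Un[OF _ i] by (auto simp: set_lebesgue_integral_def integral_restrict_space)
  finally show ?thesis .
qed

lemma integral_leb_refl [simp]:
  fixes f :: "real \<Rightarrow> 'a::{banach,second_countable_topology}"
  shows "lint a a f = 0"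
  by simp

lemma measure_leb: "a \<le> b \<Longrightarrow> measure (leb a b) {a<..<b} = b - a"
  by (simp add: measure_restrict_space)

lemma finite_measure_leb: "finite_measure (leb a b)"
  by (rule finite_measure_lebesgue_on) auto

lemma integrable_leb_const [simp]: "integrable (leb a b) (\<lambda>x. c::'a::{banach,second_countable_topology})"
proof -
  interpret finite_measure "leb a b" by (rule finite_measure_leb)
  show ?thesis by simp
qed

lemma integral_leb_const: "a \<le> b \<Longrightarrow> lint a b (\<lambda>x. c::real) = (b - a) * c"
  by (simp add: measure_leb)

lemma borel_measurable_continuous_leb:
  fixes f :: "real \<Rightarrow> 'a::euclidean_space"
  assumes "continuous_on {a..b} f"
  shows "f \<in> borel_measurable (leb a b)"
  by (rule continuous_imp_measurable_on_sets_lebesgue)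
    (auto intro: continuous_on_subset[OF assms])

lemma integrable_leb_bounded:
  fixes f :: "real \<Rightarrow> 'a::{banach,second_countable_topology}"
  assumes "f \<in> borel_measurable (leb a b)" "\<And>x. a < x \<Longrightarrow> x < b \<Longrightarrow> norm (f x) \<le> B"
  shows "integrable (leb a b) f"
proof (rule Bochner_Integration.integrable_bound[of _ "\<lambda>_. B"])
  show "AE x in leb a b. norm (f x) \<le> norm B"
    by (rule AE_leb_cong) (use assms(2) in force)
qed (use assms in auto)

lemma continuous_bound_Icc:
  fixes g :: "real \<Rightarrow> 'a::real_normed_vector"
  assumes "continuous_on {a..b} g"
  obtains B where "B \<ge> 0" "\<And>y. y \<in> {a..b} \<Longrightarrow> norm (g y) \<le> B"
proof -
  have "bounded (g ` {a..b})" using compact_continuous_image[OF assms] compact_imp_bounded by blast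
  then obtain B where "\<And>y. y \<in> {a..b} \<Longrightarrow> norm (g y) \<le> B" unfolding bounded_iff by blast
  then show thesis using that[of "\<bar>B\<bar>"] by force
qed

lemma integrable_continuous_leb:
  fixes f :: "real \<Rightarrow> 'a::euclidean_space"
  assumes "continuous_on {a..b} f"
  shows "integrable (leb a b) f"
proof -
  obtain B where "\<And>x. x \<in> {a..b} \<Longrightarrow> norm (f x) \<le> B"
    using continuous_bound_Icc[OF assms] by blast
  then show ?thesis
    by (intro integrable_leb_bounded[of _ _ _ B] borel_measurable_continuous_leb assms) auto
qed

lemma integrable_mult_continuous:
  fixes f g :: "real \<Rightarrow> 'a::{real_normed_field,euclidean_space}"
  assumes f: "integrable (leb a b) f" and g: "continuous_on {a..b} g"
  shows "integrable (leb a b) (\<lambda>x. f x * g x)"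
proof -
  obtain B where B: "B \<ge> 0" "\<And>x. x \<in> {a..b} \<Longrightarrow> norm (g x) \<le> B"
    using continuous_bound_Icc[OF g] by blast
  show ?thesis
  proof (rule Bochner_Integration.integrable_bound)
    show "integrable (leb a b) (\<lambda>x. B * norm (f x))" using f by simp
    show "(\<lambda>x. f x * g x) \<in> borel_measurable (leb a b)"
      using f borel_measurable_continuous_leb[OF g] by auto
    show "AE x in leb a b. norm (f x * g x) \<le> norm (B * norm (f x))"
      by (rule AE_leb_cong) (use B in \<open>simp add: norm_mult mult.commute[of B] mult_left_mono\<close>)
  qed
qed

text \<open>Continuity is taken over from the Henstock-Kurzweil indefinite integral, which has the
  same values here.\<close>

lemma continuous_on_integral_leb:
  fixes f :: "real \<Rightarrow> 'a::euclidean_space"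
  assumes "integrable (leb a b) f"
  shows "continuous_on {a..b} (\<lambda>t. lint a t f)"
proof -
  have fi: "f integrable_on {a<..<b}"
    by (rule integrable_on_lebesgue_on) (use assms in auto)
  then have "continuous_on {a..b} (\<lambda>t. integral {a..t} f)"
    by (intro indefinite_integral_continuous_1) (simp add: integrable_on_Icc_iff_Ioo)
  moreover have "lint a t f = integral {a..t} f" if "t \<in> {a..b}" for t
    using lebesgue_integral_eq_integral[OF integrable_leb_subset[OF assms, of a t]] that
    by (simp add: integral_open_interval_real)
  ultimately show ?thesis
    by (metis (no_types, lifting) continuous_on_eq)
qed

lemma norm_integral_leb_le:
  fixes f :: "real \<Rightarrow> 'a::euclidean_space"
  assumes "integrable (leb a b) g" "f \<in> borel_measurable (leb a b)"
    "\<And>x. a < x \<Longrightarrow> x < b \<Longrightarrow> norm (f x) \<le> g x"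
  shows "norm (lint a b f) \<le> lint a b g"
proof -
  have "integrable (leb a b) f"
    by (rule Bochner_Integration.integrable_bound[OF assms(1,2)]) (use assms(3) in \<open>force intro!: AE_I2\<close>)
  then have "norm (lint a b f) \<le> lint a b (\<lambda>x. norm (f x))"
    by simp
  also have "\<dots> \<le> lint a b g"
    by (rule integral_mono) (use assms \<open>integrable (leb a b) f\<close> in auto)
  finally show ?thesis .
qed

text \<open>Summing the hypothesis over \<open>n\<close> pieces of equal \<open>\<nu>\<close>-length bounds the total
  increment by \<open>C (\<nu> b - \<nu> a)\<^sup>2 / n\<close>.  The lemma replaces differentiation almost everywhere in the
  proofs of the product and chain rules for primitives of integrable functions.\<close>

lemma constant_if_quadratic_increments:
  fixes H :: "real \<Rightarrow> 'a::real_normed_vector" and \<nu> :: "real \<Rightarrow> real"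
  assumes ab: "a \<le> b" and cont: "continuous_on {a..b} \<nu>"
    and mono: "\<And>s t. a \<le> s \<Longrightarrow> s < t \<Longrightarrow> t \<le> b \<Longrightarrow> \<nu> s < \<nu> t"
    and bound: "\<And>s t. a \<le> s \<Longrightarrow> s < t \<Longrightarrow> t \<le> b \<Longrightarrow> norm (H t - H s) \<le> C * (\<nu> t - \<nu> s)\<^sup>2"
  shows "H b = H a"
proof (cases "a = b")
  case False
  with ab have ab: "a < b" by simp
  define \<Delta> where "\<Delta> = \<nu> b - \<nu> a"
  have \<Delta>: "\<Delta> > 0" using mono[of a b] ab by (simp add: \<Delta>_def)
  have key: "norm (H b - H a) \<le> C * \<Delta>\<^sup>2 * (1 / real n)" if n: "n > 0" for n :: nat
  proof -
    have "\<exists>x. a \<le> x \<and> x \<le> b \<and> \<nu> x = \<nu> a + real i * \<Delta> / real n" if "i \<le> n" for i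
    proof (rule IVT')
      show "\<nu> a \<le> \<nu> a + real i * \<Delta> / real n" using \<Delta> by simp
      have "real i * \<Delta> / real n \<le> \<Delta>" using that n \<Delta> by (simp add: field_simps)
      then show "\<nu> a + real i * \<Delta> / real n \<le> \<nu> b" by (simp add: \<Delta>_def)
    qed (use ab cont in auto)
    then have "\<forall>i. \<exists>x. i \<le> n \<longrightarrow> a \<le> x \<and> x \<le> b \<and> \<nu> x = \<nu> a + real i * \<Delta> / real n"
      by blast
    from choice[OF this]
    obtain x where x: "\<And>i. i \<le> n \<Longrightarrow> a \<le> x i \<and> x i \<le> b \<and> \<nu> (x i) = \<nu> a + real i * \<Delta> / real n"
      by blast
    \<comment> \<open>The cut points are known by their \<open>\<nu>\<close>-height only;
      injectivity of \<open>\<nu>\<close> identifies the first with \<open>a\<close> and the last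
      with \<open>b\<close>.\<close>
    have inj: "p = q" if "a \<le> p" "p \<le> b" "a \<le> q" "q \<le> b" "\<nu> p = \<nu> q" for p q
      using mono[of p q] mono[of q p] that by (cases p q rule: linorder_cases) auto
    have x0: "x 0 = a" by (rule inj) (use x[of 0] ab in auto)
    have xn: "x n = b" by (rule inj) (use x[of n] ab n in \<open>auto simp: \<Delta>_def\<close>)
    have step: "norm (H (x (Suc i)) - H (x i)) \<le> C * (\<Delta> / real n)\<^sup>2" if "i < n" for i
    proof -
      have d: "\<nu> (x (Suc i)) - \<nu> (x i) = \<Delta> / real n"
        using x[of i] x[of "Suc i"] that by (simp add: field_simps)
      have "x i < x (Suc i)"
      proof (rule ccontr)
        assume "\<not> x i < x (Suc i)"
        then have "\<nu> (x (Suc i)) \<le> \<nu> (x i)"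
          using mono[of "x (Suc i)" "x i"] x[of i] x[of "Suc i"] that
          by (cases "x (Suc i) = x i") auto
        moreover have "\<Delta> / real n > 0" using \<Delta> n by simp
        ultimately show False using d by simp
      qed
      with bound[of "x i" "x (Suc i)"] x[of i] x[of "Suc i"] that d show ?thesis by simp
    qed
    have "H b - H a = (\<Sum>i<n. H (x (Suc i)) - H (x i))"
      using sum_lessThan_telescope[of "\<lambda>i. H (x i)" n] x0 xn by simp
    then have "norm (H b - H a) \<le> (\<Sum>i<n. norm (H (x (Suc i)) - H (x i)))"
      by (simp add: norm_sum)
    also have "\<dots> \<le> (\<Sum>i<n. C * (\<Delta> / real n)\<^sup>2)"
      by (intro sum_mono) (use step in auto)
    also have "\<dots> = C * \<Delta>\<^sup>2 * (1 / real n)"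
      using n by (simp add: power2_eq_square field_simps)
    finally show ?thesis .
  qed
  have "(\<lambda>n. C * \<Delta>\<^sup>2 * (1 / real n)) \<longlonglongrightarrow> C * \<Delta>\<^sup>2 * 0"
    by (intro tendsto_intros lim_1_over_n)
  then have "norm (H b - H a) \<le> C * \<Delta>\<^sup>2 * 0"
    by (rule LIMSEQ_le_const) (use key in \<open>auto intro: exI[of _ 1]\<close>)
  then show ?thesis by simp
qed simp

definition primitive_on :: "real \<Rightarrow> (real \<Rightarrow> 'a) \<Rightarrow> (real \<Rightarrow> 'a::{banach,second_countable_topology}) \<Rightarrow> bool" where
  "primitive_on T f f' \<longleftrightarrow> integrable (leb 0 T) f' \<and>
     (\<forall>t\<in>{0..T}. f t = f 0 + lint 0 t f')"

lemma primitive_onD: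
  assumes "primitive_on T f f'"
  shows "integrable (leb 0 T) f'" "\<And>t. 0 \<le> t \<Longrightarrow> t \<le> T \<Longrightarrow> f t = f 0 + lint 0 t f'"
proof -
  note d = assms[unfolded primitive_on_def]
  show "integrable (leb 0 T) f'" using conjunct1[OF d] .
  show "f t = f 0 + lint 0 t f'" if "0 \<le> t" "t \<le> T" for t
    by (rule bspec[OF conjunct2[OF d]]) (use that in simp)
qed

text \<open>The second premise is shaped like the conclusion of
  \<open>constant_if_quadratic_increments\<close> for \<open>f t\<close> minus the integral of the
  candidate density; the vanishing term at 0 is kept to match it literally.\<close>

lemma primitive_onI:
  assumes "integrable (leb 0 T) f'"
    "\<And>t. 0 \<le> t \<Longrightarrow> t \<le> T \<Longrightarrow> f t - lint 0 t f' = f 0 - lint 0 0 f'"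
  shows "primitive_on T f f'"
  unfolding primitive_on_def
proof (intro conjI ballI)
  fix t assume "t \<in> {0..T}"
  then have "f t - lint 0 t f' = f 0" using assms(2)[of t] by simp
  then show "f t = f 0 + lint 0 t f'" by (simp add: diff_eq_eq)
qed (rule assms(1))

lemma primitive_on_increment:
  assumes "primitive_on T f f'" "0 \<le> s" "s \<le> t" "t \<le> T"
  shows "f t - f s = lint s t f'"
proof -
  have "integrable (leb 0 t) f'"
    using primitive_onD(1)[OF assms(1)] by (rule integrable_leb_subset) (use assms in auto)
  from integral_leb_split[OF this assms(2,3)] show ?thesis
    using primitive_onD(2)[OF assms(1), of t] primitive_onD(2)[OF assms(1), of s] assms by simp
qed

lemma primitive_on_continuous:
  fixes f :: "real \<Rightarrow> 'a::euclidean_space"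
  assumes "primitive_on T f f'"
  shows "continuous_on {0..T} f"
proof -
  have "continuous_on {0..T} (\<lambda>t. f 0 + lint 0 t f')"
    by (rule continuous_on_add[OF continuous_on_const
          continuous_on_integral_leb[OF primitive_onD(1)[OF assms]]])
  moreover have "f 0 + lint 0 t f' = f t" if "t \<in> {0..T}" for t
    by (rule primitive_onD(2)[OF assms, symmetric]) (use that in auto)
  ultimately show ?thesis
    by (rule continuous_on_eq)
qed

lemma primitive_on_const: "primitive_on T (\<lambda>_. c) (\<lambda>_. 0)"
  by (auto simp: primitive_on_def)

lemma primitive_on_integral:
  "integrable (leb 0 T) f' \<Longrightarrow> primitive_on T (\<lambda>t. c + lint 0 t f') f'"
  by (auto simp: primitive_on_def)

lemma primitive_on_add:
  assumes "primitive_on T f f'" "primitive_on T g g'"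
  shows "primitive_on T (\<lambda>t. f t + g t) (\<lambda>t. f' t + g' t)"
  unfolding primitive_on_def
proof (intro conjI ballI)
  note i = primitive_onD(1)[OF assms(1)] primitive_onD(1)[OF assms(2)]
  show "integrable (leb 0 T) (\<lambda>t. f' t + g' t)" using i by simp
  fix t assume t: "t \<in> {0..T}"
  have "integrable (leb 0 t) f'" "integrable (leb 0 t) g'"
    using i t by (auto intro: integrable_leb_subset)
  then show "f t + g t = f 0 + g 0 + lint 0 t (\<lambda>t. f' t + g' t)"
    using primitive_onD(2)[OF assms(1), of t] primitive_onD(2)[OF assms(2), of t] t by simp
qed

lemma primitive_on_bounded_linear:
  assumes "primitive_on T f f'" and L: "bounded_linear L"
  shows "primitive_on T (\<lambda>t. L (f t)) (\<lambda>t. L (f' t))"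
  unfolding primitive_on_def
proof (intro conjI ballI)
  note i = primitive_onD(1)[OF assms(1)]
  show "integrable (leb 0 T) (\<lambda>t. L (f' t))" using integrable_bounded_linear[OF L i] .
  fix t assume t: "t \<in> {0..T}"
  have "integrable (leb 0 t) f'" using i t by (auto intro: integrable_leb_subset)
  then show "L (f t) = L (f 0) + lint 0 t (\<lambda>t. L (f' t))"
    using primitive_onD(2)[OF assms(1), of t] t
    by (simp add: integral_bounded_linear[OF L] linear_add[OF bounded_linear.linear[OF L]])
qed

lemma primitive_on_sum:
  assumes "\<And>i. i \<in> A \<Longrightarrow> primitive_on T (f i) (f' i)"
  shows "primitive_on T (\<lambda>t. \<Sum>i\<in>A. f i t) (\<lambda>t. \<Sum>i\<in>A. f' i t)"
  using assms
proof (induction A rule: infinite_finite_induct)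
  case (insert x F)
  then have "primitive_on T (\<lambda>t. f x t + (\<Sum>i\<in>F. f i t)) (\<lambda>t. f' x t + (\<Sum>i\<in>F. f' i t))"
    by (intro primitive_on_add) blast+
  then show ?case using insert by simp
qed (simp_all add: primitive_on_const)

lemma primitive_on_cong:
  assumes "primitive_on T f f'" "\<And>t. 0 \<le> t \<Longrightarrow> t \<le> T \<Longrightarrow> g t = f t"
    "\<And>t. 0 < t \<Longrightarrow> t < T \<Longrightarrow> g' t = f' t"
  shows "primitive_on T g g'"
  unfolding primitive_on_def
proof (intro conjI ballI)
  show "integrable (leb 0 T) g'"
    using primitive_onD(1)[OF assms(1)]
    by (subst Bochner_Integration.integrable_cong[OF refl, of "leb 0 T" g' f']) (use assms(3) in auto)
  fix t assume t: "t \<in> {0..T}"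
  have "lint 0 t g' = lint 0 t f'"
    by (rule Bochner_Integration.integral_cong) (use assms(3) t in auto)
  then show "g t = g 0 + lint 0 t g'"
    using primitive_onD(2)[OF assms(1), of t] assms(2)[of t] assms(2)[of 0] t by auto
qed

text \<open>The gauge \<open>\<nu>\<close> in which all the functions at hand are Lipschitz.\<close>

lemma gauge_integral:
  assumes h: "integrable (leb 0 T) h" and h0: "\<And>t. 0 < t \<Longrightarrow> t < T \<Longrightarrow> 0 \<le> (h t::real)"
    and \<nu>_def: "\<nu> = (\<lambda>t. t + lint 0 t h)"
  shows "continuous_on {0..T} \<nu>"
    and "\<And>s t. 0 \<le> s \<Longrightarrow> s < t \<Longrightarrow> t \<le> T \<Longrightarrow> \<nu> s < \<nu> t"
    and "\<And>s t. 0 \<le> s \<Longrightarrow> s \<le> t \<Longrightarrow> t \<le> T \<Longrightarrow> lint s t h \<le> \<nu> t - \<nu> s"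
    and "\<And>s t. 0 \<le> s \<Longrightarrow> s \<le> t \<Longrightarrow> t \<le> T \<Longrightarrow> 0 \<le> lint s t h"
proof -
  show "continuous_on {0..T} \<nu>"
    unfolding \<nu>_def by (intro continuous_on_add continuous_on_id continuous_on_integral_leb[OF h])
  have nn: "0 \<le> lint s t h" if "0 \<le> s" "t \<le> T" for s t
    by (rule integral_nonneg_AE, rule AE_leb_cong) (use h0 that in auto)
  have eq: "\<nu> t - \<nu> s = t - s + lint s t h" if "0 \<le> s" "s \<le> t" "t \<le> T" for s t
    using integral_leb_split[OF integrable_leb_subset[OF h order_refl that(3)] that(1,2)]
    by (simp add: \<nu>_def)
  fix s t :: real assume st: "0 \<le> s" "t \<le> T"
  show "s < t \<Longrightarrow> \<nu> s < \<nu> t" using eq[of s t] nn[of s t] st by auto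
  show "s \<le> t \<Longrightarrow> lint s t h \<le> \<nu> t - \<nu> s" using eq[of s t] st by auto
  show "s \<le> t \<Longrightarrow> 0 \<le> lint s t h" using nn st by auto
qed

text \<open>Measured in \<open>\<nu>\<close>, both factors are Lipschitz, so the product minus the
  integral of the expected density has increments of second order and is constant.\<close>

lemma primitive_on_mult:
  fixes f g :: "real \<Rightarrow> 'a::{real_normed_field,euclidean_space}"
  assumes f: "primitive_on T f f'" and g: "primitive_on T g g'"
  shows "primitive_on T (\<lambda>t. f t * g t) (\<lambda>t. f' t * g t + f t * g' t)"
proof -
  note fi = primitive_onD(1)[OF f] and gi = primitive_onD(1)[OF g]
  note fc = primitive_on_continuous[OF f] and gc = primitive_on_continuous[OF g]
  have i1: "integrable (leb 0 T) (\<lambda>t. f' t * g t)" by (rule integrable_mult_continuous[OF fi gc])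
  have i2: "integrable (leb 0 T) (\<lambda>t. f t * g' t)"
    using integrable_mult_continuous[OF gi fc] by (simp add: mult.commute)
  define k where "k = (\<lambda>t. f' t * g t + f t * g' t)"
  have k: "integrable (leb 0 T) k" unfolding k_def using i1 i2 by simp
  define h where "h = (\<lambda>t. norm (f' t) + norm (g' t))"
  have hi: "integrable (leb 0 T) h" unfolding h_def using fi gi by simp
  \<comment> \<open>The summand \<open>t\<close> keeps \<open>\<nu>\<close> strictly increasing
    where both densities vanish.\<close>
  define \<nu> where "\<nu> = (\<lambda>t. t + lint 0 t h)"
  have h0: "0 \<le> h t" for t by (simp add: h_def)
  note \<nu> = gauge_integral[OF hi h0 \<nu>_def]
  have inc: "norm (q t - q \<tau>) \<le> \<nu> b - \<nu> a"
    if q: "primitive_on T q q'" and le: "\<And>t. norm (q' t) \<le> h t"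
      and o: "0 \<le> a" "a \<le> \<tau>" "\<tau> \<le> t" "t \<le> b" "b \<le> T"
    for q q' :: "real \<Rightarrow> 'a" and a \<tau> t b
  proof -
    have "norm (q t - q \<tau>) = norm (lint \<tau> t q')"
      using primitive_on_increment[OF q, of \<tau> t] o by simp
    also have "\<dots> \<le> lint \<tau> t h"
      using o le integrable_leb_subset[OF primitive_onD(1)[OF q], of \<tau> t]
      by (intro norm_integral_leb_le integrable_leb_subset[OF hi]) auto
    also have "\<dots> \<le> \<nu> t - \<nu> \<tau>" using \<nu>(3) o by auto
    also have "\<dots> \<le> \<nu> b - \<nu> a"
      using \<nu>(2)[of t b] \<nu>(2)[of a \<tau>] o by (smt (verit))
    finally show ?thesis .
  qed
  have "f t * g t - lint 0 t k = f 0 * g 0 - lint 0 0 k" if t: "0 \<le> t" "t \<le> T" for t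
  proof (rule constant_if_quadratic_increments[where H = "\<lambda>t. f t * g t - lint 0 t k" and \<nu> = \<nu> and C = 1])
    show "continuous_on {0..t} \<nu>" using \<nu>(1) t by (auto intro: continuous_on_subset)
    show "\<nu> a < \<nu> b" if "0 \<le> a" "a < b" "b \<le> t" for a b using \<nu>(2) that t by auto
    fix a b assume ab: "0 \<le> a" "a < b" "b \<le> t"
    then have bT: "b \<le> T" using t by simp
    note sub = integrable_leb_subset[where a = 0 and b = T and c = a and d = b, OF _ ab(1) bT]
    have kab: "lint 0 b k - lint 0 a k = lint a b k"
      using integral_leb_split[OF integrable_leb_subset[OF k order_refl bT], of a] ab by simp
    \<comment> \<open>Freezing \<open>g\<close> at \<open>b\<close> and \<open>f\<close> at
      \<open>a\<close> gives an integrand that differs from \<open>k\<close> only by increments of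
      \<open>f\<close> or \<open>g\<close> times a density; integrating such products yields the
      square of the \<open>\<nu>\<close>-increment.\<close>
    have "f b * g b - f a * g a = (f b - f a) * g b + f a * (g b - g a)"
      by (simp add: algebra_simps)
    also have "\<dots> = lint a b (\<lambda>\<tau>. f' \<tau> * g b + f a * g' \<tau>)"
      using primitive_on_increment[OF f, of a b] primitive_on_increment[OF g, of a b] ab bT
        sub[OF fi] sub[OF gi] by simp
    finally have fg: "f b * g b - f a * g a = lint a b (\<lambda>\<tau>. f' \<tau> * g b + f a * g' \<tau>)" .
    have "(f b * g b - lint 0 b k) - (f a * g a - lint 0 a k)
        = lint a b (\<lambda>\<tau>. f' \<tau> * g b + f a * g' \<tau>) - lint a b k"
      unfolding fg[symmetric] kab[symmetric] by (simp only: diff_diff_eq2 diff_diff_eq ac_simps add_diff_eq diff_add_eq)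
    also have "\<dots> = lint a b (\<lambda>\<tau>. f' \<tau> * g b + f a * g' \<tau> - k \<tau>)"
      using sub[OF fi] sub[OF gi] sub[OF k] by simp
    also have "norm \<dots> \<le> lint a b (\<lambda>\<tau>. (\<nu> b - \<nu> a) * h \<tau>)"
    proof (rule norm_integral_leb_le)
      show "integrable (leb a b) (\<lambda>\<tau>. (\<nu> b - \<nu> a) * h \<tau>)" using sub[OF hi] by simp
      show "(\<lambda>\<tau>. f' \<tau> * g b + f a * g' \<tau> - k \<tau>) \<in> borel_measurable (leb a b)"
        using sub[OF fi] sub[OF gi] sub[OF k] by auto
      fix \<tau> assume \<tau>: "a < \<tau>" "\<tau> < b"
      have "f' \<tau> * g b + f a * g' \<tau> - k \<tau> = f' \<tau> * (g b - g \<tau>) - (f \<tau> - f a) * g' \<tau>"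
        by (simp add: k_def algebra_simps)
      also have "norm \<dots> \<le> norm (f' \<tau>) * norm (g b - g \<tau>) + norm (f \<tau> - f a) * norm (g' \<tau>)"
        by (metis norm_mult norm_triangle_ineq4)
      also have "\<dots> \<le> norm (f' \<tau>) * (\<nu> b - \<nu> a) + (\<nu> b - \<nu> a) * norm (g' \<tau>)"
        using inc[OF f, of a a \<tau> b] inc[OF g, of a \<tau> b b] ab \<tau> bT
        by (intro add_mono mult_left_mono mult_right_mono) (auto simp: h_def)
      also have "\<dots> = (\<nu> b - \<nu> a) * h \<tau>" by (simp add: h_def algebra_simps)
      finally show "norm (f' \<tau> * g b + f a * g' \<tau> - k \<tau>) \<le> (\<nu> b - \<nu> a) * h \<tau>" .
    qed
    also have "\<dots> = (\<nu> b - \<nu> a) * lint a b h" by simp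
    also have "\<dots> \<le> 1 * (\<nu> b - \<nu> a)\<^sup>2"
      using \<nu>(3)[of a b] \<nu>(4)[of a b] \<nu>(2)[of a b] ab bT
      by (simp add: power2_eq_square mult_left_mono)
    finally show "norm ((f b * g b - lint 0 b k) - (f a * g a - lint 0 a k))
        \<le> 1 * (\<nu> b - \<nu> a)\<^sup>2" .
  qed (use t in auto)
  with k show ?thesis
    unfolding k_def by (rule primitive_onI)
qed

text \<open>The two bounds on \<open>G\<close> express that its derivative is Lipschitz. In the
  application \<open>G x\<close> is a sine coefficient of the comparison function with parameter
  \<open>x\<close>, and both bounds come directly from the exponential.\<close>

lemma primitive_on_chain:
  fixes s u :: "real \<Rightarrow> real" and G G' :: "real \<Rightarrow> complex"
  assumes s: "primitive_on T s u"
    and G: "\<And>x y. norm (G y - G x - of_real (y - x) * G' x) \<le> C * (y - x)\<^sup>2"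
    and G': "\<And>x y. norm (G' y - G' x) \<le> C * \<bar>y - x\<bar>"
  shows "primitive_on T (\<lambda>t. G (s t)) (\<lambda>t. of_real (u t) * G' (s t))"
proof -
  have C: "C \<ge> 0" using norm_ge_zero[THEN order_trans, OF G'[of 1 0]] by simp
  note ui = primitive_onD(1)[OF s]
  note sc = primitive_on_continuous[OF s]
  have "C-lipschitz_on UNIV G'"
    using G' C by (intro lipschitz_onI) (auto simp: dist_norm)
  then have G'c: "continuous_on UNIV G'" by (rule lipschitz_on_continuous_on)
  have G's: "continuous_on {0..T} (\<lambda>t. G' (s t))"
    using continuous_on_compose2[OF G'c sc] by simp
  define k where "k = (\<lambda>t. of_real (u t) * G' (s t))"
  have k: "integrable (leb 0 T) k"
    unfolding k_def by (rule integrable_mult_continuous[OF _ G's]) (use ui in simp)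
  define h where "h = (\<lambda>t. \<bar>u t\<bar>)"
  have hi: "integrable (leb 0 T) h" unfolding h_def using ui by simp
  define \<nu> where "\<nu> = (\<lambda>t. t + lint 0 t h)"
  have h0: "0 \<le> h t" for t by (simp add: h_def)
  note \<nu> = gauge_integral[OF hi h0 \<nu>_def]
  have inc: "\<bar>s t - s a\<bar> \<le> \<nu> b - \<nu> a" if o: "0 \<le> a" "a \<le> t" "t \<le> b" "b \<le> T" for a t b
  proof -
    have "\<bar>s t - s a\<bar> = norm (lint a t u)"
      using primitive_on_increment[OF s, of a t] o by simp
    also have "\<dots> \<le> lint a t h"
      using o integrable_leb_subset[OF ui, of a t]
      by (intro norm_integral_leb_le integrable_leb_subset[OF hi]) (auto simp: h_def)
    also have "\<dots> \<le> \<nu> t - \<nu> a" using \<nu>(3) o by auto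
    also have "\<dots> \<le> \<nu> b - \<nu> a"
      using \<nu>(2)[of t b] o by (smt (verit))
    finally show ?thesis .
  qed
  have "G (s t) - lint 0 t k = G (s 0) - lint 0 0 k" if t: "0 \<le> t" "t \<le> T" for t
  proof (rule constant_if_quadratic_increments[where H = "\<lambda>t. G (s t) - lint 0 t k" and \<nu> = \<nu> and C = "2 * C"])
    show "continuous_on {0..t} \<nu>" using \<nu>(1) t by (auto intro: continuous_on_subset)
    show "\<nu> a < \<nu> b" if "0 \<le> a" "a < b" "b \<le> t" for a b using \<nu>(2) that t by auto
    fix a b assume ab: "0 \<le> a" "a < b" "b \<le> t"
    then have bT: "b \<le> T" using t by simp
    have \<nu>ab: "0 \<le> \<nu> b - \<nu> a" using \<nu>(2)[of a b] ab bT by simp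
    note sub = integrable_leb_subset[where a = 0 and b = T and c = a and d = b, OF _ ab(1) bT]
    have "lint 0 b k - lint 0 a k = lint a b k"
      using integral_leb_split[OF integrable_leb_subset[OF k order_refl bT], of a] ab by simp
    moreover have "of_real (s b - s a) * G' (s a) = lint a b (\<lambda>\<tau>. of_real (u \<tau>) * G' (s a))"
      using primitive_on_increment[OF s, of a b] ab bT sub[OF ui] by simp
    \<comment> \<open>The first part is the Taylor remainder of \<open>G\<close>, the second the
      variation of \<open>G'\<close> along \<open>s\<close>; each contributes one \<open>C\<close>,
      whence the constant \<open>2 * C\<close>.\<close>
    ultimately have "(G (s b) - lint 0 b k) - (G (s a) - lint 0 a k)
        = (G (s b) - G (s a) - of_real (s b - s a) * G' (s a))
          - (lint a b k - lint a b (\<lambda>\<tau>. of_real (u \<tau>) * G' (s a)))"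
      by (simp add: algebra_simps)
    also have "lint a b k - lint a b (\<lambda>\<tau>. of_real (u \<tau>) * G' (s a))
        = lint a b (\<lambda>\<tau>. k \<tau> - of_real (u \<tau>) * G' (s a))"
      using sub[OF k] sub[OF ui] by simp
    finally have "(G (s b) - lint 0 b k) - (G (s a) - lint 0 a k)
        = (G (s b) - G (s a) - of_real (s b - s a) * G' (s a))
          - lint a b (\<lambda>\<tau>. k \<tau> - of_real (u \<tau>) * G' (s a))" .
    then have "norm ((G (s b) - lint 0 b k) - (G (s a) - lint 0 a k))
        \<le> norm (G (s b) - G (s a) - of_real (s b - s a) * G' (s a))
          + norm (lint a b (\<lambda>\<tau>. k \<tau> - of_real (u \<tau>) * G' (s a)))"
      by (simp only: norm_triangle_ineq4)
    also have "norm (G (s b) - G (s a) - of_real (s b - s a) * G' (s a)) \<le> C * (\<nu> b - \<nu> a)\<^sup>2"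
    proof -
      have "(s b - s a)\<^sup>2 \<le> (\<nu> b - \<nu> a)\<^sup>2"
        using inc[of a b b] ab bT \<nu>ab by (metis abs_le_square_iff abs_of_nonneg less_imp_le order_refl)
      then show ?thesis using G[of "s b" "s a"] C by (meson mult_left_mono order_trans)
    qed
    also have "norm (lint a b (\<lambda>\<tau>. k \<tau> - of_real (u \<tau>) * G' (s a)))
        \<le> lint a b (\<lambda>\<tau>. C * (\<nu> b - \<nu> a) * h \<tau>)"
    proof (rule norm_integral_leb_le)
      show "integrable (leb a b) (\<lambda>\<tau>. C * (\<nu> b - \<nu> a) * h \<tau>)" using sub[OF hi] by simp
      show "(\<lambda>\<tau>. k \<tau> - of_real (u \<tau>) * G' (s a)) \<in> borel_measurable (leb a b)"
        using sub[OF ui] sub[OF k] by auto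
      fix \<tau> assume \<tau>: "a < \<tau>" "\<tau> < b"
      have "k \<tau> - of_real (u \<tau>) * G' (s a) = of_real (u \<tau>) * (G' (s \<tau>) - G' (s a))"
        by (simp add: k_def algebra_simps)
      also have "norm \<dots> = h \<tau> * norm (G' (s \<tau>) - G' (s a))"
        by (simp add: norm_mult h_def)
      also have "\<dots> \<le> h \<tau> * (C * (\<nu> b - \<nu> a))"
        using order_trans[OF G'[of "s \<tau>" "s a"] mult_left_mono[OF inc[of a \<tau> b] C]] ab \<tau> bT
        by (intro mult_left_mono) (auto simp: h_def)
      finally show "norm (k \<tau> - of_real (u \<tau>) * G' (s a)) \<le> C * (\<nu> b - \<nu> a) * h \<tau>"
        by (simp add: mult_ac)
    qed
    also have "\<dots> = C * (\<nu> b - \<nu> a) * lint a b h" by simp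
    also have "\<dots> \<le> C * (\<nu> b - \<nu> a) * (\<nu> b - \<nu> a)"
      using \<nu>(3)[of a b] C \<nu>ab ab bT by (intro mult_left_mono) auto
    finally show "norm ((G (s b) - lint 0 b k) - (G (s a) - lint 0 a k))
        \<le> 2 * C * (\<nu> b - \<nu> a)\<^sup>2" by (simp add: power2_eq_square algebra_simps)
  qed (use t in auto)
  with k show ?thesis
    unfolding k_def by (rule primitive_onI)
qed

text \<open>Also applied in the space variable with \<open>T = 1\<close>, where it provides
  integration by parts on the unit interval.\<close>

lemma primitive_on_FTC:
  fixes f :: "real \<Rightarrow> 'a::euclidean_space"
  assumes "\<And>x. (f has_vector_derivative f' x) (at x)" "continuous_on {0..T} f'"
  shows "primitive_on T f f'"
  unfolding primitive_on_def
proof (intro conjI ballI)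
  show "integrable (leb 0 T) f'" by (rule integrable_continuous_leb) fact
  fix t assume t: "t \<in> {0..T}"
  have "integrable (leb 0 t) f'"
    by (rule integrable_continuous_leb) (use assms(2) t in \<open>auto intro: continuous_on_subset\<close>)
  then have "lint 0 t f' = integral {0..t} f'"
    by (simp add: lebesgue_integral_eq_integral integral_open_interval_real)
  also have "\<dots> = f t - f 0"
    by (rule integral_unique, rule fundamental_theorem_of_calculus)
      (use t assms(1) in \<open>auto intro: has_vector_derivative_at_within\<close>)
  finally show "f t = f 0 + lint 0 t f'" by simp
qed

subsection \<open>Test functions\<close>

text \<open>Layering smoothness by order, with derivatives as witnesses, gives closure under
  products and affine substitutions by induction on the order, without any calculation of iterates
  of \<open>deriv\<close>. The lemma \<open>smooth_iff\<close> returns to the form in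
  \<open>test_function\<close>.\<close>

fun smooth_upto :: "nat \<Rightarrow> (real \<Rightarrow> real) \<Rightarrow> bool" where
  "smooth_upto 0 f \<longleftrightarrow> True"
| "smooth_upto (Suc n) f \<longleftrightarrow>
     (\<exists>f'. (\<forall>x. (f has_real_derivative f' x) (at x)) \<and> smooth_upto n f')"

definition smooth :: "(real \<Rightarrow> real) \<Rightarrow> bool" where
  "smooth f \<longleftrightarrow> (\<forall>n. smooth_upto n f)"

lemma smooth_upto_Suc: "smooth_upto (Suc n) f \<Longrightarrow> smooth_upto n f"
  by (induction n arbitrary: f) (auto 4 4)

lemma smooth_upto_add: "smooth_upto n f \<Longrightarrow> smooth_upto n g \<Longrightarrow> smooth_upto n (\<lambda>x. f x + g x)"
proof (induction n arbitrary: f g)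
  case (Suc n)
  then obtain f' g' where "\<And>x. (f has_real_derivative f' x) (at x)" "smooth_upto n f'"
      "\<And>x. (g has_real_derivative g' x) (at x)" "smooth_upto n g'" by auto
  with Suc.IH[of f' g'] show ?case
    by (auto intro!: exI[of _ "\<lambda>x. f' x + g' x"] derivative_eq_intros)
qed simp

lemma smooth_upto_mult: "smooth_upto n f \<Longrightarrow> smooth_upto n g \<Longrightarrow> smooth_upto n (\<lambda>x. f x * g x)"
proof (induction n arbitrary: f g)
  case (Suc n)
  then obtain f' g' where d: "\<And>x. (f has_real_derivative f' x) (at x)" "smooth_upto n f'"
      "\<And>x. (g has_real_derivative g' x) (at x)" "smooth_upto n g'" by auto
  have "smooth_upto n (\<lambda>x. f' x * g x + f x * g' x)"
    using Suc.prems[THEN smooth_upto_Suc] d by (intro smooth_upto_add Suc.IH) auto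
  with d(1,3) show ?case
    by (auto intro!: exI[of _ "\<lambda>x. f' x * g x + f x * g' x"] derivative_eq_intros)
qed simp

text \<open>The factor \<open>c\<close> is there for the induction: each differentiation pulls out
  another \<open>a\<close>.\<close>

lemma smooth_upto_affine: "smooth_upto n f \<Longrightarrow> smooth_upto n (\<lambda>x. c * f (a * x + b))"
proof (induction n arbitrary: f c)
  case (Suc n)
  then obtain f' where d: "\<And>x. (f has_real_derivative f' x) (at x)" "smooth_upto n f'" by auto
  have "((\<lambda>x. c * f (a * x + b)) has_real_derivative c * a * f' (a * x + b)) (at x)" for x
  proof -
    have "((\<lambda>x. a * x + b) has_real_derivative a) (at x)"
      by (auto intro!: derivative_eq_intros)
    from DERIV_chain2[OF d(1) this] show ?thesis
      by (auto intro!: derivative_eq_intros)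
  qed
  with Suc.IH[OF d(2), of "c * a"] show ?case
    unfolding smooth_upto.simps by (intro exI[of _ "\<lambda>x. c * a * f' (a * x + b)"]) auto
qed simp

lemma smooth_upto_iterated_deriv:
  "smooth_upto n f \<Longrightarrow> k < n \<Longrightarrow> (deriv ^^ k) f differentiable (at x)"
proof (induction n arbitrary: f k)
  case (Suc n)
  then obtain f' where d: "\<And>x. (f has_real_derivative f' x) (at x)" "smooth_upto n f'" by auto
  have eq: "deriv f = f'" using d(1) by (intro ext DERIV_imp_deriv)
  show ?case
  proof (cases k)
    case 0
    then show ?thesis using d(1)[of x] by (auto simp: real_differentiable_def)
  next
    case (Suc j)
    then have "(deriv ^^ k) f = (deriv ^^ j) f'" by (simp add: funpow_swap1 eq)
    then show ?thesis using Suc.IH[OF d(2), of j] Suc.prems Suc by simp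
  qed
qed simp

lemma smooth_upto_if_iterated_deriv:
  "(\<And>k x. (deriv ^^ k) f differentiable (at x)) \<Longrightarrow> smooth_upto n f"
proof (induction n arbitrary: f)
  case (Suc n)
  have "smooth_upto n (deriv f)"
    by (rule Suc.IH) (use Suc.prems[of "Suc _"] in \<open>simp add: funpow_swap1\<close>)
  moreover have "(f has_real_derivative deriv f x) (at x)" for x
    using Suc.prems[of 0 x] by (auto simp: real_differentiable_def DERIV_imp_deriv)
  ultimately show ?case by auto
qed simp

lemma smooth_iff: "smooth f \<longleftrightarrow> (\<forall>k x. (deriv ^^ k) f differentiable (at x))"
  unfolding smooth_def
  using smooth_upto_if_iterated_deriv smooth_upto_iterated_deriv[OF _ lessI] by metis

lemma smooth_add: "smooth f \<Longrightarrow> smooth g \<Longrightarrow> smooth (\<lambda>x. f x + g x)"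
  by (simp add: smooth_def smooth_upto_add)

lemma smooth_mult: "smooth f \<Longrightarrow> smooth g \<Longrightarrow> smooth (\<lambda>x. f x * g x)"
  by (simp add: smooth_def smooth_upto_mult)

lemma smooth_affine: "smooth f \<Longrightarrow> smooth (\<lambda>x. c * f (a * x + b))"
  by (simp add: smooth_def smooth_upto_affine)

lemma smooth_cmult: "smooth f \<Longrightarrow> smooth (\<lambda>x. c * f x)"
  using smooth_affine[of f c 1 0] by simp

lemma smooth_has_derivative: "smooth f \<Longrightarrow> (f has_real_derivative deriv f x) (at x)"
  unfolding smooth_iff by (metis DERIV_imp_deriv funpow_0 real_differentiable_def)

lemma smooth_deriv: "smooth f \<Longrightarrow> smooth (deriv f)"
  unfolding smooth_iff by (metis comp_apply funpow_Suc_right)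

lemma smooth_antiderivative:
  assumes "\<And>x. (F has_real_derivative f x) (at x)" "smooth f"
  shows "smooth F"
  unfolding smooth_def
proof
  fix n show "smooth_upto n F"
    using assms by (cases n) (auto simp: smooth_def)
qed

lemma smooth_continuous: "smooth f \<Longrightarrow> continuous_on A f"
  by (meson DERIV_isCont continuous_at_imp_continuous_on smooth_has_derivative)

text \<open>The powers of the inverse are included so that the family is closed under
  differentiation up to linear combinations; \<open>flat 0\<close> is the usual function
  exp(-1/x).\<close>

definition flat :: "nat \<Rightarrow> real \<Rightarrow> real" where
  "flat n x = (if x > 0 then inverse x ^ n * exp (- inverse x) else 0)"

lemma flat_has_derivative:
  "(flat n has_real_derivative flat (n + 2) x + (- real n) * flat (n + 1) x) (at x)"
proof (cases x "0 :: real" rule: linorder_cases)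
  case less
  have "((\<lambda>x. 0) has_real_derivative 0) (at x)" by simp
  moreover have "\<forall>\<^sub>F y in nhds x. flat n y = 0"
    using eventually_nhds_in_open[of "{..<0}" x] less
    by (auto elim!: eventually_mono simp: flat_def)
  ultimately have "(flat n has_real_derivative 0) (at x)"
    by (subst DERIV_cong_ev[OF refl _ refl])
  then show ?thesis using less by (simp add: flat_def)
next
  case greater
  define y where "y = inverse x"
  have 1: "(inverse has_real_derivative - (y\<^sup>2)) (at x)"
    using DERIV_inverse[of x UNIV] greater by (simp add: y_def numeral_2_eq_2)
  have 2: "((\<lambda>x. inverse x ^ n) has_real_derivative real n * (- (y\<^sup>2) * y ^ (n - Suc 0))) (at x)"
    using DERIV_power[OF 1, of n] by (simp add: y_def)
  have 3: "((\<lambda>x. exp (- inverse x)) has_real_derivative exp (- y) * y\<^sup>2) (at x)"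
    using DERIV_fun_exp[OF DERIV_minus[OF 1]] by (simp add: y_def)
  \<comment> \<open>For \<open>n = 0\<close> the exponent \<open>n - Suc 0\<close> is truncated,
    which the factor \<open>real n\<close> makes harmless.\<close>
  have "real n * (- (y\<^sup>2) * y ^ (n - Suc 0)) * exp (- y) + exp (- y) * y\<^sup>2 * y ^ n
      = flat (n + 2) x + (- real n) * flat (n + 1) x"
    using greater by (cases n) (simp_all add: flat_def y_def[symmetric] power2_eq_square algebra_simps)
  with DERIV_mult[OF 2 3]
  have "((\<lambda>x. inverse x ^ n * exp (- inverse x)) has_real_derivative
      flat (n + 2) x + (- real n) * flat (n + 1) x) (at x)"
    by (simp add: y_def)
  moreover have "\<forall>\<^sub>F y in nhds x. flat n y = inverse y ^ n * exp (- inverse y)"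
    using eventually_nhds_in_open[of "{0<..}" x] greater
    by (auto elim!: eventually_mono simp: flat_def)
  ultimately show ?thesis by (subst DERIV_cong_ev[OF refl _ refl])
next
  case equal
  \<comment> \<open>With \<open>y = inverse h\<close> the right difference quotient at the origin
    becomes this expression, so the exponential beats every power.\<close>
  have "((\<lambda>y. y ^ (n + 1) / exp y) \<longlongrightarrow> (0::real)) at_top"
    by (rule tendsto_power_div_exp_0)
  from filterlim_compose[OF this filterlim_inverse_at_top_right]
  have "((\<lambda>h. inverse h ^ (n + 1) / exp (inverse h)) \<longlongrightarrow> (0::real)) (at_right 0)" .
  then have "((\<lambda>h. flat n h / h) \<longlongrightarrow> 0) (at_right 0)"
    by (rule Lim_transform_eventually)
      (auto simp: eventually_at_filter flat_def exp_minus field_simps)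
  moreover have "((\<lambda>h. flat n h / h) \<longlongrightarrow> 0) (at_left 0)"
    by (rule Lim_transform_eventually[OF tendsto_const])
      (auto simp: eventually_at_filter flat_def)
  ultimately have "((\<lambda>h. flat n h / h) \<longlongrightarrow> 0) (at 0)"
    by (simp add: filterlim_split_at)
  then have "(flat n has_real_derivative 0) (at 0)"
    by (simp add: DERIV_def flat_def)
  then show ?thesis using equal by (simp add: flat_def)
qed

lemma smooth_flat: "smooth (flat n)"
proof -
  have "smooth_upto k (flat n)" for k
  proof (induction k arbitrary: n)
    case (Suc k)
    have "smooth_upto k (\<lambda>x. flat (n + 2) x + (- real n) * flat (n + 1) x)"
      using smooth_upto_affine[OF Suc.IH[of "n + 1"], of "- real n" 1 0] Suc.IH[of "n + 2"]
      by (intro smooth_upto_add) auto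
    then show ?case
      unfolding smooth_upto.simps using flat_has_derivative
      by (intro exI[of _ "\<lambda>x. flat (n + 2) x + (- real n) * flat (n + 1) x"]) blast
  qed simp
  then show ?thesis by (simp add: smooth_def)
qed

lemma test_functionI:
  assumes "smooth f" "0 < a" "b < 1" "\<And>x. x \<notin> {a..b} \<Longrightarrow> f x = 0"
  shows "test_function f"
proof -
  have "{x. f x \<noteq> 0} \<subseteq> {a..b}" using assms(4) by blast
  then have "closure {x. f x \<noteq> 0} \<subseteq> {a..b}" by (rule closure_minimal) simp
  then have "compact (closure {x. f x \<noteq> 0})" "closure {x. f x \<noteq> 0} \<subseteq> {0<..<1}"
    using assms(2,3) bounded_subset[of "{a..b}"] by (auto simp: compact_eq_bounded_closed)
  then show ?thesis using assms(1) by (simp add: test_function_def smooth_iff)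
qed

lemma test_functionE:
  assumes "test_function f"
  obtains a b where "smooth f" "0 < a" "a < b" "b < 1" "\<And>x. x \<notin> {a..b} \<Longrightarrow> f x = 0"
proof -
  define K where "K = closure {x. f x \<noteq> 0}"
  have K: "compact K" "K \<subseteq> {0<..<1}" and s: "smooth f"
    using assms by (simp_all add: test_function_def smooth_iff K_def)
  have "\<exists>a b. 0 < a \<and> a < b \<and> b < 1 \<and> K \<subseteq> {a..b}"
  proof (cases "K = {}")
    case True
    then show ?thesis by (intro exI[of _ "1/3"] exI[of _ "1/2"]) auto
  next
    case False
    obtain l where l: "l \<in> K" "\<And>x. x \<in> K \<Longrightarrow> l \<le> x"
      using compact_attains_inf[OF K(1) False] by blast
    obtain r where r: "r \<in> K" "\<And>x. x \<in> K \<Longrightarrow> x \<le> r"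
      using compact_attains_sup[OF K(1) False] by blast
    have "0 < l" "l \<le> r" "r < 1" using l r K(2) by auto
    \<comment> \<open>The right end is moved halfway towards 1 so that \<open>a < b\<close> holds
      even if \<open>l = r\<close>.\<close>
    then show ?thesis using l r
      by (intro exI[of _ l] exI[of _ "(r + 1) / 2"]) fastforce
  qed
  then obtain a b where ab: "0 < a" "a < b" "b < 1" "K \<subseteq> {a..b}" by blast
  have "f x = 0" if "x \<notin> {a..b}" for x
    using that ab(4) closure_subset[of "{x. f x \<noteq> 0}"] by (auto simp: K_def)
  then show thesis using that s ab by blast
qed

lemma test_function_deriv:
  assumes "test_function f"
  shows "test_function (deriv f)"
proof -
  obtain a b where f: "smooth f" "0 < a" "a < b" "b < 1" "\<And>x. x \<notin> {a..b} \<Longrightarrow> f x = 0"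
    using test_functionE[OF assms] by blast
  have "deriv f x = 0" if "x \<notin> {a..b}" for x
  proof -
    have "((\<lambda>x. 0) has_real_derivative 0) (at x)" by simp
    moreover have "\<forall>\<^sub>F y in nhds x. f y = 0"
      using eventually_nhds_in_open[of "- {a..b}" x] that f(5)
      by (auto elim!: eventually_mono simp: open_Compl)
    ultimately have "(f has_real_derivative 0) (at x)"
      by (subst DERIV_cong_ev[OF refl _ refl])
    then show ?thesis by (rule DERIV_imp_deriv)
  qed
  with f smooth_deriv show ?thesis by (intro test_functionI[of _ a b]) auto
qed

lemma test_function_cmult: "test_function f \<Longrightarrow> test_function (\<lambda>x. c * f x)"
  by (erule test_functionE, rule test_functionI) (auto intro: smooth_cmult)

lemma test_function_add:
  assumes "test_function f" "test_function g"
  shows "test_function (\<lambda>x. f x + g x)"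
proof -
  obtain a b where f: "smooth f" "0 < a" "b < 1" "\<And>x. x \<notin> {a..b} \<Longrightarrow> f x = 0"
    using test_functionE[OF assms(1)] by metis
  obtain c d where g: "smooth g" "0 < c" "d < 1" "\<And>x. x \<notin> {c..d} \<Longrightarrow> g x = 0"
    using test_functionE[OF assms(2)] by metis
  show ?thesis
  proof (rule test_functionI[of _ "min a c" "max b d"])
    show "f x + g x = 0" if "x \<notin> {min a c..max b d}" for x
      using f(4)[of x] g(4)[of x] that by fastforce
  qed (use f g in \<open>auto intro: smooth_add\<close>)
qed

text \<open>Smooth approximations of the indicator of \<open>{a<..<b}\<close>: bounded by 1, zero
  outside that interval for every \<open>n\<close>, and steeper as \<open>n\<close> grows. The scale
  \<open>Suc n\<close> is never 0. These are the properties that dominated convergence asks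
  for.\<close>

definition bump :: "real \<Rightarrow> real \<Rightarrow> nat \<Rightarrow> real \<Rightarrow> real" where
  "bump a b n x = flat 0 (real (Suc n) * (x - a)) * flat 0 (real (Suc n) * (b - x))"

lemma flat_0_bounds: "0 \<le> flat 0 x" "flat 0 x \<le> 1"
  by (auto simp: flat_def)

lemma bump_bounds: "0 \<le> bump a b n x" "bump a b n x \<le> 1"
  using flat_0_bounds by (auto simp: bump_def intro: mult_le_one)

lemma bump_eq_0: "x \<notin> {a<..<b} \<Longrightarrow> bump a b n x = 0"
  by (auto simp: bump_def flat_def zero_less_mult_iff)

lemma test_function_bump:
  assumes "0 < a" "b < 1"
  shows "test_function (bump a b n)"
proof (rule test_functionI[OF _ assms])
  have "smooth (\<lambda>x. (1 * flat 0 (real (Suc n) * x + - real (Suc n) * a)) *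
      (1 * flat 0 (- real (Suc n) * x + real (Suc n) * b)))"
    by (intro smooth_mult smooth_affine smooth_flat)
  also have "(\<lambda>x. (1 * flat 0 (real (Suc n) * x + - real (Suc n) * a)) *
      (1 * flat 0 (- real (Suc n) * x + real (Suc n) * b))) = bump a b n"
    by (intro ext) (simp add: bump_def algebra_simps)
  finally show "smooth (bump a b n)" .
qed (use bump_eq_0 in auto)

lemma bump_tendsto: "(\<lambda>n. bump a b n x) \<longlonglongrightarrow> indicator {a<..<b} x"
proof (cases "x \<in> {a<..<b}")
  case True
  have *: "(\<lambda>n. flat 0 (real (Suc n) * y)) \<longlonglongrightarrow> 1" if "y > 0" for y
  proof -
    have "(\<lambda>n. exp (- (inverse y * inverse (real (Suc n))))) \<longlonglongrightarrow> exp (- (inverse y * 0))"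
      by (intro tendsto_intros LIMSEQ_inverse_real_of_nat)
    moreover have "flat 0 (real (Suc n) * y) = exp (- (inverse y * inverse (real (Suc n))))" for n
      using that by (simp add: flat_def mult.commute)
    ultimately show ?thesis by simp
  qed
  have "(\<lambda>n. bump a b n x) \<longlonglongrightarrow> 1 * 1"
    unfolding bump_def using True by (intro tendsto_mult *) auto
  then show ?thesis using True by simp
qed (simp add: bump_eq_0)

subsection \<open>Weak derivatives\<close>

lemma locally_integrable_Icc:
  assumes "locally_integrable f" "0 < a" "b < 1"
  shows "integrable (lebesgue_on {a..b}) f"
proof -
  have "{a..b} \<subseteq> {0<..<1}" using assms(2,3) by auto
  then show ?thesis using assms(1) unfolding locally_integrable_def by blast
qed

lemma integrable_mult_test:
  assumes "locally_integrable f" "0 < a" "b < 1" "continuous_on UNIV \<theta>"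
    "\<And>x. x \<notin> {a..b} \<Longrightarrow> \<theta> x = 0"
  shows "integrable (leb 0 1) (\<lambda>x. f x * \<theta> x)"
proof -
  have fi: "integrable (lebesgue_on {a..b}) f"
    by (rule locally_integrable_Icc) fact+
  obtain B where B: "\<And>x. x \<in> {a..b} \<Longrightarrow> \<bar>\<theta> x\<bar> \<le> B"
    using continuous_bound_Icc[OF continuous_on_subset[OF assms(4)]] unfolding real_norm_def by blast
  have "\<theta> \<in> borel_measurable (lebesgue_on {a..b})"
    by (rule continuous_imp_measurable_on_sets_lebesgue)
      (auto intro: continuous_on_subset[OF assms(4)])
  have "integrable (lebesgue_on {a..b}) (\<lambda>x. f x * \<theta> x)"
  proof (rule Bochner_Integration.integrable_bound)
    show "integrable (lebesgue_on {a..b}) (\<lambda>x. B * f x)" using fi by simp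
    show "(\<lambda>x. f x * \<theta> x) \<in> borel_measurable (lebesgue_on {a..b})"
      using fi \<open>\<theta> \<in> _\<close> by auto
    show "AE x in lebesgue_on {a..b}. norm (f x * \<theta> x) \<le> norm (B * f x)"
    proof (rule AE_I2)
      fix x assume "x \<in> space (lebesgue_on {a..b})"
      then have "\<bar>\<theta> x\<bar> \<le> \<bar>B\<bar>" using B[of x] by auto
      then show "norm (f x * \<theta> x) \<le> norm (B * f x)"
        by (simp add: abs_mult mult.commute[of "\<bar>B\<bar>"] mult_left_mono)
    qed
  qed
  then have "integrable lebesgue (\<lambda>x. indicator {a..b} x *\<^sub>R (f x * \<theta> x))"
    by (simp add: integrable_restrict_space)
  also have "(\<lambda>x. indicator {a..b} x *\<^sub>R (f x * \<theta> x)) = (\<lambda>x. indicator {0<..<1} x *\<^sub>R (f x * \<theta> x))"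
    using assms(2,3,5) by (auto simp: fun_eq_iff indicator_def)
  finally show ?thesis by (simp add: integrable_restrict_space)
qed

lemma integrable_mult_test_function:
  assumes "locally_integrable f" "test_function \<theta>"
  shows "integrable (leb 0 1) (\<lambda>x. f x * \<theta> x)"
  using test_functionE[OF assms(2)] integrable_mult_test[OF assms(1)] smooth_continuous by metis

text \<open>Lebesgue differentiation: off a negligible set, \<open>f x\<close> is the limit of the
  averages over \<open>{x..x + h}\<close>, and these are zero for small \<open>h\<close>.\<close>

lemma AE_zero_if_integrals_zero:
  fixes f :: "real \<Rightarrow> real"
  assumes f: "integrable (lebesgue_on {c..d}) f"
    and zero: "\<And>a b. c < a \<Longrightarrow> a < b \<Longrightarrow> b < d \<Longrightarrow> integral {a..b} f = 0"
  shows "AE x in lebesgue. x \<in> {c<..<d} \<longrightarrow> f x = 0"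
proof -
  define g where "g = (\<lambda>x. if x \<in> {c..d} then f x else 0)"
  have "f integrable_on {c..d}" using f by (intro integrable_on_lebesgue_on) auto
  then have "g integrable_on UNIV" unfolding g_def using integrable_restrict_UNIV by blast
  then have "g integrable_on cbox a b" for a b by (rule integrable_on_subcbox) simp
  from integrable_ccontinuous_explicit[OF this] obtain N where N: "negligible N"
    "\<And>x e. \<lbrakk>x \<notin> N; 0 < e\<rbrakk> \<Longrightarrow> \<exists>d>0. \<forall>h. 0 < h \<and> h < d \<longrightarrow>
        norm (integral (cbox x (x + h *\<^sub>R One)) g /\<^sub>R h ^ DIM(real) - g x) < e" by metis
  have "f x = 0" if x: "x \<notin> N" "c < x" "x < d" for x
  proof (rule ccontr)
    assume nz: "f x \<noteq> 0"
    obtain \<delta> where \<delta>: "\<delta> > 0" "\<And>h. 0 < h \<Longrightarrow> h < \<delta> \<Longrightarrow>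
        norm (integral (cbox x (x + h *\<^sub>R One)) g /\<^sub>R h ^ DIM(real) - g x) < \<bar>f x\<bar>"
      using N(2)[OF x(1), of "\<bar>f x\<bar>"] nz by auto
    have "0 < d - x" using x by simp
    from field_lbound_gt_zero[OF \<delta>(1) this] obtain h where h: "0 < h" "h < \<delta>" "x + h < d"
      by (auto simp: less_diff_eq add.commute)
    have "integral {x..x + h} g = integral {x..x + h} f"
      by (rule integral_cong) (use h x in \<open>auto simp: g_def\<close>)
    also have "\<dots> = 0" using zero[of x "x + h"] h x by simp
    finally show False using \<delta>(2)[OF h(1,2)] x by (auto simp: g_def)
  qed
  then have "{x. \<not> (x \<in> {c<..<d} \<longrightarrow> f x = 0)} \<subseteq> N" by auto
  then have "{x. \<not> (x \<in> {c<..<d} \<longrightarrow> f x = 0)} \<in> null_sets lebesgue"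
    using N(1) by (meson negligible_iff_null_sets negligible_subset)
  then show ?thesis by (rule AE_I') simp
qed

text \<open>Local integrability gives control only away from the endpoints; countably many smaller
  intervals exhaust (0,1), and a countable union of null sets is null.\<close>

lemma AE_leb_0_1_exhaust:
  assumes "\<And>c d. 0 < c \<Longrightarrow> d < 1 \<Longrightarrow> AE x in lebesgue. x \<in> {c<..<d} \<longrightarrow> P x"
  shows "AE x in leb 0 1. P x"
proof -
  define q where "q = (\<lambda>n. inverse (real (Suc n)))"
  have "AE x in lebesgue. \<forall>n. x \<in> {q n<..<1 - q n} \<longrightarrow> P x"
    unfolding AE_all_countable using assms by (auto simp: q_def)
  then have "AE x in lebesgue. x \<in> {0<..<1} \<longrightarrow> P x"
  proof eventually_elim
    case (elim x)
    show ?case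
    proof
      assume x: "x \<in> {0<..<1}"
      have "q \<longlonglongrightarrow> 0" unfolding q_def by (rule LIMSEQ_inverse_real_of_nat)
      then have "\<forall>\<^sub>F n in sequentially. q n < min x (1 - x)"
        by (rule order_tendstoD) (use x in auto)
      then obtain n where "q n < min x (1 - x)" by (auto dest: eventually_happens)
      then show "P x" using elim by auto
    qed
  qed
  then show ?thesis by (simp add: AE_restrict_space_iff)
qed

text \<open>Testing with bumps and letting them increase in steepness gives, by dominated
  convergence, that the integral of \<open>f\<close> over every compact subinterval is zero.\<close>

lemma fundamental_lemma:
  assumes f: "locally_integrable f"
    and zero: "\<And>\<theta>. test_function \<theta> \<Longrightarrow> lint 0 1 (\<lambda>x. f x * \<theta> x) = 0"
  shows "AE x in leb 0 1. f x = 0"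
proof (rule AE_leb_0_1_exhaust, rule AE_zero_if_integrals_zero)
  fix c d :: real assume cd: "0 < c" "d < 1"
  show "integrable (lebesgue_on {c..d}) f" by (rule locally_integrable_Icc[OF f cd])
  fix a b assume ab: "c < a" "a < b" "b < d"
  have 0: "0 < a" "b < 1" using ab cd by auto
  have fab: "integrable (lebesgue_on {a..b}) f" by (rule locally_integrable_Icc[OF f 0])
  have dom: "integrable (leb 0 1) (\<lambda>x. indicator {a..b} x * f x)"
  proof -
    have "integrable lebesgue (\<lambda>x. indicator {a..b} x *\<^sub>R f x)"
      using fab by (simp add: integrable_restrict_space)
    also have "(\<lambda>x. indicator {a..b} x *\<^sub>R f x)
        = (\<lambda>x. indicator {0<..<1} x *\<^sub>R (indicator {a..b} x * f x))"
      using 0 by (auto simp: fun_eq_iff indicator_def)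
    finally show ?thesis by (simp add: integrable_restrict_space)
  qed
  have fi: "integrable (leb a b) f"
    by (rule integrable_lebesgue_on_subset[OF fab]) auto
  have lim: "(\<lambda>n. lint 0 1 (\<lambda>x. f x * bump a b n x))
      \<longlonglongrightarrow> lint 0 1 (\<lambda>x. f x * indicator {a<..<b} x)"
  proof (rule integral_dominated_convergence)
    show "integrable (leb 0 1) (\<lambda>x. norm (indicator {a..b} x * f x))" using dom by (rule integrable_norm)
    show m: "(\<lambda>x. f x * bump a b n x) \<in> borel_measurable (leb 0 1)" for n
      using integrable_mult_test_function[OF f test_function_bump[OF 0]] by auto
    show "AE x in leb 0 1. (\<lambda>n. f x * bump a b n x) \<longlonglongrightarrow> f x * indicator {a<..<b} x"
      by (intro AE_I2 tendsto_intros bump_tendsto)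
    show "(\<lambda>x. f x * indicator {a<..<b} x) \<in> borel_measurable (leb 0 1)"
      by (rule borel_measurable_LIMSEQ_real[where u = "\<lambda>n x. f x * bump a b n x", OF _ m])
        (intro tendsto_intros bump_tendsto)
    show "AE x in leb 0 1. norm (f x * bump a b n x) \<le> norm (indicator {a..b} x * f x)" for n
    proof (rule AE_I2)
      fix x
      show "norm (f x * bump a b n x) \<le> norm (indicator {a..b} x * f x)"
      proof (cases "x \<in> {a<..<b}")
        case True
        then show ?thesis using bump_bounds[of a b n x]
          by (simp add: abs_mult mult_left_le)
      qed (simp add: bump_eq_0)
    qed
  qed
  have "integral {a..b} f = lint a b f"
    using lebesgue_integral_eq_integral[OF fi] by (simp add: integral_open_interval_real)
  also have "\<dots> = lint 0 1 (\<lambda>x. if x \<in> {a<..<b} then f x else 0)"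
    by (rule integral_restrict[symmetric]) (use 0 in auto)
  also have "\<dots> = lint 0 1 (\<lambda>x. f x * indicator {a<..<b} x)"
    by (rule Bochner_Integration.integral_cong) auto
  also have "\<dots> = 0"
    using lim zero[OF test_function_bump[OF 0]] by (simp add: LIMSEQ_const_iff)
  finally show "integral {a..b} f = 0" .
qed

lemma locally_integrable_integrable: "integrable (leb 0 1) f \<Longrightarrow> locally_integrable f"
  unfolding locally_integrable_def
  by (auto intro!: integrable_lebesgue_on_subset[where S = "{0<..<1}"] lmeasurable_compact fmeasurableD)

lemma locally_integrable_lin:
  "locally_integrable f \<Longrightarrow> locally_integrable g \<Longrightarrow> locally_integrable (\<lambda>x. f x - g x)"
  by (auto simp: locally_integrable_def)

lemma weak_deriv_unique:
  assumes "weak_deriv k f g" "weak_deriv k f h"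
  shows "AE x in leb 0 1. g x = h x"
proof -
  have gh: "locally_integrable g" "locally_integrable h" using assms by (auto simp: weak_deriv_def)
  have "AE x in leb 0 1. g x - h x = 0"
  proof (rule fundamental_lemma[OF locally_integrable_lin[OF gh]])
    fix \<theta> assume t: "test_function \<theta>"
    have "(- 1) ^ k * lint 0 1 (\<lambda>x. g x * \<theta> x)
        = (- 1) ^ k * lint 0 1 (\<lambda>x. h x * \<theta> x)"
      using assms t by (simp add: weak_deriv_def)
    then have "lint 0 1 (\<lambda>x. g x * \<theta> x) = lint 0 1 (\<lambda>x. h x * \<theta> x)" by simp
    then show "lint 0 1 (\<lambda>x. (g x - h x) * \<theta> x) = 0"
      using integrable_mult_test_function[OF _ t] gh by (simp add: left_diff_distrib)
  qed
  then show ?thesis by simp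
qed

text \<open>\<open>sobolev\<close> supplies the derivative of each order directly from
  \<open>f\<close>, not from the preceding order. Testing order \<open>j\<close> with
  \<open>deriv \<theta>\<close> links consecutive ones.\<close>

lemma weak_deriv_Suc:
  assumes "weak_deriv j f g" "weak_deriv (Suc j) f h"
  shows "weak_deriv 1 g h"
  unfolding weak_deriv_def
proof (intro conjI allI impI)
  fix \<theta> assume t: "test_function \<theta>"
  have "(- 1) ^ j * lint 0 1 (\<lambda>x. g x * deriv \<theta> x)
      = lint 0 1 (\<lambda>x. f x * (deriv ^^ j) (deriv \<theta>) x)"
    using assms(1) test_function_deriv[OF t] by (simp add: weak_deriv_def)
  also have "\<dots> = (- 1) ^ Suc j * lint 0 1 (\<lambda>x. h x * \<theta> x)"
    using assms(2) t by (simp add: weak_deriv_def funpow_swap1)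
  also have "\<dots> = (- 1) ^ j * ((- 1) ^ 1 * lint 0 1 (\<lambda>x. h x * \<theta> x))" by simp
  finally show "lint 0 1 (\<lambda>x. g x * (deriv ^^ 1) \<theta> x)
      = (- 1) ^ 1 * lint 0 1 (\<lambda>x. h x * \<theta> x)"
    by (subst (asm) mult_cancel_left) simp
qed (use assms in \<open>auto simp: weak_deriv_def\<close>)

section \<open>Functions with an integrable weak derivative are primitives\<close>

lemma antiderivative_exists:
  fixes f :: "real \<Rightarrow> real"
  assumes "continuous_on UNIV f"
  obtains F where "\<And>x. (F has_real_derivative f x) (at x)" "F 0 = 0"
proof -
  have "\<exists>F. \<forall>x. - \<infinity> < ereal x \<longrightarrow> ereal x < \<infinity> \<longrightarrow> (F has_vector_derivative f x) (at x)"
    by (rule einterval_antiderivative) (use assms in \<open>auto simp: continuous_on_eq_continuous_at\<close>)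
  then obtain F where "\<And>x. (F has_real_derivative f x) (at x)"
    by (auto simp: has_real_derivative_iff_has_vector_derivative)
  then have "\<And>x. ((\<lambda>x. F x - F 0) has_real_derivative f x) (at x)"
    by (auto intro!: derivative_eq_intros)
  then show thesis using that[of "\<lambda>x. F x - F 0"] by simp
qed

text \<open>If every test function had integral zero, the fundamental lemma would make the constant
  1 vanish almost everywhere; a nonzero integral is then normalised.\<close>

lemma exists_test_function_integral_1: "\<exists>\<theta>. test_function \<theta> \<and> lint 0 1 \<theta> = 1"
proof -
  have "\<exists>\<theta>. test_function \<theta> \<and> lint 0 1 \<theta> \<noteq> 0"
  proof (rule ccontr)
    assume "\<not> ?thesis"
    then have "AE x in leb 0 1. (1::real) = 0"
      by (intro fundamental_lemma locally_integrable_integrable) auto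
    then have "lint 0 1 (\<lambda>x. 1::real) = lint 0 1 (\<lambda>x. 0)"
      by (intro integral_cong_AE) auto
    then show False using integral_leb_const[of 0 1 1] by simp
  qed
  then obtain \<theta> where "test_function \<theta>" "lint 0 1 \<theta> \<noteq> 0" by blast
  then show ?thesis
    using test_function_cmult[of \<theta> "1 / lint 0 1 \<theta>"]
    by (intro exI[of _ "\<lambda>x. 1 / lint 0 1 \<theta> * \<theta> x"]) simp
qed

text \<open>The primitive starting from 0 is constant on both sides of the support; zero mean makes
  the right constant agree with the left one, so the primitive is compactly supported again.\<close>

lemma test_function_antiderivative:
  assumes "test_function \<eta>" "lint 0 1 \<eta> = 0"
  obtains \<theta> where "test_function \<theta>" "deriv \<theta> = \<eta>"
proof -
  obtain a b where e: "smooth \<eta>" "0 < a" "a < b" "b < 1" "\<And>x. x \<notin> {a..b} \<Longrightarrow> \<eta> x = 0"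
    using test_functionE[OF assms(1)] by blast
  obtain F where F: "\<And>x. (F has_real_derivative \<eta> x) (at x)" "F 0 = 0"
    using antiderivative_exists[OF smooth_continuous[OF e(1)]] by blast
  have "primitive_on 1 F \<eta>"
    by (rule primitive_on_FTC)
      (use F smooth_continuous[OF e(1)] in \<open>auto simp: has_real_derivative_iff_has_vector_derivative\<close>)
  from primitive_onD(2)[OF this, of 1] have F1: "F 1 = 0" using F(2) assms(2) by simp
  have c: "F x = F y" if "x \<le> y" "\<And>z. x \<le> z \<Longrightarrow> z \<le> y \<Longrightarrow> \<eta> z = 0" for x y
  proof (cases "x = y")
    case False
    then have "x < y" using that by simp
    have "\<And>z. x \<le> z \<Longrightarrow> z \<le> y \<Longrightarrow> (F has_real_derivative 0) (at z)"
      using F(1) that(2) by metis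
    from DERIV_isconst_end[OF \<open>x < y\<close>] this show ?thesis
      by (metis DERIV_isCont continuous_at_imp_continuous_on less_imp_le atLeastAtMost_iff)
  qed simp
  have "F x = 0" if "x \<notin> {a..b}" for x
  proof -
    consider "x < a" "x \<le> 0" | "x < a" "0 \<le> x" | "x > b" "x \<le> 1" | "x > b" "1 \<le> x"
      using \<open>x \<notin> {a..b}\<close> by fastforce
    then show ?thesis
      using c[of x 0] c[of 0 x] c[of x 1] c[of 1 x] e F(2) F1 by cases auto
  qed
  then have "test_function F"
    using smooth_antiderivative[OF F(1) e(1)] e by (intro test_functionI[of F a b]) auto
  moreover have "deriv F = \<eta>" using F(1) by (intro ext DERIV_imp_deriv)
  ultimately show thesis using that by blast
qed

text \<open>The du Bois-Reymond argument: \<open>h\<close>, which is \<open>f\<close> minus the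
  primitive of \<open>g\<close>, annihilates all derivatives of test functions, hence all test
  functions of mean zero, and is therefore constant.\<close>

lemma weak_deriv_imp_primitive:
  assumes w: "weak_deriv 1 f g" and g: "integrable (leb 0 1) g"
  obtains c where "AE x in leb 0 1. f x = c + lint 0 x g"
proof -
  define G where "G = (\<lambda>x. lint 0 x g)"
  have Gp: "primitive_on 1 G g" unfolding G_def using primitive_on_integral[OF g, of 0] by simp
  have Gi: "integrable (leb 0 1) G"
    by (rule integrable_continuous_leb[OF primitive_on_continuous[OF Gp]])
  have f: "locally_integrable f" using w by (simp add: weak_deriv_def)
  have G: "locally_integrable G" by (rule locally_integrable_integrable[OF Gi])
  define h where "h = (\<lambda>x. f x - G x)"
  have h: "locally_integrable h" unfolding h_def by (rule locally_integrable_lin[OF f G])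
  have h0: "lint 0 1 (\<lambda>x. h x * deriv \<theta> x) = 0" if t: "test_function \<theta>" for \<theta>
  proof -
    obtain a b where th: "smooth \<theta>" "0 < a" "a < b" "b < 1" "\<And>x. x \<notin> {a..b} \<Longrightarrow> \<theta> x = 0"
      using test_functionE[OF t] by blast
    have "primitive_on 1 \<theta> (deriv \<theta>)"
      by (rule primitive_on_FTC) (use smooth_has_derivative[OF th(1)]
          smooth_continuous[OF smooth_deriv[OF th(1)]] in
          \<open>auto simp: has_real_derivative_iff_has_vector_derivative\<close>)
    from primitive_onD(2)[OF primitive_on_mult[OF Gp this], of 1]
    have "lint 0 1 (\<lambda>x. g x * \<theta> x + G x * deriv \<theta> x) = 0"
      using th(5)[of 0] th(5)[of 1] th(2-4) by simp
    moreover have "lint 0 1 (\<lambda>x. f x * deriv \<theta> x) = - lint 0 1 (\<lambda>x. g x * \<theta> x)"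
      using w t by (simp add: weak_deriv_def)
    ultimately show ?thesis
      using integrable_mult_test_function[OF locally_integrable_integrable[OF g] t]
        integrable_mult_test_function[OF f test_function_deriv[OF t]]
        integrable_mult_test_function[OF G test_function_deriv[OF t]]
      by (simp add: h_def left_diff_distrib)
  qed
  obtain \<rho> where \<rho>: "test_function \<rho>" "lint 0 1 \<rho> = 1"
    using exists_test_function_integral_1 by blast
  define c where "c = lint 0 1 (\<lambda>x. h x * \<rho> x)"
  have lc: "locally_integrable (\<lambda>_. k)" for k :: real by (rule locally_integrable_integrable) simp
  have ti: "integrable (leb 0 1) \<theta>" if "test_function \<theta>" for \<theta>
    using integrable_mult_test_function[OF lc[of 1] that] by simp
  have "AE x in leb 0 1. h x - c = 0"
  proof (rule fundamental_lemma[OF locally_integrable_lin[OF h lc]])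
    fix \<xi> assume t: "test_function \<xi>"
    define k where "k = lint 0 1 \<xi>"
    \<comment> \<open>Removing the mean of \<xi> by a fixed multiple of \<rho> makes it a
      derivative; the value of \<open>h\<close> on \<rho> is the constant \<open>c\<close>.\<close>
    define \<eta> where "\<eta> = (\<lambda>x. \<xi> x + (- k) * \<rho> x)"
    have \<eta>: "test_function \<eta>" unfolding \<eta>_def by (intro test_function_add test_function_cmult t \<rho>)
    have "lint 0 1 \<eta> = 0"
      unfolding \<eta>_def using ti[OF t] ti[OF \<rho>(1)] \<rho>(2) by (simp add: k_def)
    from test_function_antiderivative[OF \<eta> this] obtain \<theta> where "test_function \<theta>" "deriv \<theta> = \<eta>" .
    with h0 have "lint 0 1 (\<lambda>x. h x * \<eta> x) = 0" by metis
    moreover have "(\<lambda>x. h x * \<eta> x) = (\<lambda>x. h x * \<xi> x - k * (h x * \<rho> x))"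
      by (auto simp: \<eta>_def algebra_simps)
    ultimately have "lint 0 1 (\<lambda>x. h x * \<xi> x) = k * c"
      using integrable_mult_test_function[OF h t] integrable_mult_test_function[OF h \<rho>(1)]
      by (simp add: c_def)
    then show "lint 0 1 (\<lambda>x. (h x - c) * \<xi> x) = 0"
      using integrable_mult_test_function[OF h t] ti[OF t] by (simp add: left_diff_distrib k_def)
  qed
  then have "AE x in leb 0 1. f x = c + lint 0 x g"
    by eventually_elim (simp add: h_def G_def)
  then show thesis by (rule that)
qed

section \<open>Classical representatives of Sobolev functions\<close>

lemma L2_imp_integrable:
  fixes g :: "real \<Rightarrow> 'a::{banach,second_countable_topology}"
  assumes "L2 a b g"
  shows "integrable (leb a b) g"
proof -
  interpret finite_measure "leb a b" by (rule finite_measure_leb)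
  have "integrable (leb a b) (\<lambda>x. norm (g x))"
    by (rule square_integrable_imp_integrable) (use assms in \<open>auto simp: L2_def\<close>)
  then show ?thesis using assms by (simp add: L2_def integrable_norm_iff)
qed

lemma integral_leb_cong_AE:
  assumes "AE x in leb 0 1. f x = g x" "integrable (leb 0 1) f" "integrable (leb 0 1) g"
    "0 \<le> x" "x \<le> 1"
  shows "lint 0 x f = lint 0 x (g :: real \<Rightarrow> real)"
proof (rule integral_cong_AE)
  show "f \<in> borel_measurable (leb 0 x)" "g \<in> borel_measurable (leb 0 x)"
    using integrable_leb_subset[OF assms(2), of 0 x] integrable_leb_subset[OF assms(3), of 0 x] assms
    by auto
  have "AE x in lebesgue. x \<in> {0<..<1} \<longrightarrow> f x = g x" using assms(1) by (simp add: AE_restrict_space_iff)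
  then have "AE y in lebesgue. y \<in> {0<..<x} \<longrightarrow> f y = g y"
    by eventually_elim (use assms(5) in auto)
  then show "AE y in leb 0 x. f y = g y" by (simp add: AE_restrict_space_iff)
qed

text \<open>A weak derivative with a continuous representative makes the primitive classically
  differentiable. Two applications lead from the second derivative of \<open>\<mu>\<close> back to
  \<open>\<mu>\<close>.\<close>

lemma weak_deriv_C1_representative:
  assumes "weak_deriv 1 f g" "integrable (leb 0 1) g" "AE x in leb 0 1. g x = G x"
    "continuous_on UNIV G"
  obtains F where "\<And>x. (F has_real_derivative G x) (at x)" "AE x in leb 0 1. f x = F x"
proof -
  obtain c where c: "AE x in leb 0 1. f x = c + lint 0 x g"
    using weak_deriv_imp_primitive[OF assms(1,2)] .
  obtain F where F: "\<And>x. (F has_real_derivative G x) (at x)" "F 0 = 0"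
    using antiderivative_exists[OF assms(4)] by blast
  have Fp: "primitive_on 1 F G"
    by (rule primitive_on_FTC) (use F assms(4) in
        \<open>auto simp: has_real_derivative_iff_has_vector_derivative intro: continuous_on_subset\<close>)
  have eq: "lint 0 x g = F x" if "0 < x" "x < 1" for x
    using integral_leb_cong_AE[OF assms(3,2) primitive_onD(1)[OF Fp], of x]
      primitive_onD(2)[OF Fp, of x] that F(2) by simp
  have "AE x in leb 0 1. x \<in> {0<..<1}" by (rule AE_I2) simp
  with c have "AE x in leb 0 1. f x = c + F x"
    by eventually_elim (use eq in auto)
  moreover have "((\<lambda>x. c + F x) has_real_derivative G x) (at x)" for x
    using F(1)[of x] by (auto intro!: derivative_eq_intros)
  ultimately show thesis using that[of "\<lambda>x. c + F x"] by blast
qed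

lemma sobolev_3_C2_representative:
  assumes "sobolev 3 \<mu>" "weak_deriv 1 \<mu> \<mu>'"
  obtains M M' M'' where "\<And>x. (M has_real_derivative M' x) (at x)"
    "\<And>x. (M' has_real_derivative M'' x) (at x)" "continuous_on UNIV M''"
    "AE x in leb 0 1. \<mu> x = M x" "AE x in leb 0 1. \<mu>' x = M' x"
proof -
  obtain g1 g2 g3 where g: "L2 0 1 g1" "weak_deriv 1 \<mu> g1" "L2 0 1 g2" "weak_deriv 2 \<mu> g2"
      "L2 0 1 g3" "weak_deriv 3 \<mu> g3"
  proof -
    have "\<exists>g. L2 0 1 g \<and> weak_deriv k \<mu> g" if "k \<in> {1..3}" for k
      using assms(1) that by (simp add: sobolev_def)
    from this[of 1] this[of 2] this[of 3] show thesis using that by auto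
  qed
  have w: "weak_deriv 1 g1 g2" "weak_deriv 1 g2 g3"
    using weak_deriv_Suc[of 1 \<mu> g1 g2] weak_deriv_Suc[of 2 \<mu> g2 g3] g
    by (simp_all add: numeral_2_eq_2 numeral_3_eq_3)
  note gi = g(1,3,5)[THEN L2_imp_integrable]
  obtain c where c: "AE x in leb 0 1. g2 x = c + lint 0 x g3"
    using weak_deriv_imp_primitive[OF w(2) gi(3)] .
  \<comment> \<open>Clamping the argument to \<open>{0..1}\<close> extends the primitive of the
    third derivative continuously to the whole line; outside (0,1) its values are
    immaterial.\<close>
  define M'' where "M'' = (\<lambda>x. c + lint 0 (max 0 (min 1 x)) g3)"
  have "continuous_on UNIV M''"
    unfolding M''_def
    by (intro continuous_on_add continuous_on_const
        continuous_on_compose2[OF continuous_on_integral_leb[OF gi(3)]] continuous_intros) auto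
  have "AE x in leb 0 1. x \<in> {0<..<1}" by (rule AE_I2) simp
  with c have "AE x in leb 0 1. g2 x = M'' x"
    by eventually_elim (simp add: M''_def)
  from weak_deriv_C1_representative[OF w(1) gi(2) this \<open>continuous_on UNIV M''\<close>]
  obtain M' where M': "\<And>x. (M' has_real_derivative M'' x) (at x)" "AE x in leb 0 1. g1 x = M' x" by blast
  have "continuous_on UNIV M'"
    using M'(1) by (meson DERIV_isCont continuous_at_imp_continuous_on)
  from weak_deriv_C1_representative[OF g(2) gi(1) M'(2) this]
  obtain M where M: "\<And>x. (M has_real_derivative M' x) (at x)" "AE x in leb 0 1. \<mu> x = M x" by blast
  have "AE x in leb 0 1. \<mu>' x = g1 x" by (rule weak_deriv_unique[OF assms(2) g(2)])
  with M'(2) have "AE x in leb 0 1. \<mu>' x = M' x" by eventually_elim simp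
  with M M' \<open>continuous_on UNIV M''\<close> show thesis using that by blast
qed

subsection \<open>The space \<open>L\<^sup>2\<close>\<close>

lemma integrable_mult_if_square_integrable:
  fixes f g :: "'a \<Rightarrow> real"
  assumes "f \<in> borel_measurable M" "g \<in> borel_measurable M"
    "integrable M (\<lambda>x. (f x)\<^sup>2)" "integrable M (\<lambda>x. (g x)\<^sup>2)"
  shows "integrable M (\<lambda>x. f x * g x)"
proof (rule Bochner_Integration.integrable_bound)
  show "integrable M (\<lambda>x. (f x)\<^sup>2 + (g x)\<^sup>2)" using assms by simp
  have "\<bar>f x * g x\<bar> \<le> (f x)\<^sup>2 + (g x)\<^sup>2" for x
  proof -
    have "2 * (\<bar>f x\<bar> * \<bar>g x\<bar>) \<le> (f x)\<^sup>2 + (g x)\<^sup>2"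
      using sum_squares_bound[of "\<bar>f x\<bar>" "\<bar>g x\<bar>"] by (simp add: mult.assoc)
    moreover have "0 \<le> \<bar>f x\<bar> * \<bar>g x\<bar>" by simp
    ultimately show ?thesis unfolding abs_mult by linarith
  qed
  then show "AE x in M. norm (f x * g x) \<le> norm ((f x)\<^sup>2 + (g x)\<^sup>2)" by auto
qed (use assms in auto)

lemma Cauchy_Schwarz_integral:
  fixes f g :: "'a \<Rightarrow> real"
  assumes "f \<in> borel_measurable M" "g \<in> borel_measurable M"
    "integrable M (\<lambda>x. (f x)\<^sup>2)" "integrable M (\<lambda>x. (g x)\<^sup>2)"
  shows "integral\<^sup>L M (\<lambda>x. f x * g x) \<le> sqrt (integral\<^sup>L M (\<lambda>x. (f x)\<^sup>2)) * sqrt (integral\<^sup>L M (\<lambda>x. (g x)\<^sup>2))"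
proof -
  note i = integrable_mult_if_square_integrable[OF assms]
  define A where "A = integral\<^sup>L M (\<lambda>x. (f x)\<^sup>2)"
  define B where "B = integral\<^sup>L M (\<lambda>x. (g x)\<^sup>2)"
  define C where "C = integral\<^sup>L M (\<lambda>x. f x * g x)"
  have AB: "A \<ge> 0" "B \<ge> 0" unfolding A_def B_def by (auto intro: integral_nonneg_AE)
  have q: "0 \<le> t\<^sup>2 * A - 2 * t * C + B" for t
  proof -
    have "0 \<le> integral\<^sup>L M (\<lambda>x. (t * f x - g x)\<^sup>2)" by (rule integral_nonneg_AE) auto
    also have "(\<lambda>x. (t * f x - g x)\<^sup>2) = (\<lambda>x. t\<^sup>2 * (f x)\<^sup>2 - 2 * t * (f x * g x) + (g x)\<^sup>2)"
      by (auto simp: power2_eq_square algebra_simps)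
    also have "integral\<^sup>L M \<dots> = t\<^sup>2 * A - 2 * t * C + B"
      using assms(3,4) i by (simp add: A_def B_def C_def)
    finally show ?thesis .
  qed
  have "C\<^sup>2 \<le> A * B"
  proof (cases "A = 0")
    case True
    have "C = 0"
    proof (rule ccontr)
      assume "C \<noteq> 0"
      \<comment> \<open>With \<open>A = 0\<close> the expression is affine in \<open>t\<close>, and
        at this point it would equal -1.\<close>
      with q[of "(B + 1) / (2 * C)"] True show False by (simp add: field_simps)
    qed
    then show ?thesis using True by simp
  next
    case False
    then have "A > 0" using AB by simp
    \<comment> \<open>The minimiser of the quadratic.\<close>
    with q[of "C / A"] show ?thesis by (simp add: field_simps power2_eq_square)
  qed
  then have "\<bar>C\<bar> \<le> sqrt (A * B)" by (rule real_le_rsqrt[of "\<bar>C\<bar>", simplified])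
  then show ?thesis by (simp add: A_def B_def C_def real_sqrt_mult)
qed

abbreviation nrm :: "(real \<Rightarrow> complex) \<Rightarrow> real" where
  "nrm f \<equiv> L2norm 0 1 f"

abbreviation sqint :: "(real \<Rightarrow> complex) \<Rightarrow> bool" where
  "sqint f \<equiv> L2 0 1 f"

lemma sqint_measurable: "sqint f \<Longrightarrow> f \<in> borel_measurable (leb 0 1)"
  by (simp add: L2_def)

lemma sqint_bound:
  assumes "f \<in> borel_measurable (leb 0 1)" "sqint g" "AE x in leb 0 1. cmod (f x) \<le> C * cmod (g x)"
  shows "sqint f"
  unfolding L2_def
proof
  show "integrable (leb 0 1) (\<lambda>x. (cmod (f x))\<^sup>2)"
  proof (rule Bochner_Integration.integrable_bound)
    show "integrable (leb 0 1) (\<lambda>x. C\<^sup>2 * (cmod (g x))\<^sup>2)" using assms(2) by (simp add: L2_def)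
    show "AE x in leb 0 1. norm ((cmod (f x))\<^sup>2) \<le> norm (C\<^sup>2 * (cmod (g x))\<^sup>2)"
      using assms(3) by eventually_elim (use power_mono[OF _ norm_ge_zero] in \<open>force simp: power_mult_distrib\<close>)
  qed (use assms in auto)
qed (use assms in auto)

lemma sqint_continuous:
  assumes "continuous_on {0..1} f"
  shows "sqint f"
  unfolding L2_def using borel_measurable_continuous_leb[OF assms]
  by (auto intro!: integrable_continuous_leb continuous_intros assms)

lemma sqint_cmult: "sqint f \<Longrightarrow> sqint (\<lambda>x. c * f x)"
  by (rule sqint_bound[of _ f "cmod c"])
    (auto simp: norm_mult intro: borel_measurable_times sqint_measurable)

lemma sqint_0: "sqint (\<lambda>_. 0)"
  by (simp add: L2_def)

lemma sqint_add:
  assumes "sqint f" "sqint g"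
  shows "sqint (\<lambda>x. f x + g x)"
  unfolding L2_def
proof
  show "integrable (leb 0 1) (\<lambda>x. (cmod (f x + g x))\<^sup>2)"
  proof (rule Bochner_Integration.integrable_bound)
    show "integrable (leb 0 1) (\<lambda>x. 2 * ((cmod (f x))\<^sup>2 + (cmod (g x))\<^sup>2))"
      using assms by (simp add: L2_def)
    have "(cmod (f x + g x))\<^sup>2 \<le> 2 * ((cmod (f x))\<^sup>2 + (cmod (g x))\<^sup>2)" for x
    proof -
      have "(cmod (f x + g x))\<^sup>2 \<le> (cmod (f x) + cmod (g x))\<^sup>2"
        by (intro power_mono norm_triangle_ineq) auto
      also have "\<dots> \<le> 2 * ((cmod (f x))\<^sup>2 + (cmod (g x))\<^sup>2)"
        using sum_squares_bound[of "cmod (f x)" "cmod (g x)"] by (simp add: power2_sum)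
      finally show ?thesis .
    qed
    then show "AE x in leb 0 1. norm ((cmod (f x + g x))\<^sup>2) \<le> norm (2 * ((cmod (f x))\<^sup>2 + (cmod (g x))\<^sup>2))"
      by auto
  qed (use assms in \<open>auto simp: L2_def\<close>)
qed (use assms in \<open>auto simp: L2_def\<close>)

lemma sqint_diff: "sqint f \<Longrightarrow> sqint g \<Longrightarrow> sqint (\<lambda>x. f x - g x)"
  using sqint_add[of f "\<lambda>x. (- 1) * g x"] sqint_cmult[of g "- 1"] by simp

lemma sqint_sum: "(\<And>i. i \<in> A \<Longrightarrow> sqint (f i)) \<Longrightarrow> sqint (\<lambda>x. \<Sum>i\<in>A. f i x)"
  by (induction A rule: infinite_finite_induct) (auto intro: sqint_add sqint_0)

lemma integrable_ip:
  assumes "sqint f" "sqint g"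
  shows "integrable (leb 0 1) (\<lambda>x. f x * cnj (g x))"
proof (rule Bochner_Integration.integrable_bound)
  show "integrable (leb 0 1) (\<lambda>x. cmod (f x) * cmod (g x))"
    by (rule integrable_mult_if_square_integrable) (use assms in \<open>auto simp: L2_def\<close>)
  have "(\<lambda>x. cnj (g x)) \<in> borel_measurable (leb 0 1)"
    by (rule borel_measurable_continuous_onI[THEN measurable_compose_rev, OF continuous_on_cnj[OF continuous_on_id]])
      (use assms in \<open>auto simp: L2_def\<close>)
  then show "(\<lambda>x. f x * cnj (g x)) \<in> borel_measurable (leb 0 1)"
    using assms by (auto simp: L2_def)
qed (auto simp: norm_mult)

lemma ip_add_left: "sqint f \<Longrightarrow> sqint g \<Longrightarrow> sqint h \<Longrightarrow> ip (\<lambda>x. f x + g x) h = ip f h + ip g h"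
  using integrable_ip[of f h] integrable_ip[of g h] by (simp add: ip_def distrib_right)

lemma ip_cmult_left: "ip (\<lambda>x. c * f x) h = c * ip f h"
  by (simp add: ip_def mult.assoc)

lemma ip_diff_left: "sqint f \<Longrightarrow> sqint g \<Longrightarrow> sqint h \<Longrightarrow> ip (\<lambda>x. f x - g x) h = ip f h - ip g h"
  using integrable_ip[of f h] integrable_ip[of g h] by (simp add: ip_def left_diff_distrib)

lemma ip_zero_left: "ip (\<lambda>_. 0) h = 0"
  by (simp add: ip_def)

lemma ip_sum_left:
  assumes "\<And>i. i \<in> A \<Longrightarrow> sqint (f i)" "sqint h"
  shows "ip (\<lambda>x. \<Sum>i\<in>A. f i x) h = (\<Sum>i\<in>A. ip (f i) h)"
  using assms by (induction A rule: infinite_finite_induct)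
    (auto simp: ip_zero_left ip_add_left sqint_sum)

lemma ip_commute: "ip g f = cnj (ip f g)"
proof -
  have "cnj (ip f g) = lint 0 1 (\<lambda>x. cnj (f x * cnj (g x)))"
    unfolding ip_def by (rule Bochner_Integration.integral_cnj[symmetric])
  then show ?thesis by (simp add: ip_def mult.commute)
qed

lemma ip_cmult_right: "ip f (\<lambda>x. c * g x) = cnj c * ip f g"
  by (metis complex_cnj_mult ip_cmult_left ip_commute)

lemma ip_diff_right: "sqint f \<Longrightarrow> sqint g \<Longrightarrow> sqint h \<Longrightarrow> ip h (\<lambda>x. f x - g x) = ip h f - ip h g"
  by (metis complex_cnj_diff ip_diff_left ip_commute)

lemma ip_cong_AE:
  assumes "AE x in leb 0 1. f x = f' x" "AE x in leb 0 1. g x = g' x"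
    "sqint f" "sqint g" "sqint f'" "sqint g'"
  shows "ip f g = ip f' g'"
  unfolding ip_def
proof (rule integral_cong_AE)
  show "(\<lambda>x. f x * cnj (g x)) \<in> borel_measurable (leb 0 1)"
    "(\<lambda>x. f' x * cnj (g' x)) \<in> borel_measurable (leb 0 1)"
    using integrable_ip[of f g] integrable_ip[of f' g'] assms by auto
  show "AE x in leb 0 1. f x * cnj (g x) = f' x * cnj (g' x)"
    using assms(1,2) by eventually_elim simp
qed

lemma nrm_square: "(nrm f)\<^sup>2 = lint 0 1 (\<lambda>x. (cmod (f x))\<^sup>2)"
  unfolding L2norm_def by (rule real_sqrt_pow2) (auto intro: integral_nonneg_AE)

lemma nrm_nonneg: "0 \<le> nrm f"
  unfolding L2norm_def by (auto intro!: real_sqrt_ge_zero integral_nonneg_AE)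

lemma ip_self: "ip f f = of_real ((nrm f)\<^sup>2)"
proof -
  have "ip f f = lint 0 1 (\<lambda>x. complex_of_real ((cmod (f x))\<^sup>2))"
    unfolding ip_def by (rule Bochner_Integration.integral_cong) (auto simp: complex_norm_square simp del: of_real_power)
  also have "\<dots> = of_real ((nrm f)\<^sup>2)"
    by (simp add: nrm_square del: of_real_power)
  finally show ?thesis .
qed

lemma cmod_ip_le:
  assumes "sqint f" "sqint g"
  shows "cmod (ip f g) \<le> nrm f * nrm g"
proof -
  have "cmod (ip f g) \<le> lint 0 1 (\<lambda>x. cmod (f x * cnj (g x)))"
    unfolding ip_def by simp
  also have "\<dots> = lint 0 1 (\<lambda>x. cmod (f x) * cmod (g x))"
    by (simp add: norm_mult)
  also have "\<dots> \<le> nrm f * nrm g"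
    unfolding L2norm_def by (rule Cauchy_Schwarz_integral) (use assms in \<open>auto simp: L2_def\<close>)
  finally show ?thesis .
qed

text \<open>For unit vectors this makes the distance a function of the real part of the overlap
  alone; the comparison of \<open>\<psi>\<close> with \<open>\<Theta>\<close> rests on it.\<close>

lemma nrm_diff_square:
  assumes "sqint f" "sqint g"
  shows "(nrm (\<lambda>x. f x - g x))\<^sup>2 = (nrm f)\<^sup>2 + (nrm g)\<^sup>2 - 2 * Re (ip f g)"
proof -
  have "complex_of_real ((nrm (\<lambda>x. f x - g x))\<^sup>2) = ip (\<lambda>x. f x - g x) (\<lambda>x. f x - g x)"
    by (simp add: ip_self)
  also have "\<dots> = ip f f - ip f g - (ip g f - ip g g)"
    using assms by (simp add: ip_diff_left ip_diff_right sqint_diff)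
  also have "\<dots> = of_real ((nrm f)\<^sup>2) + of_real ((nrm g)\<^sup>2) - (ip f g + cnj (ip f g))"
    unfolding ip_self ip_commute[of g f] by simp
  also have "\<dots> = of_real ((nrm f)\<^sup>2 + (nrm g)\<^sup>2 - 2 * Re (ip f g))"
    by (simp add: complex_add_cnj)
  finally show ?thesis using of_real_eq_iff by blast
qed

lemma nrm_cmult: "nrm (\<lambda>x. c * f x) = cmod c * nrm f"
  unfolding L2norm_def by (simp add: norm_mult power_mult_distrib real_sqrt_mult)

lemma nrm_triangle:
  assumes "sqint f" "sqint g"
  shows "nrm (\<lambda>x. f x + g x) \<le> nrm f + nrm g"
proof (rule power2_le_imp_le)
  have "(nrm (\<lambda>x. f x - (- 1) * g x))\<^sup>2 = (nrm f)\<^sup>2 + (nrm g)\<^sup>2 + 2 * Re (ip f g)"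
    using nrm_diff_square[OF assms(1) sqint_cmult[OF assms(2)], of "- 1"]
    by (simp only: nrm_cmult ip_cmult_right) simp
  also have "Re (ip f g) \<le> nrm f * nrm g"
    using cmod_ip_le[OF assms] complex_Re_le_cmod order_trans by blast
  finally show "(nrm (\<lambda>x. f x + g x))\<^sup>2 \<le> (nrm f + nrm g)\<^sup>2" by (simp add: power2_sum)
qed (simp add: nrm_nonneg)

lemma nrm_minus_commute: "nrm (\<lambda>x. f x - g x) = nrm (\<lambda>x. g x - f x)"
  by (simp add: L2norm_def norm_minus_commute)

lemma nrm_triangle_diff:
  assumes "sqint f" "sqint g"
  shows "\<bar>nrm f - nrm g\<bar> \<le> nrm (\<lambda>x. f x - g x)"
proof -
  have "nrm f \<le> nrm (\<lambda>x. f x - g x) + nrm g" "nrm g \<le> nrm (\<lambda>x. g x - f x) + nrm f"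
    using nrm_triangle[OF sqint_diff[OF assms] assms(2)]
      nrm_triangle[OF sqint_diff[OF assms(2,1)] assms(1)] by simp_all
  then show ?thesis using nrm_minus_commute[of f g] by linarith
qed

lemma nrm_cong_AE:
  assumes "AE x in leb 0 1. f x = g x" "sqint f" "sqint g"
  shows "nrm f = nrm g"
proof -
  have "complex_of_real ((nrm f)\<^sup>2) = complex_of_real ((nrm g)\<^sup>2)"
    unfolding ip_self[symmetric] by (rule ip_cong_AE) (use assms in auto)
  then have "(nrm f)\<^sup>2 = (nrm g)\<^sup>2" using of_real_eq_iff by blast
  then show ?thesis using nrm_nonneg by (simp add: power2_eq_iff_nonneg)
qed

lemma nrm_le_if_bounded:
  assumes "f \<in> borel_measurable (leb 0 1)" "sqint g" "AE x in leb 0 1. cmod (f x) \<le> C * cmod (g x)" "C \<ge> 0"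
  shows "nrm f \<le> C * nrm g"
proof -
  have "lint 0 1 (\<lambda>x. (cmod (f x))\<^sup>2) \<le> lint 0 1 (\<lambda>x. C\<^sup>2 * (cmod (g x))\<^sup>2)"
  proof (rule integral_mono_AE)
    show "AE x in leb 0 1. (cmod (f x))\<^sup>2 \<le> C\<^sup>2 * (cmod (g x))\<^sup>2"
      using assms(3) by eventually_elim (use power_mono[OF _ norm_ge_zero] in \<open>force simp: power_mult_distrib\<close>)
  qed (use sqint_bound[OF assms(1-3)] assms(2) in \<open>auto simp: L2_def\<close>)
  then have "(nrm f)\<^sup>2 \<le> (C * nrm g)\<^sup>2" by (simp add: nrm_square power_mult_distrib)
  then show ?thesis by (rule power2_le_imp_le) (simp add: nrm_nonneg assms(4))
qed

subsection \<open>Sine series\<close>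

lemma continuous_on_phi: "continuous_on A (\<phi> k)"
  unfolding \<phi>_def[abs_def] by (intro continuous_intros)

lemma sqint_phi: "sqint (\<phi> k)"
  by (rule sqint_continuous[OF continuous_on_phi])

lemma cnj_phi [simp]: "cnj (\<phi> k x) = \<phi> k x"
  by (simp add: \<phi>_def)

lemma integral_cos_pi:
  assumes "m \<noteq> 0"
  shows "lint 0 1 (\<lambda>x. cos (of_int m * pi * x)) = 0"
proof -
  have "primitive_on 1 (\<lambda>x. sin (of_int m * pi * x) / (of_int m * pi)) (\<lambda>x. cos (of_int m * pi * x))"
    by (rule primitive_on_FTC)
      (use assms in \<open>auto simp: has_real_derivative_iff_has_vector_derivative[symmetric]
        intro!: derivative_eq_intros continuous_intros\<close>)
  from primitive_onD(2)[OF this, of 1] show ?thesis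
    by (simp add: mult.commute[of "of_int m"])
qed

lemma ip_phi_phi:
  assumes "j \<ge> 1" "k \<ge> 1"
  shows "ip (\<phi> j) (\<phi> k) = (if j = k then 1 else 0)"
proof -
  have i: "integrable (leb 0 1) (\<lambda>x. cos (of_int m * pi * x))" for m
    by (intro integrable_continuous_leb continuous_intros)
  \<comment> \<open>The difference of the frequencies is formed in the integers, since natural
    subtraction would truncate when \<open>j < k\<close>.\<close>
  have "\<phi> j x * cnj (\<phi> k x) = of_real (cos (of_int (int j - int k) * pi * x) - cos (of_int (int j + int k) * pi * x))" for x
  proof -
    have "\<phi> j x * cnj (\<phi> k x) = of_real (2 * (sin (real j * pi * x) * sin (real k * pi * x)))"
      by (simp add: \<phi>_def flip: of_real_mult)
    also have "2 * (sin (real j * pi * x) * sin (real k * pi * x))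
        = cos (real j * pi * x - real k * pi * x) - cos (real j * pi * x + real k * pi * x)"
      by (simp add: cos_add cos_diff)
    finally show ?thesis by (simp add: algebra_simps)
  qed
  then have "ip (\<phi> j) (\<phi> k) = of_real (lint 0 1 (\<lambda>x. cos (of_int (int j - int k) * pi * x))
      - lint 0 1 (\<lambda>x. cos (of_int (int j + int k) * pi * x)))"
    unfolding ip_def by (simp only: integral_complex_of_real Bochner_Integration.integral_diff[OF i i])
  also have "lint 0 1 (\<lambda>x. cos (of_int (int j + int k) * pi * x)) = 0"
    by (rule integral_cos_pi) (use assms in auto)
  also have "lint 0 1 (\<lambda>x. cos (of_int (int j - int k) * pi * x)) = (if j = k then 1 else 0)"
    using integral_cos_pi[of "int j - int k"] integral_leb_const[of 0 1 1] by simp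
  finally show ?thesis by simp
qed

lemma nrm_phi: "k \<ge> 1 \<Longrightarrow> nrm (\<phi> k) = 1"
  using ip_self[of "\<phi> k"] ip_phi_phi[of k k] nrm_nonneg[of "\<phi> k"]
  by (simp del: of_real_power add: power2_eq_1_iff)

section \<open>Finite sine sums, Bessel and Riesz-Fischer\<close>

definition sine_sum :: "(nat \<Rightarrow> complex) \<Rightarrow> nat \<Rightarrow> real \<Rightarrow> complex" where
  "sine_sum c n x = (\<Sum>k=1..n. c k * \<phi> k x)"

lemma sqint_sine_sum: "sqint (sine_sum c n)"
  unfolding sine_sum_def[abs_def] by (intro sqint_sum sqint_cmult sqint_phi)

lemma ip_sine_sum_left: "sqint h \<Longrightarrow> ip (sine_sum c n) h = (\<Sum>k=1..n. c k * ip (\<phi> k) h)"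
  unfolding sine_sum_def[abs_def]
  by (simp add: ip_sum_left ip_cmult_left sqint_cmult sqint_phi)

lemma ip_sine_sum_phi: "j \<ge> 1 \<Longrightarrow> ip (sine_sum c n) (\<phi> j) = (if j \<le> n then c j else 0)"
proof -
  assume j: "j \<ge> 1"
  have "ip (sine_sum c n) (\<phi> j) = (\<Sum>k=1..n. if k = j then c k else 0)"
    unfolding ip_sine_sum_left[OF sqint_phi] by (rule sum.cong) (use j in \<open>auto simp: ip_phi_phi\<close>)
  then show ?thesis using j by (simp add: sum.delta)
qed

lemma nrm_sine_sum: "(nrm (sine_sum c n))\<^sup>2 = (\<Sum>k=1..n. (cmod (c k))\<^sup>2)"
proof -
  have "complex_of_real ((nrm (sine_sum c n))\<^sup>2) = (\<Sum>k=1..n. c k * ip (\<phi> k) (sine_sum c n))"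
    by (simp only: ip_self[symmetric] ip_sine_sum_left[OF sqint_sine_sum])
  also have "\<dots> = (\<Sum>k=1..n. complex_of_real ((cmod (c k))\<^sup>2))"
    by (rule sum.cong)
      (auto simp: ip_commute[of "\<phi> _"] ip_sine_sum_phi complex_norm_square simp del: of_real_power)
  finally show ?thesis by (simp only: of_real_sum[symmetric] of_real_eq_iff)
qed

lemma sum_from_1_split:
  fixes f :: "nat \<Rightarrow> 'a::comm_monoid_add"
  assumes "m \<le> n"
  shows "sum f {1..n} = sum f {1..m} + sum f {Suc m..n}"
proof -
  have "{1..n} = {1..m} \<union> {Suc m..n}" using assms by auto
  then show ?thesis by (simp add: sum.union_disjoint)
qed

lemma sine_sum_diff: "m \<le> n \<Longrightarrow> sine_sum c n x - sine_sum c m x = sine_sum (\<lambda>k. if k \<le> m then 0 else c k) n x"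
proof -
  assume mn: "m \<le> n"
  have "sine_sum c n x = (\<Sum>k=1..m. c k * \<phi> k x) + (\<Sum>k=Suc m..n. c k * \<phi> k x)"
    unfolding sine_sum_def by (rule sum_from_1_split[OF mn])
  moreover have "sine_sum (\<lambda>k. if k \<le> m then 0 else c k) n x = (\<Sum>k=Suc m..n. c k * \<phi> k x)"
    unfolding sine_sum_def by (rule sum.mono_neutral_cong_right) auto
  ultimately show ?thesis by (simp add: sine_sum_def)
qed

lemma nrm_sine_sum_diff:
  assumes "m \<le> n"
  shows "(nrm (\<lambda>x. sine_sum c n x - sine_sum c m x))\<^sup>2 = (\<Sum>k=1..n. (cmod (c k))\<^sup>2) - (\<Sum>k=1..m. (cmod (c k))\<^sup>2)"
proof -
  have "(nrm (\<lambda>x. sine_sum c n x - sine_sum c m x))\<^sup>2 = (\<Sum>k=1..n. (cmod (if k \<le> m then 0 else c k))\<^sup>2)"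
    unfolding sine_sum_diff[OF assms] by (rule nrm_sine_sum)
  also have "\<dots> = (\<Sum>k=Suc m..n. (cmod (c k))\<^sup>2)"
    by (rule sum.mono_neutral_cong_right) auto
  also have "\<dots> = (\<Sum>k=1..n. (cmod (c k))\<^sup>2) - (\<Sum>k=1..m. (cmod (c k))\<^sup>2)"
    using sum_from_1_split[OF assms, of "\<lambda>k. (cmod (c k))\<^sup>2"] by simp
  finally show ?thesis .
qed

lemma nrm_minus_sine_sum:
  assumes "sqint f"
  shows "(nrm (\<lambda>x. f x - sine_sum (\<lambda>k. ip f (\<phi> k)) n x))\<^sup>2 = (nrm f)\<^sup>2 - (\<Sum>k=1..n. (cmod (ip f (\<phi> k)))\<^sup>2)"
proof -
  let ?c = "\<lambda>k. ip f (\<phi> k)"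
  have "ip f (sine_sum ?c n) = cnj (\<Sum>k=1..n. ?c k * ip (\<phi> k) f)"
    using ip_commute[of f "sine_sum ?c n"] ip_sine_sum_left[OF assms] by simp
  also have "\<dots> = (\<Sum>k=1..n. complex_of_real ((cmod (?c k))\<^sup>2))"
    unfolding cnj_sum
    by (rule sum.cong) (auto simp: ip_commute[of "\<phi> _"] complex_norm_square simp del: of_real_power)
  finally have "Re (ip f (sine_sum ?c n)) = (\<Sum>k=1..n. (cmod (?c k))\<^sup>2)" by simp
  then show ?thesis
    using nrm_diff_square[OF assms sqint_sine_sum, of ?c n] by (simp add: nrm_sine_sum)
qed

lemma Bessel:
  assumes "sqint f"
  shows "(\<Sum>k=1..n. (cmod (ip f (\<phi> k)))\<^sup>2) \<le> (nrm f)\<^sup>2"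
  using nrm_minus_sine_sum[OF assms, of n] zero_le_power2 by (smt (verit))

lemma integral_cmod_le_nrm:
  assumes "sqint f"
  shows "lint 0 1 (\<lambda>x. cmod (f x)) \<le> nrm f"
proof -
  have "lint 0 1 (\<lambda>x. cmod (f x) * 1) \<le> nrm f * sqrt (lint 0 1 (\<lambda>x. 1\<^sup>2))"
    unfolding L2norm_def by (rule Cauchy_Schwarz_integral) (use assms in \<open>auto simp: L2_def\<close>)
  then show ?thesis using integral_leb_const[of 0 1 1] by simp
qed

text \<open>Riesz--Fischer: an almost everywhere convergent subsequence of the partial sums gives the
  limit, and Fatou's lemma the convergence in norm.\<close>

lemma sine_series_converges:
  assumes sm: "summable (\<lambda>k. (cmod (c k))\<^sup>2)"
  obtains g where "sqint g" "(\<lambda>n. nrm (\<lambda>x. g x - sine_sum c n x)) \<longlonglongrightarrow> 0"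
proof -
  define q where "q n = (\<Sum>k=1..n. (cmod (c k))\<^sup>2)" for n
  have qd: "(nrm (\<lambda>x. sine_sum c n x - sine_sum c m x))\<^sup>2 = \<bar>q n - q m\<bar>" for m n
  proof (cases "m \<le> n")
    case True
    then show ?thesis
      using nrm_sine_sum_diff[OF True, of c] zero_le_power2[of "nrm (\<lambda>x. sine_sum c n x - sine_sum c m x)"]
      unfolding q_def by linarith
  next
    case False
    then show ?thesis
      using nrm_sine_sum_diff[of n m c] zero_le_power2[of "nrm (\<lambda>x. sine_sum c n x - sine_sum c m x)"]
        nrm_minus_commute[of "sine_sum c n" "sine_sum c m"]
      unfolding q_def by simp
  qed
  \<comment> \<open>Series are indexed from 0, the basis from 1, so the entry at 0 is subtracted
    again.\<close>
  have qeq: "q = (\<lambda>n. (\<Sum>k\<le>n. (cmod (c k))\<^sup>2) - (cmod (c 0))\<^sup>2)"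
    unfolding q_def by (simp add: atMost_atLeast0 sum.atLeast_Suc_atMost fun_eq_iff)
  define Q where "Q = suminf (\<lambda>k. (cmod (c k))\<^sup>2) - (cmod (c 0))\<^sup>2"
  have Q: "q \<longlonglongrightarrow> Q"
    unfolding qeq Q_def by (rule tendsto_diff[OF summable_LIMSEQ'[OF sm] tendsto_const])
  have inc: "q m \<le> q n" if "m \<le> n" for m n
    unfolding q_def by (rule sum_mono2) (use that in auto)
  have qQ: "q n \<le> Q" for n
    by (rule LIMSEQ_le_const[OF Q]) (use inc in blast)
  have Pm: "sine_sum c n \<in> borel_measurable (leb 0 1)" for n
    by (rule sqint_measurable[OF sqint_sine_sum])
  have "\<exists>N. \<forall>i\<ge>N. \<forall>j\<ge>N. lint 0 1 (\<lambda>x. cmod (sine_sum c i x - sine_sum c j x)) < e"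
    if e: "e > 0" for e
  proof -
    have "\<forall>\<^sub>F n in sequentially. Q - e\<^sup>2 < q n"
      using order_tendstoD(1)[OF Q, of "Q - e\<^sup>2"] e by simp
    then obtain N where N: "\<And>n. n \<ge> N \<Longrightarrow> Q - e\<^sup>2 < q n" by (auto simp: eventually_sequentially)
    have "lint 0 1 (\<lambda>x. cmod (sine_sum c i x - sine_sum c j x)) < e" if "i \<ge> N" "j \<ge> N" for i j
    proof -
      have "(nrm (\<lambda>x. sine_sum c i x - sine_sum c j x))\<^sup>2 < e\<^sup>2"
        unfolding qd using N[OF that(1)] N[OF that(2)] qQ[of i] qQ[of j] by (simp add: abs_less_iff)
      then have "nrm (\<lambda>x. sine_sum c i x - sine_sum c j x) < e"
        by (rule power_less_imp_less_base) (use e in simp)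
      then show ?thesis
        using integral_cmod_le_nrm[OF sqint_diff[OF sqint_sine_sum[of c i] sqint_sine_sum[of c j]]] by simp
    qed
    then show ?thesis by blast
  qed
  \<comment> \<open>The subsequence theorem works in L1; the Cauchy property there follows from the
    one in L2 because the interval has length 1.\<close>
  from cauchy_L1_AE_cauchy_subseq[OF L2_imp_integrable[OF sqint_sine_sum] this]
  obtain r where r: "strict_mono r" "AE x in leb 0 1. Cauchy (\<lambda>i. sine_sum c (r i) x)" by blast
  define g where "g x = lim (\<lambda>i. sine_sum c (r i) x)" for x
  have gm: "g \<in> borel_measurable (leb 0 1)"
    unfolding g_def[abs_def] by (rule borel_measurable_lim_metric) (rule Pm)
  have lim: "AE x in leb 0 1. (\<lambda>i. sine_sum c (r i) x) \<longlonglongrightarrow> g x"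
    using r(2) by eventually_elim (simp add: g_def Cauchy_convergent convergent_LIMSEQ_iff[symmetric])
  \<comment> \<open>One index stays at \<open>n\<close> while the other runs through the
    subsequence. The bound \<open>Q - q n\<close> serves twice: it is finite, so the difference is
    square integrable, and it tends to 0.\<close>
  have fatou: "(\<integral>\<^sup>+x. ennreal ((cmod (g x - sine_sum c n x))\<^sup>2) \<partial>leb 0 1) \<le> ennreal (Q - q n)" for n
  proof -
    have "(\<integral>\<^sup>+x. ennreal ((cmod (g x - sine_sum c n x))\<^sup>2) \<partial>leb 0 1)
        = (\<integral>\<^sup>+x. liminf (\<lambda>i. ennreal ((cmod (sine_sum c (r i) x - sine_sum c n x))\<^sup>2)) \<partial>leb 0 1)"
    proof (rule nn_integral_cong_AE)
      show "AE x in leb 0 1. ennreal ((cmod (g x - sine_sum c n x))\<^sup>2)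
          = liminf (\<lambda>i. ennreal ((cmod (sine_sum c (r i) x - sine_sum c n x))\<^sup>2))"
        using lim
      proof eventually_elim
        case (elim x)
        have "(\<lambda>i. ennreal ((cmod (sine_sum c (r i) x - sine_sum c n x))\<^sup>2))
            \<longlonglongrightarrow> ennreal ((cmod (g x - sine_sum c n x))\<^sup>2)"
          by (intro tendsto_intros elim)
        from lim_imp_Liminf[OF _ this] show ?case by simp
      qed
    qed
    also have "\<dots> \<le> liminf (\<lambda>i. \<integral>\<^sup>+x. ennreal ((cmod (sine_sum c (r i) x - sine_sum c n x))\<^sup>2) \<partial>leb 0 1)"
      by (rule nn_integral_liminf) (use Pm in measurable)
    also have "(\<lambda>i. \<integral>\<^sup>+x. ennreal ((cmod (sine_sum c (r i) x - sine_sum c n x))\<^sup>2) \<partial>leb 0 1)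
        = (\<lambda>i. ennreal \<bar>q (r i) - q n\<bar>)"
      unfolding qd[symmetric] nrm_square
      by (intro ext nn_integral_eq_integral)
        (use sqint_diff[OF sqint_sine_sum sqint_sine_sum] in \<open>auto simp: L2_def\<close>)
    also have "liminf (\<lambda>i. ennreal \<bar>q (r i) - q n\<bar>) = ennreal \<bar>Q - q n\<bar>"
      by (rule lim_imp_Liminf)
        (use LIMSEQ_subseq_LIMSEQ[OF Q r(1)] in \<open>auto intro!: tendsto_intros simp: o_def\<close>)
    finally show ?thesis using qQ[of n] by simp
  qed
  have sq: "sqint (\<lambda>x. g x - sine_sum c n x)" for n
    unfolding L2_def integrable_iff_bounded
    using fatou[of n] gm Pm[of n] by (auto simp: less_top[symmetric] top_unique)
  have "sqint (\<lambda>x. (g x - sine_sum c 0 x) + sine_sum c 0 x)"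
    by (rule sqint_add[OF sq sqint_sine_sum])
  then have g: "sqint g" by simp
  have le: "(nrm (\<lambda>x. g x - sine_sum c n x))\<^sup>2 \<le> Q - q n" for n
  proof -
    have "ennreal ((nrm (\<lambda>x. g x - sine_sum c n x))\<^sup>2) = (\<integral>\<^sup>+x. ennreal ((cmod (g x - sine_sum c n x))\<^sup>2) \<partial>leb 0 1)"
      unfolding nrm_square by (rule nn_integral_eq_integral[symmetric]) (use sq in \<open>auto simp: L2_def\<close>)
    then have "ennreal ((nrm (\<lambda>x. g x - sine_sum c n x))\<^sup>2) \<le> ennreal (Q - q n)"
      using fatou[of n] by metis
    moreover have "0 \<le> Q - q n" using qQ[of n] by simp
    ultimately show ?thesis using ennreal_le_iff by blast
  qed
  have "(\<lambda>n. Q - q n) \<longlonglongrightarrow> 0" using tendsto_diff[OF tendsto_const Q, of Q] by simp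
  then have "(\<lambda>n. (nrm (\<lambda>x. g x - sine_sum c n x))\<^sup>2) \<longlonglongrightarrow> 0"
    by (rule tendsto_sandwich[OF _ _ tendsto_const, rotated 2]) (use le in auto)
  then have "(\<lambda>n. sqrt ((nrm (\<lambda>x. g x - sine_sum c n x))\<^sup>2)) \<longlonglongrightarrow> sqrt 0" by (rule tendsto_real_sqrt)
  then have "(\<lambda>n. nrm (\<lambda>x. g x - sine_sum c n x)) \<longlonglongrightarrow> 0" by (simp add: nrm_nonneg)
  with g show thesis by (rule that)
qed

lemma ip_limit_phi:
  assumes g: "sqint g" "(\<lambda>n. nrm (\<lambda>x. g x - sine_sum c n x)) \<longlonglongrightarrow> 0" and j: "j \<ge> 1"
  shows "ip g (\<phi> j) = c j"
proof -
  have le: "cmod (ip g (\<phi> j) - c j) \<le> nrm (\<lambda>x. g x - sine_sum c n x)" if "n \<ge> j" for n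
  proof -
    have "ip g (\<phi> j) - c j = ip (\<lambda>x. g x - sine_sum c n x) (\<phi> j)"
      using that j by (simp add: ip_diff_left[OF g(1) sqint_sine_sum sqint_phi] ip_sine_sum_phi)
    then show ?thesis
      using cmod_ip_le[OF sqint_diff[OF g(1) sqint_sine_sum] sqint_phi, of c n j] nrm_phi[OF j] by simp
  qed
  have "cmod (ip g (\<phi> j) - c j) \<le> 0"
    by (rule LIMSEQ_le_const[OF g(2)]) (use le in blast)
  then show ?thesis by simp
qed

text \<open>Index 0 is outside the basis and is set to 0, so that the partial sums of the series are
  the sums in Bessel's inequality.\<close>

lemma summable_ip_phi:
  assumes "sqint f"
  shows "summable (\<lambda>k. (cmod (if k = 0 then 0 else ip f (\<phi> k)))\<^sup>2)"
proof (rule bounded_imp_summable)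
  fix n
  have "(\<Sum>k\<le>n. (cmod (if k = 0 then 0 else ip f (\<phi> k)))\<^sup>2) = (\<Sum>k=1..n. (cmod (ip f (\<phi> k)))\<^sup>2)"
    by (rule sum.mono_neutral_cong_right) auto
  then show "(\<Sum>k\<le>n. (cmod (if k = 0 then 0 else ip f (\<phi> k)))\<^sup>2) \<le> (nrm f)\<^sup>2"
    using Bessel[OF assms] by simp
qed simp

lemma sine_sum_cong: "(\<And>k. k \<ge> 1 \<Longrightarrow> c k = d k) \<Longrightarrow> sine_sum c n = sine_sum d n"
  by (auto simp: sine_sum_def fun_eq_iff)

section \<open>Completeness of the sines\<close>

text \<open>Multiplying \<open>sin (k \<pi> x)\<close> by \<open>cos (\<pi> x)\<close> stays in the span of the sines, so a function
  orthogonal to all sines is orthogonal to \<open>sin (\<pi> x) p (cos (\<pi> x))\<close> for every polynomial \<open>p\<close>.\<close>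

definition sine_orth :: "(real \<Rightarrow> real) \<Rightarrow> (real \<Rightarrow> real) \<Rightarrow> bool" where
  "sine_orth h g \<longleftrightarrow> continuous_on {0..1} g \<and>
     (\<forall>k. lint 0 1 (\<lambda>x. h x * (sin (real k * pi * x) * g x)) = 0)"

lemma sine_orth_lin:
  assumes h: "integrable (leb 0 1) h" and "sine_orth h f" "sine_orth h g"
  shows "sine_orth h (\<lambda>x. a * f x + b * g x)"
  unfolding sine_orth_def
proof (intro conjI allI)
  have c: "continuous_on {0..1} f" "continuous_on {0..1} g" using assms by (auto simp: sine_orth_def)
  then show "continuous_on {0..1} (\<lambda>x. a * f x + b * g x)" by (intro continuous_intros)
  fix k
  have i: "integrable (leb 0 1) (\<lambda>x. h x * (sin (real k * pi * x) * f x))"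
    "integrable (leb 0 1) (\<lambda>x. h x * (sin (real k * pi * x) * g x))"
    by (intro integrable_mult_continuous h continuous_intros c)+
  have "(\<lambda>x. h x * (sin (real k * pi * x) * (a * f x + b * g x)))
      = (\<lambda>x. a * (h x * (sin (real k * pi * x) * f x)) + b * (h x * (sin (real k * pi * x) * g x)))"
    by (simp add: algebra_simps)
  then show "lint 0 1 (\<lambda>x. h x * (sin (real k * pi * x) * (a * f x + b * g x))) = 0"
    using i assms(2,3) by (simp add: sine_orth_def)
qed

lemma sine_orth_cos:
  assumes h: "integrable (leb 0 1) h" and g: "sine_orth h g"
  shows "sine_orth h (\<lambda>x. cos (pi * x) * g x)"
  unfolding sine_orth_def
proof (intro conjI allI)
  have c: "continuous_on {0..1} g" using g by (auto simp: sine_orth_def)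
  then show "continuous_on {0..1} (\<lambda>x. cos (pi * x) * g x)" by (intro continuous_intros)
  fix k
  have i: "integrable (leb 0 1) (\<lambda>x. h x * (sin (real k * pi * x) * g x))" for k
    by (intro integrable_mult_continuous h continuous_intros c)
  have z: "lint 0 1 (\<lambda>x. h x * (sin (real k * pi * x) * g x)) = 0" for k
    using g by (simp add: sine_orth_def)
  show "lint 0 1 (\<lambda>x. h x * (sin (real k * pi * x) * (cos (pi * x) * g x))) = 0"
  proof (cases k)
    \<comment> \<open>The product has the frequencies \<open>k + 1\<close> and \<open>k - 1\<close>;
      admitting frequency 0 in \<open>sine_orth\<close> keeps the lower one in range.\<close>
    case (Suc j)
    have "sin (real k * pi * x) * cos (pi * x)
        = (1/2) * sin (real (Suc k) * pi * x) + (1/2) * sin (real j * pi * x)" for x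
    proof -
      have "real (Suc k) * pi * x = real k * pi * x + pi * x" "real j * pi * x = real k * pi * x - pi * x"
        by (simp_all add: Suc algebra_simps)
      then show ?thesis by (simp only: sin_add sin_diff) (simp add: field_simps)
    qed
    then have "h x * (sin (real k * pi * x) * (cos (pi * x) * g x))
        = (1/2) * (h x * (sin (real (Suc k) * pi * x) * g x)) + (1/2) * (h x * (sin (real j * pi * x) * g x))" for x
      by (simp only: mult.assoc[symmetric]) (simp add: algebra_simps)
    then show ?thesis using i z by (simp del: of_nat_Suc)
  qed simp
qed

text \<open>The substitution y = (1 + cos(pi x))/2 identifies \<open>{0..1}\<close> with itself, and
  a Bernstein polynomial is built from powers of \<open>y\<close> and \<open>1 - y\<close>, both
  affine in cos(pi x); so it is reached by repeated use of \<open>sine_orth_cos\<close>.\<close>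

lemma sine_orth_Bernstein:
  assumes h: "integrable (leb 0 1) h" and orth: "sine_orth h (\<lambda>_. 1)"
  shows "sine_orth h (\<lambda>x. \<Sum>k\<le>n. c k * Bernstein n k ((1 + cos (pi * x)) / 2))"
proof -
  have p: "sine_orth h (\<lambda>x. (a + b * cos (pi * x)) * g x)" if "sine_orth h g" for g a b
    using sine_orth_lin[OF h that sine_orth_cos[OF h that], of a b] by (simp add: algebra_simps)
  have m: "sine_orth h (\<lambda>x. ((1 + cos (pi * x)) / 2) ^ i * (((1 - cos (pi * x)) / 2) ^ j * 1))" for i j
  proof (induction i)
    case 0
    show ?case
    proof (induction j)
      case (Suc j)
      from p[OF this, of "1/2" "-1/2"] show ?case by (simp add: field_simps)
    qed (use orth in simp)
  next
    case (Suc i)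
    from p[OF this, of "1/2" "1/2"] show ?case by (simp add: field_simps)
  qed
  have b: "sine_orth h (\<lambda>x. c k * Bernstein n k ((1 + cos (pi * x)) / 2))" for k
  proof -
    \<comment> \<open>The summand with factor 0 only brings the term into the two-term shape of
      \<open>sine_orth_lin\<close>.\<close>
    have e: "c k * Bernstein n k ((1 + cos (pi * x)) / 2) = (c k * real (n choose k)) *
        (((1 + cos (pi * x)) / 2) ^ k * (((1 - cos (pi * x)) / 2) ^ (n - k) * 1)) + 0 *
        (((1 + cos (pi * x)) / 2) ^ k * (((1 - cos (pi * x)) / 2) ^ (n - k) * 1))" for x
    proof -
      have "1 - (1 + cos (pi * x)) / 2 = (1 - cos (pi * x)) / 2" by (simp add: field_simps)
      then show ?thesis
        unfolding Bernstein_def by (simp only: mult_1_right mult_zero_left add_0_right mult.assoc)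
    qed
    show ?thesis unfolding e by (rule sine_orth_lin[OF h m m])
  qed
  have "sine_orth h (\<lambda>x. \<Sum>k\<in>A. c k * Bernstein n k ((1 + cos (pi * x)) / 2))" if "finite A" for A
    using that
  proof induction
    case (insert k A)
    from sine_orth_lin[OF h b[of k] insert.IH, of 1 1] show ?case using insert by simp
  qed (simp add: sine_orth_def)
  then show ?thesis by simp
qed

text \<open>Polynomials in cos(pi x) are uniformly dense in the continuous functions on
  \<open>{0..1}\<close>, because cos(pi x) is injective there. Hence h(x) sin(pi x) integrates to 0
  against every continuous function and vanishes almost everywhere, and sin(pi x) is positive inside
  the interval.\<close>

lemma sine_complete_real:
  fixes h :: "real \<Rightarrow> real"
  assumes h: "integrable (leb 0 1) h"
    and orth: "\<And>k. k \<ge> 1 \<Longrightarrow> lint 0 1 (\<lambda>x. h x * sin (real k * pi * x)) = 0"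
  shows "AE x in leb 0 1. h x = 0"
proof -
  have one: "sine_orth h (\<lambda>_. 1)"
    unfolding sine_orth_def
  proof (intro conjI allI)
    fix k show "lint 0 1 (\<lambda>x. h x * (sin (real k * pi * x) * 1)) = 0"
      using orth[of k] by (cases "k = 0") auto
  qed simp
  have hs: "integrable (leb 0 1) (\<lambda>x. h x * sin (pi * x))"
    by (intro integrable_mult_continuous h continuous_intros)
  define I where "I = lint 0 1 (\<lambda>x. \<bar>h x * sin (pi * x)\<bar>)"
  have I: "I \<ge> 0" unfolding I_def by (rule integral_nonneg_AE) simp
  have zero: "lint 0 1 (\<lambda>x. (h x * sin (pi * x)) * \<theta> x) = 0" if c: "continuous_on {0..1} \<theta>" for \<theta>
  proof -
    \<comment> \<open>This writes \<theta> in the variable y = (1 + cos(pi x))/2, in which it is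
      approximated by Bernstein polynomials.\<close>
    define F where "F = (\<lambda>y. \<theta> (arccos (2 * y - 1) / pi))"
    have "continuous_on {0..1} F"
      unfolding F_def
    proof (rule continuous_on_compose2[OF c])
      show "continuous_on {0..1} (\<lambda>y. arccos (2 * y - 1) / pi)"
        by (intro continuous_intros continuous_on_compose2[OF continuous_on_arccos']) auto
      show "(\<lambda>y. arccos (2 * y - 1) / pi) ` {0..1} \<subseteq> {0..1}"
        using arccos_lbound arccos_ubound by (auto simp: divide_le_eq)
    qed
    have le: "\<bar>lint 0 1 (\<lambda>x. (h x * sin (pi * x)) * \<theta> x)\<bar> \<le> e * I" if e: "e > 0" for e
    proof -
      obtain N where N: "\<forall>n x. N \<le> n \<and> x \<in> {0..1} \<longrightarrow>
          \<bar>F x - (\<Sum>k\<le>n. F (real k / real n) * Bernstein n k x)\<bar> < e"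
        using Bernstein_Weierstrass[OF \<open>continuous_on {0..1} F\<close> e] by blast
      define B where "B x = (\<Sum>k\<le>N. F (real k / real N) * Bernstein N k ((1 + cos (pi * x)) / 2))" for x
      have Bo: "sine_orth h B"
        unfolding B_def[abs_def] by (rule sine_orth_Bernstein[OF h one])
      then have Bc: "continuous_on {0..1} B" by (simp add: sine_orth_def)
      have "lint 0 1 (\<lambda>x. h x * (sin (real 1 * pi * x) * B x)) = 0"
        using Bo unfolding sine_orth_def by blast
      then have B0: "lint 0 1 (\<lambda>x. (h x * sin (pi * x)) * B x) = 0"
        by (simp add: mult.assoc)
      have close: "\<bar>\<theta> x - B x\<bar> \<le> e" if x: "0 < x" "x < 1" for x
      proof -
        have "0 \<le> 1 + cos (pi * x)" using cos_ge_minus_one[of "pi * x"] by linarith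
        then have "(1 + cos (pi * x)) / 2 \<in> {0..1}" by simp
        moreover have "F ((1 + cos (pi * x)) / 2) = \<theta> x"
        proof -
          have "2 * ((1 + cos (pi * x)) / 2) - 1 = cos (pi * x)" by (simp add: field_simps)
          moreover have "arccos (cos (pi * x)) = pi * x" using x by (intro arccos_cos) auto
          ultimately show ?thesis by (simp only: F_def) simp
        qed
        moreover have "\<bar>F y - (\<Sum>k\<le>N. F (real k / real N) * Bernstein N k y)\<bar> < e" if "y \<in> {0..1}" for y
          using N that by blast
        ultimately show ?thesis unfolding B_def by (metis (no_types) less_imp_le)
      qed
      have "lint 0 1 (\<lambda>x. (h x * sin (pi * x)) * \<theta> x)
          = lint 0 1 (\<lambda>x. (h x * sin (pi * x)) * (\<theta> x - B x))"
        using integrable_mult_continuous[OF hs c] integrable_mult_continuous[OF hs Bc] B0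
        by (simp add: right_diff_distrib)
      also have "norm \<dots> \<le> lint 0 1 (\<lambda>x. e * \<bar>h x * sin (pi * x)\<bar>)"
      proof (rule norm_integral_leb_le)
        show "integrable (leb 0 1) (\<lambda>x. e * \<bar>h x * sin (pi * x)\<bar>)" using hs by simp
        show "(\<lambda>x. (h x * sin (pi * x)) * (\<theta> x - B x)) \<in> borel_measurable (leb 0 1)"
          using integrable_mult_continuous[OF hs continuous_on_diff[OF c Bc]] by auto
        fix x :: real assume "0 < x" "x < 1"
        from mult_left_mono[OF close[OF this], of "\<bar>h x * sin (pi * x)\<bar>"]
        show "norm ((h x * sin (pi * x)) * (\<theta> x - B x)) \<le> e * \<bar>h x * sin (pi * x)\<bar>"
          by (simp add: abs_mult mult_ac)
      qed
      finally show ?thesis by (simp add: I_def)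
    qed
    show ?thesis
    proof (rule ccontr)
      assume nz: "\<not> ?thesis"
      let ?J = "\<bar>lint 0 1 (\<lambda>x. (h x * sin (pi * x)) * \<theta> x)\<bar>"
      \<comment> \<open>This tolerance would bound \<open>?J\<close> by less than half of itself;
        the added 1 covers \<open>I = 0\<close>.\<close>
      have "?J \<le> ?J / (2 * (I + 1)) * I" using le[of "?J / (2 * (I + 1))"] nz I by simp
      moreover have "?J / (2 * (I + 1)) * I < ?J"
        using nz I by (simp add: field_simps) (smt (verit) mult_nonneg_nonneg abs_ge_zero)
      ultimately show False by simp
    qed
  qed
  have "AE x in leb 0 1. h x * sin (pi * x) = 0"
  proof (rule fundamental_lemma[OF locally_integrable_integrable[OF hs]])
    fix \<theta> assume "test_function \<theta>"
    then have "continuous_on {0..1} \<theta>" using test_functionE smooth_continuous by metis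
    then show "lint 0 1 (\<lambda>x. h x * sin (pi * x) * \<theta> x) = 0" by (rule zero)
  qed
  moreover have "AE x in leb 0 1. sin (pi * x) \<noteq> 0"
  proof (rule AE_leb_cong)
    fix x :: real assume "0 < x" "x < 1"
    then have "sin (pi * x) > 0" by (intro sin_gt_zero) auto
    then show "sin (pi * x) \<noteq> 0" by simp
  qed
  ultimately show ?thesis by eventually_elim simp
qed

text \<open>The sines are real, so orthogonality passes to the real and imaginary parts.\<close>

lemma sine_complete:
  assumes f: "sqint f" and orth: "\<And>k. k \<ge> 1 \<Longrightarrow> ip f (\<phi> k) = 0"
  shows "AE x in leb 0 1. f x = 0"
proof -
  have fi: "integrable (leb 0 1) f" by (rule L2_imp_integrable[OF f])
  have "ip f (\<phi> k) = complex_of_real (sqrt 2) * lint 0 1 (\<lambda>x. f x * of_real (sin (real k * pi * x)))" for k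
  proof -
    have "(\<lambda>x. f x * \<phi> k x) = (\<lambda>x. of_real (sqrt 2) * (f x * of_real (sin (real k * pi * x))))"
      by (auto simp: \<phi>_def)
    then show ?thesis unfolding ip_def cnj_phi by simp
  qed
  then have z: "lint 0 1 (\<lambda>x. f x * of_real (sin (real k * pi * x))) = 0" if "k \<ge> 1" for k
    using orth[OF that] by simp
  have ic: "integrable (leb 0 1) (\<lambda>x. f x * of_real (sin (real k * pi * x)))" for k
    using integrable_ip[OF f sqint_continuous[of "\<lambda>x. of_real (sin (real k * pi * x))"]]
    by (simp add: continuous_intros)
  have "AE x in leb 0 1. Re (f x) = 0"
  proof (rule sine_complete_real)
    show "integrable (leb 0 1) (\<lambda>x. Re (f x))" using fi by simp
    show "lint 0 1 (\<lambda>x. Re (f x) * sin (real k * pi * x)) = 0" if "k \<ge> 1" for k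
      using integral_Re[OF ic[of k]] z[OF that] by simp
  qed
  moreover have "AE x in leb 0 1. Im (f x) = 0"
  proof (rule sine_complete_real)
    show "integrable (leb 0 1) (\<lambda>x. Im (f x))" using fi by simp
    show "lint 0 1 (\<lambda>x. Im (f x) * sin (real k * pi * x)) = 0" if "k \<ge> 1" for k
      using integral_Im[OF ic[of k]] z[OF that] by simp
  qed
  ultimately show ?thesis by eventually_elim (simp add: complex_eq_iff)
qed

section \<open>Expansion in the sine basis and the unitary group\<close>

lemma AE_eq_if_ip_phi_eq:
  assumes "sqint f" "sqint g" "\<And>k. k \<ge> 1 \<Longrightarrow> ip f (\<phi> k) = ip g (\<phi> k)"
  shows "AE x in leb 0 1. f x = g x"
proof -
  have "AE x in leb 0 1. f x - g x = 0"
    by (rule sine_complete[OF sqint_diff[OF assms(1,2)]])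
      (use assms in \<open>simp add: ip_diff_left sqint_phi\<close>)
  then show ?thesis by simp
qed

text \<open>Riesz-Fischer yields some limit of the series; it has the same coefficients as
  \<open>f\<close>, hence equals \<open>f\<close> by completeness.\<close>

lemma sine_series_self:
  assumes f: "sqint f"
  shows "(\<lambda>n. nrm (\<lambda>x. f x - sine_sum (\<lambda>k. ip f (\<phi> k)) n x)) \<longlonglongrightarrow> 0"
proof -
  let ?c = "\<lambda>k. if k = 0 then 0 else ip f (\<phi> k)"
  have e: "sine_sum ?c n = sine_sum (\<lambda>k. ip f (\<phi> k)) n" for n
    by (rule sine_sum_cong) simp
  obtain g where g: "sqint g" "(\<lambda>n. nrm (\<lambda>x. g x - sine_sum ?c n x)) \<longlonglongrightarrow> 0"
    using sine_series_converges[OF summable_ip_phi[OF f]] .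
  have "AE x in leb 0 1. f x = g x"
    by (rule AE_eq_if_ip_phi_eq[OF f g(1)]) (use ip_limit_phi[OF g] in simp)
  then have "AE x in leb 0 1. f x - sine_sum ?c n x = g x - sine_sum ?c n x" for n by auto
  then have "nrm (\<lambda>x. f x - sine_sum ?c n x) = nrm (\<lambda>x. g x - sine_sum ?c n x)" for n
    by (rule nrm_cong_AE) (intro sqint_diff f g sqint_sine_sum)+
  then show ?thesis using g(2) by (simp add: e)
qed

lemma Parseval:
  assumes f: "sqint f" and h: "sqint h"
  shows "(\<lambda>n. \<Sum>k=1..n. ip f (\<phi> k) * cnj (ip h (\<phi> k))) \<longlonglongrightarrow> ip f h"
proof -
  have e: "(\<Sum>k=1..n. ip f (\<phi> k) * cnj (ip h (\<phi> k))) = ip (sine_sum (\<lambda>k. ip f (\<phi> k)) n) h" for n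
    by (simp add: ip_sine_sum_left[OF h] ip_commute[of _ h, symmetric])
  have "(\<lambda>n. ip f h - ip (sine_sum (\<lambda>k. ip f (\<phi> k)) n) h) \<longlonglongrightarrow> 0"
  proof (rule tendsto_norm_zero_cancel, rule tendsto_sandwich[OF _ _ tendsto_const])
    show "\<forall>\<^sub>F n in sequentially. norm (ip f h - ip (sine_sum (\<lambda>k. ip f (\<phi> k)) n) h)
        \<le> nrm (\<lambda>x. f x - sine_sum (\<lambda>k. ip f (\<phi> k)) n x) * nrm h"
      using cmod_ip_le[OF sqint_diff[OF f sqint_sine_sum] h]
      by (simp add: ip_diff_left[OF f sqint_sine_sum h])
    show "(\<lambda>n. nrm (\<lambda>x. f x - sine_sum (\<lambda>k. ip f (\<phi> k)) n x) * nrm h) \<longlonglongrightarrow> 0"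
      using tendsto_mult[OF sine_series_self[OF f] tendsto_const, of "nrm h"] by simp
  qed auto
  from tendsto_diff[OF tendsto_const this, of "ip f h"] show ?thesis unfolding e by simp
qed

text \<open>The bound is uniform in \<open>n\<close>; it provides the dominating function when
  Parseval is integrated in time.\<close>

lemma Bessel_mixed:
  assumes f: "sqint f" and h: "sqint h"
  shows "cmod (\<Sum>k=1..n. ip f (\<phi> k) * cnj (ip h (\<phi> k))) \<le> nrm f * nrm h"
proof -
  have "(\<Sum>k=1..n. ip f (\<phi> k) * cnj (ip h (\<phi> k))) = ip (sine_sum (\<lambda>k. ip f (\<phi> k)) n) h"
    by (simp add: ip_sine_sum_left[OF h] ip_commute[of _ h, symmetric])
  also have "cmod \<dots> \<le> nrm (sine_sum (\<lambda>k. ip f (\<phi> k)) n) * nrm h"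
    by (rule cmod_ip_le[OF sqint_sine_sum h])
  also have "nrm (sine_sum (\<lambda>k. ip f (\<phi> k)) n) \<le> nrm f"
    by (rule power2_le_imp_le) (use Bessel[OF f] in \<open>simp_all add: nrm_sine_sum nrm_nonneg\<close>)
  finally show ?thesis using nrm_nonneg[of h] by (simp add: mult_right_mono)
qed

text \<open>The phases preserve the moduli of the coefficients, so Riesz-Fischer provides a witness
  for the choice in \<open>group_A\<close>. Later arguments see the group only through these
  coefficients.\<close>

lemma group_A_props:
  assumes f: "sqint f"
  shows "sqint (group_A t f)"
    and "k \<ge> 1 \<Longrightarrow> ip (group_A t f) (\<phi> k) = exp (- \<i> * complex_of_real (eigval k * t)) * ip f (\<phi> k)"
proof -
  define c where "c k = exp (- \<i> * complex_of_real (eigval k * t)) * ip f (\<phi> k)" for k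
  let ?c = "\<lambda>k. if k = 0 then 0 else c k"
  have "cmod (c k) = cmod (ip f (\<phi> k))" for k by (simp add: c_def norm_mult)
  then have "summable (\<lambda>k. (cmod (?c k))\<^sup>2)"
    using summable_ip_phi[OF f] by (simp add: if_distrib cong: if_cong)
  from sine_series_converges[OF this] obtain g where
    "sqint g" "(\<lambda>n. nrm (\<lambda>x. g x - sine_sum ?c n x)) \<longlonglongrightarrow> 0" .
  moreover have "sine_sum ?c n = sine_sum c n" for n by (rule sine_sum_cong) simp
  ultimately have "\<exists>g. sqint g \<and> (\<lambda>n. nrm (\<lambda>x. g x - sine_sum c n x)) \<longlonglongrightarrow> 0" by auto
  then have G: "sqint (group_A t f) \<and> (\<lambda>n. nrm (\<lambda>x. group_A t f x - sine_sum c n x)) \<longlonglongrightarrow> 0"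
    unfolding group_A_def sine_sum_def c_def mult.assoc by (rule someI_ex)
  then show "sqint (group_A t f)" by blast
  show "k \<ge> 1 \<Longrightarrow> ip (group_A t f) (\<phi> k) = exp (- \<i> * complex_of_real (eigval k * t)) * ip f (\<phi> k)"
    using ip_limit_phi[OF conjunct1[OF G] conjunct2[OF G]] by (simp add: c_def)
qed

subsection \<open>Solutions in terms of their sine coefficients\<close>

text \<open>The equation i x' = A x - u M x - f, imposed on each sine coefficient separately, so
  that \<open>A x\<close> need not make sense in L2. The uniform norm bounds are for dominated
  convergence. The comparison function fits in here although it need not take values in
  \<open>H30\<close>.\<close>

definition evolves ::
    "real \<Rightarrow> (real \<Rightarrow> real) \<Rightarrow> (real \<Rightarrow> real) \<Rightarrow> (real \<Rightarrow> real \<Rightarrow> complex) \<Rightarrow> (real \<Rightarrow> real \<Rightarrow> complex) \<Rightarrow> bool"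
  where
  "evolves T M u x f \<longleftrightarrow>
     (\<forall>t\<in>{0..T}. sqint (x t)) \<and> (\<exists>B. \<forall>t\<in>{0..T}. nrm (x t) \<le> B) \<and>
     (\<forall>t\<in>{0..T}. sqint (f t)) \<and> (\<exists>B. \<forall>t\<in>{0..T}. nrm (f t) \<le> B) \<and>
     (\<forall>k\<ge>1. primitive_on T (\<lambda>t. ip (x t) (\<phi> k))
        (\<lambda>t. - \<i> * of_real (eigval k) * ip (x t) (\<phi> k)
           + \<i> * of_real (u t) * ip (\<lambda>y. of_real (M y) * x t y) (\<phi> k) + \<i> * ip (f t) (\<phi> k)))"

lemma sqint_mult_continuous:
  assumes M: "continuous_on {0..1} M" and f: "sqint f" and B: "\<And>y. y \<in> {0..1} \<Longrightarrow> \<bar>M y\<bar> \<le> B"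
  shows "sqint (\<lambda>y. complex_of_real (M y) * f y)" "nrm (\<lambda>y. complex_of_real (M y) * f y) \<le> B * nrm f"
proof -
  have m: "(\<lambda>y. complex_of_real (M y) * f y) \<in> borel_measurable (leb 0 1)"
    using borel_measurable_continuous_leb[OF M] sqint_measurable[OF f] by auto
  have le: "AE y in leb 0 1. cmod (complex_of_real (M y) * f y) \<le> B * cmod (f y)"
    by (rule AE_leb_cong) (use B in \<open>auto simp: norm_mult intro!: mult_right_mono\<close>)
  show "sqint (\<lambda>y. complex_of_real (M y) * f y)" by (rule sqint_bound[OF m f le])
  show "nrm (\<lambda>y. complex_of_real (M y) * f y) \<le> B * nrm f"
    by (rule nrm_le_if_bounded[OF m f le]) (use B[of 0] in auto)
qed

lemma ip_mult_real_left: "ip (\<lambda>y. complex_of_real (M y) * f y) g = ip f (\<lambda>y. complex_of_real (M y) * g y)"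
  unfolding ip_def by (simp add: mult_ac)

text \<open>The terms with \<open>\<lambda>\<^sub>k\<close> cancel in each coefficient, and the terms with \<open>u\<close> cancel in the sum
  because \<open>M\<close> is real.\<close>

lemma evolves_ip:
  assumes x: "evolves T M u x f" and y: "evolves T M u y g"
    and M: "continuous_on {0..1} M" and u: "integrable (leb 0 T) u"
  shows "primitive_on T (\<lambda>t. ip (x t) (y t)) (\<lambda>t. \<i> * (ip (f t) (y t) - ip (x t) (g t)))"
proof -
  obtain BM where BM: "BM \<ge> 0" "\<And>z. z \<in> {0..1} \<Longrightarrow> \<bar>M z\<bar> \<le> BM"
    using continuous_bound_Icc[OF M] by auto
  have sq: "sqint (x t)" "sqint (y t)" "sqint (f t)" "sqint (g t)" if "0 \<le> t" "t \<le> T" for t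
    using x y that unfolding evolves_def by auto
  obtain Bx where Bx: "\<forall>t\<in>{0..T}. nrm (x t) \<le> Bx" using x unfolding evolves_def by blast
  obtain By where By: "\<forall>t\<in>{0..T}. nrm (y t) \<le> By" using y unfolding evolves_def by blast
  obtain Bf where Bf: "\<forall>t\<in>{0..T}. nrm (f t) \<le> Bf" using x unfolding evolves_def by blast
  obtain Bg where Bg: "\<forall>t\<in>{0..T}. nrm (g t) \<le> Bg" using y unfolding evolves_def by blast
  have B: "nrm (x t) \<le> Bx" "nrm (y t) \<le> By" "nrm (f t) \<le> Bf" "nrm (g t) \<le> Bg"
    if "0 \<le> t" "t \<le> T" for t
    using Bx By Bf Bg that by auto
  let ?Mx = "\<lambda>t z. complex_of_real (M z) * x t z"
  let ?My = "\<lambda>t z. complex_of_real (M z) * y t z"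
  have sqM: "sqint (?Mx t)" "sqint (?My t)" "nrm (?Mx t) \<le> BM * nrm (x t)" "nrm (?My t) \<le> BM * nrm (y t)"
    if "0 \<le> t" "t \<le> T" for t
    using sqint_mult_continuous[OF M _ BM(2)] sq[OF that] by auto
  define P where "P a b n = (\<Sum>k=1..n. ip a (\<phi> k) * cnj (ip b (\<phi> k)))" for a b and n :: nat
  \<comment> \<open>The density of the truncated pairing. With the eigenvalues gone it is bounded
    uniformly in \<open>n\<close>; the terms with the control disappear only in the limit.\<close>
  define d where "d n t = \<i> * of_real (u t) * (P (?Mx t) (y t) n - P (x t) (?My t) n)
      + \<i> * (P (f t) (y t) n - P (x t) (g t) n)" for n t
  have prim: "primitive_on T (\<lambda>t. P (x t) (y t) n) (d n)" for n
  proof -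
    have px: "primitive_on T (\<lambda>t. ip (x t) (\<phi> k))
        (\<lambda>t. - \<i> * of_real (eigval k) * ip (x t) (\<phi> k)
           + \<i> * of_real (u t) * ip (?Mx t) (\<phi> k) + \<i> * ip (f t) (\<phi> k))" if "k \<ge> 1" for k
      using x that unfolding evolves_def by blast
    have "primitive_on T (\<lambda>t. ip (y t) (\<phi> k))
        (\<lambda>t. - \<i> * of_real (eigval k) * ip (y t) (\<phi> k)
           + \<i> * of_real (u t) * ip (?My t) (\<phi> k) + \<i> * ip (g t) (\<phi> k))" if "k \<ge> 1" for k
      using y that unfolding evolves_def by blast
    note py = primitive_on_bounded_linear[OF this bounded_linear_cnj]
    show ?thesis
      unfolding P_def
    proof (rule primitive_on_cong[OF primitive_on_sum[OF primitive_on_mult[OF px py]]])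
      fix t :: real
      show "d n t = (\<Sum>k=1..n.
          (- \<i> * of_real (eigval k) * ip (x t) (\<phi> k)
            + \<i> * of_real (u t) * ip (?Mx t) (\<phi> k) + \<i> * ip (f t) (\<phi> k)) * cnj (ip (y t) (\<phi> k))
          + ip (x t) (\<phi> k) * cnj (- \<i> * of_real (eigval k) * ip (y t) (\<phi> k)
            + \<i> * of_real (u t) * ip (?My t) (\<phi> k) + \<i> * ip (g t) (\<phi> k)))"
        unfolding d_def P_def sum_subtractf[symmetric] sum_distrib_left sum.distrib[symmetric]
        by (rule sum.cong) (auto simp: algebra_simps)
    qed auto
  qed
  have dlim: "(\<lambda>n. d n t) \<longlonglongrightarrow> \<i> * (ip (f t) (y t) - ip (x t) (g t))" if t: "0 \<le> t" "t \<le> T" for t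
  proof -
    have "(\<lambda>n. d n t) \<longlonglongrightarrow> \<i> * of_real (u t) * (ip (?Mx t) (y t) - ip (x t) (?My t))
      + \<i> * (ip (f t) (y t) - ip (x t) (g t))"
      unfolding d_def P_def by (intro tendsto_intros Parseval sq[OF t] sqM[OF t])
    then show ?thesis by (simp add: ip_mult_real_left)
  qed

  have Pb: "cmod (P a b n) \<le> A * C" if "sqint a" "sqint b" "nrm a \<le> A" "nrm b \<le> C" for a b n A C
  proof -
    have "cmod (P a b n) \<le> nrm a * nrm b" unfolding P_def by (rule Bessel_mixed[OF that(1,2)])
    also have "\<dots> \<le> A * C" using that nrm_nonneg by (intro mult_mono) (auto intro: order_trans)
    finally show ?thesis .
  qed
  \<comment> \<open>An integrable majorant for all \<open>n\<close>: everything is bounded except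
    the factor |u|.\<close>
  define w where "w t = \<bar>u t\<bar> * (2 * (BM * Bx * By)) + (Bf * By + Bx * Bg)" for t
  have dle: "cmod (d n t) \<le> w t" if t: "0 \<le> t" "t \<le> T" for n t
  proof -
    have m: "nrm (?Mx t) \<le> BM * Bx" "nrm (?My t) \<le> BM * By"
      using sqM(3,4)[OF t] B(1,2)[OF t] BM(1) by (meson mult_left_mono order_trans)+
    have "cmod (d n t) \<le> \<bar>u t\<bar> * cmod (P (?Mx t) (y t) n - P (x t) (?My t) n)
        + cmod (P (f t) (y t) n - P (x t) (g t) n)"
      unfolding d_def by (rule order_trans[OF norm_triangle_ineq]) (simp add: norm_mult)
    also have "\<dots> \<le> \<bar>u t\<bar> * (BM * Bx * By + Bx * (BM * By)) + (Bf * By + Bx * Bg)"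
      by (intro add_mono mult_left_mono order_trans[OF norm_triangle_ineq4] Pb sq[OF t] sqM(1,2)[OF t] B[OF t] m) auto
    finally show ?thesis by (simp add: w_def algebra_simps)
  qed
  have wi: "integrable (leb 0 T) w" unfolding w_def using u by simp
  show ?thesis
  proof (rule primitive_onI)
    have dm: "d n \<in> borel_measurable (leb 0 T)" for n using primitive_onD(1)[OF prim] by auto
    have Dm: "(\<lambda>t. \<i> * (ip (f t) (y t) - ip (x t) (g t))) \<in> borel_measurable (leb 0 T)"
      by (rule borel_measurable_LIMSEQ_metric[where f = d, OF dm]) (use dlim in auto)
    show "integrable (leb 0 T) (\<lambda>t. \<i> * (ip (f t) (y t) - ip (x t) (g t)))"
    proof (rule integrable_dominated_convergence[where s = d and w = w])
      show "AE t in leb 0 T. (\<lambda>n. d n t) \<longlonglongrightarrow> \<i> * (ip (f t) (y t) - ip (x t) (g t))"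
        by (rule AE_leb_cong) (use dlim in auto)
      show "AE t in leb 0 T. norm (d n t) \<le> w t" for n
        by (rule AE_leb_cong) (use dle in auto)
    qed (use Dm dm wi in auto)
    fix t assume t: "0 \<le> t" "t \<le> T"
    have sub: "h \<in> borel_measurable (leb 0 t)" if "h \<in> borel_measurable (leb 0 T)" for h :: "real \<Rightarrow> complex"
    proof -
      have "leb 0 t = restrict_space (leb 0 T) {0<..<t}"
        using t by (subst restrict_restrict_space) (auto intro!: arg_cong[of _ _ "lebesgue_on"])
      then show ?thesis using that by (simp add: measurable_restrict_space1)
    qed
    have "(\<lambda>n. lint 0 t (d n)) \<longlonglongrightarrow> lint 0 t (\<lambda>t. \<i> * (ip (f t) (y t) - ip (x t) (g t)))"
    proof (rule integral_dominated_convergence[where w = w])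
      show "integrable (leb 0 t) w" using wi t by (auto intro: integrable_leb_subset)
      show "AE t in leb 0 t. (\<lambda>n. d n t) \<longlonglongrightarrow> \<i> * (ip (f t) (y t) - ip (x t) (g t))"
        by (rule AE_leb_cong) (use dlim t in auto)
      show "AE t in leb 0 t. norm (d n t) \<le> w t" for n
        by (rule AE_leb_cong) (use dle t in auto)
    qed (use sub[OF Dm] sub[OF dm] in auto)
    moreover have "lint 0 t (d n) = P (x t) (y t) n - P (x 0) (y 0) n" for n :: nat
      using primitive_onD(2)[OF prim t, of n] by (simp add: eq_diff_eq add.commute)
    moreover have "(\<lambda>n. P (x t) (y t) n - P (x 0) (y 0) n) \<longlonglongrightarrow> ip (x t) (y t) - ip (x 0) (y 0)"
      unfolding P_def using t by (intro tendsto_diff Parseval sq) auto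
    ultimately have "lint 0 t (\<lambda>t. \<i> * (ip (f t) (y t) - ip (x t) (g t))) = ip (x t) (y t) - ip (x 0) (y 0)"
      by (simp only:) (rule LIMSEQ_unique)
    then show "ip (x t) (y t) - lint 0 t (\<lambda>t. \<i> * (ip (f t) (y t) - ip (x t) (g t)))
        = ip (x 0) (y 0) - lint 0 0 (\<lambda>t. \<i> * (ip (f t) (y t) - ip (x t) (g t)))"
      by simp
  qed
qed

subsection \<open>Mild solutions\<close>

lemma H30_sqint: "f \<in> H30 \<Longrightarrow> sqint f"
  by (simp add: dom_A_powr_def)

text \<open>The domain \<open>H30\<close> is weighted by powers of \<open>eigval k\<close>, the norm
  \<open>H30norm\<close> by \<open>k ^ 3\<close>; the weights differ by the constant
  \<open>pi ^ 3\<close>.\<close>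

lemma eigval_powr: "k \<ge> 1 \<Longrightarrow> eigval k powr (3/2) = pi ^ 3 * real (k ^ 3)"
proof -
  assume "k \<ge> 1"
  then have p: "real k * pi > 0" by simp
  have "eigval k = (real k * pi) powr 2"
    using p by (simp add: eigval_def)
  then have "eigval k powr (3/2) = ((real k * pi) powr 2) powr (3/2)" by (simp only:)
  also have "\<dots> = (real k * pi) powr 3" by (simp only: powr_powr) simp
  also have "\<dots> = pi ^ 3 * real (k ^ 3)" using p by (simp add: powr_numeral power_mult_distrib)
  finally show ?thesis .
qed

lemma H30_summable:
  assumes "f \<in> H30"
  shows "(\<lambda>k. (cmod (of_nat (k ^ 3) * ip f (\<phi> k)))\<^sup>2) summable_on {1..}"
proof -
  have "(\<lambda>k. (cmod (complex_of_real (eigval k powr (3/2)) * ip f (\<phi> k)))\<^sup>2) summable_on {1..}"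
    using assms by (simp add: dom_A_powr_def)
  then have "(\<lambda>k. inverse (pi ^ 6) * (cmod (complex_of_real (eigval k powr (3/2)) * ip f (\<phi> k)))\<^sup>2) summable_on {1..}"
    by (rule summable_on_cmult_right)
  then show ?thesis
  proof (rule summable_on_cong[THEN iffD1, rotated])
    fix k :: nat assume "k \<in> {1..}"
    then have "cmod (complex_of_real (eigval k powr (3/2)) * ip f (\<phi> k)) = pi ^ 3 * cmod (of_nat (k ^ 3) * ip f (\<phi> k))"
      by (simp add: eigval_powr norm_mult norm_power)
    then show "inverse (pi ^ 6) * (cmod (complex_of_real (eigval k powr (3/2)) * ip f (\<phi> k)))\<^sup>2
        = (cmod (of_nat (k ^ 3) * ip f (\<phi> k)))\<^sup>2"
      by (simp add: power_mult_distrib power_mult[symmetric])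
  qed
qed

lemma nrm_le_H30norm:
  assumes "f \<in> H30" "g \<in> H30"
  shows "nrm (\<lambda>x. f x - g x) \<le> H30norm (\<lambda>x. f x - g x)"
proof -
  note sq = H30_sqint[OF assms(1)] H30_sqint[OF assms(2)]
  define h where "h = (\<lambda>x. f x - g x)"
  have h: "sqint h" unfolding h_def by (rule sqint_diff[OF sq])
  \<comment> \<open>An infinite sum over a family that is not summable has the default value 0, so
    \<open>H30norm\<close> bounds nothing until summability is shown.\<close>
  have s: "(\<lambda>k. (cmod (of_nat (k ^ 3) * ip h (\<phi> k)))\<^sup>2) summable_on {1..}"
  proof (rule summable_on_comparison_test)
    show "(\<lambda>k. 2 * (cmod (of_nat (k ^ 3) * ip f (\<phi> k)))\<^sup>2 + 2 * (cmod (of_nat (k ^ 3) * ip g (\<phi> k)))\<^sup>2) summable_on {1..}"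
      by (intro summable_on_add summable_on_cmult_right H30_summable assms)
    fix k :: nat
    let ?a = "of_nat (k ^ 3) * ip f (\<phi> k)" and ?b = "of_nat (k ^ 3) * ip g (\<phi> k)"
    have "of_nat (k ^ 3) * ip h (\<phi> k) = ?a - ?b"
      unfolding h_def ip_diff_left[OF sq sqint_phi] by (rule right_diff_distrib)
    then have "(cmod (of_nat (k ^ 3) * ip h (\<phi> k)))\<^sup>2 \<le> (cmod ?a + cmod ?b)\<^sup>2"
      by (metis norm_ge_zero norm_triangle_ineq4 power_mono)
    also have "\<dots> \<le> 2 * (cmod ?a)\<^sup>2 + 2 * (cmod ?b)\<^sup>2"
      using sum_squares_bound[of "cmod ?a" "cmod ?b"] unfolding power2_sum by linarith
    finally show "(cmod (of_nat (k ^ 3) * ip h (\<phi> k)))\<^sup>2 \<le> 2 * (cmod ?a)\<^sup>2 + 2 * (cmod ?b)\<^sup>2" .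
  qed simp
  have "(\<lambda>n. \<Sum>k=1..n. ip h (\<phi> k) * cnj (ip h (\<phi> k))) \<longlonglongrightarrow> ip h h" by (rule Parseval[OF h h])
  from tendsto_Re[OF this]
  have lim: "(\<lambda>n. \<Sum>k=1..n. (cmod (ip h (\<phi> k)))\<^sup>2) \<longlonglongrightarrow> (nrm h)\<^sup>2"
    by (simp add: ip_self complex_norm_square[symmetric] del: of_real_power)
  have "(nrm h)\<^sup>2 \<le> (\<Sum>\<^sub>\<infinity>k\<in>{1..}. (cmod (of_nat (k ^ 3) * ip h (\<phi> k)))\<^sup>2)"
  proof (rule LIMSEQ_le_const2[OF lim], intro exI allI impI)
    fix n :: nat
    have "(\<Sum>k=1..n. (cmod (ip h (\<phi> k)))\<^sup>2) \<le> (\<Sum>k=1..n. (cmod (of_nat (k ^ 3) * ip h (\<phi> k)))\<^sup>2)"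
    proof (rule sum_mono)
      fix k assume k: "k \<in> {1..n}"
      then have "1 \<le> real (k ^ 3)" by (simp add: one_le_power)
      then have "cmod (ip h (\<phi> k)) \<le> cmod (of_nat (k ^ 3) * ip h (\<phi> k))"
        unfolding norm_mult norm_of_nat by (simp add: mult_le_cancel_right1)
      then show "(cmod (ip h (\<phi> k)))\<^sup>2 \<le> (cmod (of_nat (k ^ 3) * ip h (\<phi> k)))\<^sup>2"
        by (intro power_mono) auto
    qed
    also have "\<dots> \<le> (\<Sum>\<^sub>\<infinity>k\<in>{1..}. (cmod (of_nat (k ^ 3) * ip h (\<phi> k)))\<^sup>2)"
      by (rule finite_sum_le_infsum[OF s]) auto
    finally show "(\<Sum>k=1..n. (cmod (ip h (\<phi> k)))\<^sup>2) \<le> (\<Sum>\<^sub>\<infinity>k\<in>{1..}. (cmod (of_nat (k ^ 3) * ip h (\<phi> k)))\<^sup>2)" .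
  qed
  then show ?thesis
    unfolding h_def[symmetric] H30norm_def by (rule real_le_rsqrt)
qed

text \<open>Continuity in \<open>H30norm\<close> implies continuity of the L2 norm, which is then
  bounded on the compact time interval.\<close>

lemma mild_solution_bounded:
  assumes "mild_solution T \<mu> u \<psi>\<^sub>0 \<psi>"
  shows "\<exists>B. \<forall>t\<in>{0..T}. nrm (\<psi> t) \<le> B"
proof -
  have H: "\<psi> t \<in> H30" if "t \<in> {0..T}" for t using assms that by (simp add: mild_solution_def)
  have "continuous_on {0..T} (\<lambda>t. nrm (\<psi> t))"
    unfolding continuous_on_def
  proof
    fix t assume t: "t \<in> {0..T}"
    have "((\<lambda>s. H30norm (\<lambda>x. \<psi> s x - \<psi> t x)) \<longlongrightarrow> 0) (at t within {0..T})"
      using assms t by (simp add: mild_solution_def)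
    then have "((\<lambda>s. nrm (\<psi> s) - nrm (\<psi> t)) \<longlongrightarrow> 0) (at t within {0..T})"
    proof (rule Lim_null_comparison[rotated])
      show "\<forall>\<^sub>F s in at t within {0..T}. norm (nrm (\<psi> s) - nrm (\<psi> t)) \<le> H30norm (\<lambda>x. \<psi> s x - \<psi> t x)"
        unfolding eventually_at_filter
      proof (intro always_eventually allI impI)
        fix s assume s: "s \<in> {0..T}"
        show "norm (nrm (\<psi> s) - nrm (\<psi> t)) \<le> H30norm (\<lambda>x. \<psi> s x - \<psi> t x)"
          using order_trans[OF nrm_triangle_diff[OF H30_sqint[OF H[OF s]] H30_sqint[OF H[OF t]]]
              nrm_le_H30norm[OF H[OF s] H[OF t]]] by simp
      qed
    qed
    then show "((\<lambda>t. nrm (\<psi> t)) \<longlongrightarrow> nrm (\<psi> t)) (at t within {0..T})"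
      by (simp add: LIM_zero_iff)
  qed
  from compact_imp_bounded[OF compact_continuous_image[OF this compact_Icc]]
  show ?thesis unfolding bounded_iff real_norm_def by (metis abs_le_D1 imageI)
qed

text \<open>Pairing the Duhamel formula with \<open>\<phi> k\<close> through the duality relation in
  \<open>has_L2_integral\<close> makes it scalar. Here \<open>\<mu>\<close> is also exchanged for
  its continuous representative.\<close>

lemma mild_solution_coefficient:
  assumes mild: "mild_solution T \<mu> u \<psi>\<^sub>0 \<psi>" and \<psi>0: "sqint \<psi>\<^sub>0" and T: "0 \<le> T"
    and \<mu>: "\<mu> \<in> borel_measurable (leb 0 1)" "AE y in leb 0 1. \<mu> y = M y"
    and M: "continuous_on {0..1} M" and k: "k \<ge> 1" and t: "t \<in> {0..T}"
  shows "integrable (leb 0 t) (\<lambda>\<tau>. exp (- \<i> * complex_of_real (eigval k * (t - \<tau>))) *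
      (of_real (u \<tau>) * ip (\<lambda>y. of_real (M y) * \<psi> \<tau> y) (\<phi> k)))"
    and "ip (\<psi> t) (\<phi> k) = exp (- \<i> * complex_of_real (eigval k * t)) * ip \<psi>\<^sub>0 (\<phi> k)
      + \<i> * lint 0 t (\<lambda>\<tau>. exp (- \<i> * complex_of_real (eigval k * (t - \<tau>))) *
          (of_real (u \<tau>) * ip (\<lambda>y. of_real (M y) * \<psi> \<tau> y) (\<phi> k)))"
proof -
  obtain BM where BM: "BM \<ge> 0" "\<And>z. z \<in> {0..1} \<Longrightarrow> \<bar>M z\<bar> \<le> BM"
    using continuous_bound_Icc[OF M] by auto
  have sq: "sqint (\<psi> \<tau>)" if "\<tau> \<in> {0..T}" for \<tau>
    using mild that by (auto simp: mild_solution_def intro: H30_sqint)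
  let ?F = "\<lambda>\<tau> x. complex_of_real (u \<tau>) * complex_of_real (\<mu> x) * \<psi> \<tau> x"
  let ?G = "\<lambda>\<tau>. exp (- \<i> * complex_of_real (eigval k * (t - \<tau>))) *
      (of_real (u \<tau>) * ip (\<lambda>y. of_real (M y) * \<psi> \<tau> y) (\<phi> k))"
  obtain I where I: "has_L2_integral 0 t (\<lambda>\<tau>. group_A (t - \<tau>) (?F \<tau>)) I"
      "eq_ae (\<psi> t) (\<lambda>x. group_A t \<psi>\<^sub>0 x + \<i> * I x)"
    using mild t unfolding mild_solution_def by blast
  have eq: "ip (group_A (t - \<tau>) (?F \<tau>)) (\<phi> k) = ?G \<tau>" if \<tau>: "0 < \<tau>" "\<tau> < t" for \<tau>
  proof -
    have s: "sqint (\<psi> \<tau>)" using sq \<tau> t by simp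
    note sM = sqint_mult_continuous(1)[OF M s BM(2)]
    have ae: "AE y in leb 0 1. ?F \<tau> y = of_real (u \<tau>) * (of_real (M y) * \<psi> \<tau> y)"
      using \<mu>(2) by eventually_elim (simp add: mult.assoc)
    have sF: "sqint (?F \<tau>)"
    proof (rule sqint_bound[OF _ sM])
      show "?F \<tau> \<in> borel_measurable (leb 0 1)" using \<mu>(1) sqint_measurable[OF s] by auto
      show "AE y in leb 0 1. cmod (?F \<tau> y) \<le> \<bar>u \<tau>\<bar> * cmod (of_real (M y) * \<psi> \<tau> y)"
        using ae by eventually_elim (simp only: norm_mult norm_of_real order_refl)
    qed
    have "ip (?F \<tau>) (\<phi> k) = ip (\<lambda>y. of_real (u \<tau>) * (of_real (M y) * \<psi> \<tau> y)) (\<phi> k)"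
      by (rule ip_cong_AE[OF ae _ sF sqint_phi sqint_cmult[OF sM] sqint_phi]) simp
    then show ?thesis
      using group_A_props(2)[OF sF k, of "t - \<tau>"] by (simp add: ip_cmult_left)
  qed
  have Ii: "sqint I" "integrable (leb 0 t) (\<lambda>\<tau>. ip (group_A (t - \<tau>) (?F \<tau>)) (\<phi> k))"
    "ip I (\<phi> k) = lint 0 t (\<lambda>\<tau>. ip (group_A (t - \<tau>) (?F \<tau>)) (\<phi> k))"
    using I(1) sqint_phi by (auto simp: has_L2_integral_def)
  show "integrable (leb 0 t) ?G"
    using Ii(2) by (subst Bochner_Integration.integrable_cong[OF refl, of _ _ "\<lambda>\<tau>. ip (group_A (t - \<tau>) (?F \<tau>)) (\<phi> k)"])
      (use eq in auto)
  have "ip I (\<phi> k) = lint 0 t ?G"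
    unfolding Ii(3) by (rule Bochner_Integration.integral_cong) (use eq in auto)
  moreover have "ip (\<psi> t) (\<phi> k) = ip (\<lambda>x. group_A t \<psi>\<^sub>0 x + \<i> * I x) (\<phi> k)"
    by (rule ip_cong_AE)
      (use I(2) sq[OF t] sqint_phi group_A_props(1)[OF \<psi>0] Ii(1) in \<open>auto simp: eq_ae_def intro: sqint_add sqint_cmult\<close>)
  ultimately show "ip (\<psi> t) (\<phi> k) = exp (- \<i> * complex_of_real (eigval k * t)) * ip \<psi>\<^sub>0 (\<phi> k)
      + \<i> * lint 0 t ?G"
    using group_A_props[OF \<psi>0] k Ii(1)
    by (simp add: ip_add_left sqint_cmult sqint_phi ip_cmult_left)
qed

lemma exp_phase_has_derivative:
  "((\<lambda>t. exp (- \<i> * complex_of_real (l * t))) has_vector_derivative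
     - \<i> * of_real l * exp (- \<i> * complex_of_real (l * t))) (at t)"
proof -
  have "((\<lambda>z. exp (- \<i> * of_real l * z)) has_field_derivative
      - \<i> * of_real l * exp (- \<i> * of_real l * of_real t)) (at (of_real t :: complex))"
    by (auto intro!: derivative_eq_intros)
  from has_vector_derivative_real_field[OF this] show ?thesis by (simp add: mult.assoc)
qed

lemma primitive_on_exp_phase:
  "primitive_on T (\<lambda>t. exp (- \<i> * complex_of_real (l * t)))
     (\<lambda>t. - \<i> * of_real l * exp (- \<i> * complex_of_real (l * t)))"
  by (rule primitive_on_FTC[OF exp_phase_has_derivative]) (intro continuous_intros)

text \<open>Variation of constants read backwards: each coefficient is the phase times a primitive,
  so the product rule returns the differential equation.\<close>

lemma mild_solution_evolves:
  assumes mild: "mild_solution T \<mu> u \<psi>\<^sub>0 \<psi>" and \<psi>0: "sqint \<psi>\<^sub>0" and T: "0 \<le> T"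
    and \<mu>: "\<mu> \<in> borel_measurable (leb 0 1)" "AE y in leb 0 1. \<mu> y = M y"
    and M: "continuous_on {0..1} M"
  shows "evolves T M u \<psi> (\<lambda>t y. 0)" "AE y in leb 0 1. \<psi> 0 y = \<psi>\<^sub>0 y"
proof -
  have sq: "sqint (\<psi> \<tau>)" if "\<tau> \<in> {0..T}" for \<tau>
    using mild that by (auto simp: mild_solution_def intro: H30_sqint)
  note coef = mild_solution_coefficient[OF mild \<psi>0 T \<mu> M]
  show "AE y in leb 0 1. \<psi> 0 y = \<psi>\<^sub>0 y"
    by (rule AE_eq_if_ip_phi_eq) (use sq[of 0] \<psi>0 T coef(2)[of _ 0] in auto)
  have "primitive_on T (\<lambda>t. ip (\<psi> t) (\<phi> k))
        (\<lambda>t. - \<i> * of_real (eigval k) * ip (\<psi> t) (\<phi> k)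
           + \<i> * of_real (u t) * ip (\<lambda>y. of_real (M y) * \<psi> t y) (\<phi> k) + \<i> * ip (\<lambda>y. 0) (\<phi> k))" if k: "k \<ge> 1" for k
  proof -
    define m where "m t = of_real (u t) * ip (\<lambda>y. of_real (M y) * \<psi> t y) (\<phi> k)" for t
    let ?e = "\<lambda>t. exp (- \<i> * complex_of_real (eigval k * t))"
    let ?E = "\<lambda>t. exp (\<i> * complex_of_real (eigval k * t))"
    have eE: "?e (t - \<tau>) = ?e t * ?E \<tau>" for t \<tau>
      by (simp add: exp_add[symmetric] algebra_simps)
    have e1: "?e t * ?E t = 1" for t by (simp add: exp_add[symmetric])
    \<comment> \<open>Duhamel at the final time gives integrability with the phase of
      \<open>T - \<tau>\<close>; the constant factor at \<open>T\<close> removes \<open>T\<close>,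
      and one density serves all \<open>t\<close>.\<close>
    have "integrable (leb 0 T) (\<lambda>\<tau>. ?E T * (?e (T - \<tau>) * m \<tau>))"
      using coef(1)[OF k, of T] T by (simp add: m_def)
    moreover have "(\<lambda>\<tau>. ?E T * (?e (T - \<tau>) * m \<tau>)) = (\<lambda>\<tau>. ?E \<tau> * m \<tau>)"
    proof
      fix \<tau>
      have "?E T * (?e (T - \<tau>) * m \<tau>) = (?e T * ?E T) * (?E \<tau> * m \<tau>)"
        unfolding eE by (simp only: mult_ac)
      then show "?E T * (?e (T - \<tau>) * m \<tau>) = ?E \<tau> * m \<tau>" by (simp only: e1 mult_1)
    qed
    ultimately have mi: "integrable (leb 0 T) (\<lambda>\<tau>. ?E \<tau> * m \<tau>)" by (simp only:)
    have b: "primitive_on T (\<lambda>t. ip \<psi>\<^sub>0 (\<phi> k) + lint 0 t (\<lambda>\<tau>. \<i> * (?E \<tau> * m \<tau>))) (\<lambda>\<tau>. \<i> * (?E \<tau> * m \<tau>))"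
      by (rule primitive_on_integral) (use mi in simp)
    have val: "ip (\<psi> t) (\<phi> k) = ?e t * (ip \<psi>\<^sub>0 (\<phi> k) + lint 0 t (\<lambda>\<tau>. \<i> * (?E \<tau> * m \<tau>)))"
      if t: "0 \<le> t" "t \<le> T" for t
    proof -
      have "ip (\<psi> t) (\<phi> k) = ?e t * ip \<psi>\<^sub>0 (\<phi> k) + \<i> * lint 0 t (\<lambda>\<tau>. ?e t * (?E \<tau> * m \<tau>))"
        using coef(2)[OF k, of t] t unfolding eE by (simp add: m_def mult.assoc)
      also have "lint 0 t (\<lambda>\<tau>. ?e t * (?E \<tau> * m \<tau>)) = ?e t * lint 0 t (\<lambda>\<tau>. ?E \<tau> * m \<tau>)"
        by (rule integral_mult_right_zero)
      also have "?e t * ip \<psi>\<^sub>0 (\<phi> k) + \<i> * (?e t * lint 0 t (\<lambda>\<tau>. ?E \<tau> * m \<tau>))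
          = ?e t * (ip \<psi>\<^sub>0 (\<phi> k) + \<i> * lint 0 t (\<lambda>\<tau>. ?E \<tau> * m \<tau>))"
        by (simp add: algebra_simps)
      also have "\<i> * lint 0 t (\<lambda>\<tau>. ?E \<tau> * m \<tau>) = lint 0 t (\<lambda>\<tau>. \<i> * (?E \<tau> * m \<tau>))"
        by (rule integral_mult_right_zero[symmetric])
      finally show ?thesis .
    qed
    show ?thesis
    proof (rule primitive_on_cong[OF primitive_on_mult[OF primitive_on_exp_phase[of T "eigval k"] b]])
      fix t assume t: "0 < t" "t < T"
      have "?e t * (\<i> * (?E t * m t)) = (?e t * ?E t) * (\<i> * m t)" by (simp only: mult_ac)
      also have "\<dots> = \<i> * m t" by (simp only: e1 mult_1)
      finally have "?e t * (\<i> * (?E t * m t)) = \<i> * m t" .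
      then show "- \<i> * of_real (eigval k) * ip (\<psi> t) (\<phi> k)
           + \<i> * of_real (u t) * ip (\<lambda>y. of_real (M y) * \<psi> t y) (\<phi> k) + \<i> * ip (\<lambda>y. 0) (\<phi> k)
        = - \<i> * of_real (eigval k) * ?e t * (ip \<psi>\<^sub>0 (\<phi> k) + lint 0 t (\<lambda>\<tau>. \<i> * (?E \<tau> * m \<tau>)))
          + ?e t * (\<i> * (?E t * m t))"
        using val[of t] t by (simp add: ip_zero_left m_def mult.assoc)
    qed (use val in auto)
  qed
  then show "evolves T M u \<psi> (\<lambda>t y. 0)"
    using mild_solution_bounded[OF mild] sq sqint_0
    by (auto simp: evolves_def L2norm_def intro: exI[of _ 0])
qed

subsection \<open>The gauge-transformed eigenstates\<close>

lemma norm_exp_i_minus_1: "cmod (exp (\<i> * of_real x) - 1) \<le> \<bar>x\<bar>"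
  using abs_sin_x_le_abs_x[of "x / 2"] unfolding dist_exp_i_1 by simp

lemma norm_exp_i_taylor: "cmod (exp (\<i> * of_real x) - 1 - \<i> * of_real x) \<le> x\<^sup>2"
proof -
  have re: "\<bar>cos x - 1\<bar> \<le> x\<^sup>2 / 2"
  proof -
    have "cos x = 1 - 2 * (sin (x / 2))\<^sup>2" using cos_double_sin[of "x / 2"] by simp
    moreover have "(sin (x / 2))\<^sup>2 \<le> (x / 2)\<^sup>2" using abs_sin_x_le_abs_x[of "x / 2"] by (simp only: abs_le_square_iff)
    ultimately show ?thesis by (simp add: power_divide)
  qed
  have im: "\<bar>sin x - x\<bar> \<le> x\<^sup>2 / 2"
    using Maclaurin_sin_bound[of x 2] by (simp add: numeral_2_eq_2 sin_coeff_def)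
  have "exp (\<i> * of_real x) - 1 - \<i> * of_real x = Complex (cos x - 1) (sin x - x)"
    by (simp add: exp_Euler complex_eq_iff cos_of_real sin_of_real)
  then have "cmod (exp (\<i> * of_real x) - 1 - \<i> * of_real x) \<le> \<bar>cos x - 1\<bar> + \<bar>sin x - x\<bar>"
    using cmod_le[of "Complex (cos x - 1) (sin x - x)"] by simp
  then show ?thesis using re im by simp
qed

lemma nrm_le_sup:
  assumes "f \<in> borel_measurable (leb 0 1)" "\<And>y. 0 < y \<Longrightarrow> y < 1 \<Longrightarrow> cmod (f y) \<le> C" "C \<ge> 0"
  shows "nrm f \<le> C"
proof -
  have "nrm (\<lambda>_. 1) = 1" using integral_leb_const[of 0 1 1] by (simp add: L2norm_def)
  moreover have "nrm f \<le> C * nrm (\<lambda>_. 1)"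
    by (rule nrm_le_if_bounded) (use assms sqint_continuous[of "\<lambda>_. 1"] in \<open>auto intro!: AE_leb_cong\<close>)
  ultimately show ?thesis by simp
qed

definition dphi :: "nat \<Rightarrow> real \<Rightarrow> complex" where
  "dphi k x = complex_of_real (sqrt 2 * (cos (real k * pi * x) * (real k * pi)))"

lemma phi_has_derivative: "(\<phi> k has_vector_derivative dphi k x) (at x)"
proof -
  have "((\<lambda>x. sqrt 2 * sin (real k * pi * x)) has_real_derivative
      sqrt 2 * (cos (real k * pi * x) * (real k * pi))) (at x)"
    by (auto intro!: derivative_eq_intros)
  from has_vector_derivative_of_real[OF this] show ?thesis
    unfolding \<phi>_def[abs_def] dphi_def by simp
qed

lemma dphi_has_derivative: "(dphi k has_vector_derivative - (complex_of_real (eigval k) * \<phi> k x)) (at x)"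
proof -
  have "((\<lambda>x. sqrt 2 * (cos (real k * pi * x) * (real k * pi))) has_real_derivative
      - (eigval k * (sqrt 2 * sin (real k * pi * x)))) (at x)"
    unfolding eigval_def by (auto intro!: derivative_eq_intros simp: power2_eq_square)
  from has_vector_derivative_of_real[OF this] show ?thesis
    unfolding \<phi>_def dphi_def[abs_def] by simp
qed

lemma continuous_on_dphi: "continuous_on A (dphi k)"
  unfolding dphi_def[abs_def] by (intro continuous_intros)

lemma cnj_dphi [simp]: "cnj (dphi k x) = dphi k x"
  by (simp add: dphi_def)

text \<open>Second derivatives are required because \<open>M''\<close> occurs in the source that
  remains after the gauge transformation; this is where third order Sobolev regularity of
  \<open>\<mu>\<close> enters.\<close>

locale C2_potential =
  fixes M M' M'' :: "real \<Rightarrow> real"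
  assumes M: "\<And>x. (M has_real_derivative M' x) (at x)"
    and M': "\<And>x. (M' has_real_derivative M'' x) (at x)"
    and M''_cont: "continuous_on UNIV M''"
begin

lemma M_cont: "continuous_on A M"
  using M by (meson DERIV_isCont continuous_at_imp_continuous_on)

lemma M'_cont: "continuous_on A M'"
  using M' by (meson DERIV_isCont continuous_at_imp_continuous_on)

lemmas M_continuous = M_cont M'_cont continuous_on_subset[OF M''_cont subset_UNIV]

text \<open>The primitive of the control is frozen as a parameter \<open>s\<close>. Time enters
  later only through \<open>s t\<close> and a phase, which separates space from time
  differentiation.\<close>

definition E :: "nat \<Rightarrow> real \<Rightarrow> real \<Rightarrow> complex" where
  "E j s y = exp (\<i> * of_real (s * M y)) * \<phi> j y"

definition dE :: "nat \<Rightarrow> real \<Rightarrow> real \<Rightarrow> complex" where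
  "dE j s y = exp (\<i> * of_real (s * M y)) * (\<i> * of_real (s * M' y) * \<phi> j y + dphi j y)"

text \<open>The function \<open>E j s\<close> satisfies \<open>E'' + \<lambda>\<^sub>j E = r\<close>.\<close>

definition r :: "nat \<Rightarrow> real \<Rightarrow> real \<Rightarrow> complex" where
  "r j s y = exp (\<i> * of_real (s * M y)) * (2 * \<i> * of_real (s * M' y) * dphi j y
      + \<i> * of_real (s * M'' y) * \<phi> j y - of_real (s\<^sup>2 * (M' y)\<^sup>2) * \<phi> j y)"

lemma gauge_has_derivative:
  "((\<lambda>y. exp (\<i> * complex_of_real (s * M y))) has_vector_derivative
     exp (\<i> * of_real (s * M y)) * (\<i> * of_real (s * M' y))) (at y)"
proof -
  have "((\<lambda>y. s * M y) has_real_derivative s * M' y) (at y)"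
    using M[of y] by (auto intro!: derivative_eq_intros)
  from has_vector_derivative_of_real[OF this]
  have 1: "((\<lambda>y. \<i> * complex_of_real (s * M y)) has_vector_derivative \<i> * of_real (s * M' y)) (at y)"
    by (rule has_vector_derivative_mult_right)
  have "(exp has_field_derivative exp (\<i> * complex_of_real (s * M y))) (at (\<i> * complex_of_real (s * M y)))"
    by (rule DERIV_exp)
  from field_vector_diff_chain_at[OF 1 this] show ?thesis by (simp add: o_def mult.commute)
qed

lemma E_has_derivative: "(E j s has_vector_derivative dE j s y) (at y)"
  unfolding E_def[abs_def] dE_def
  using has_vector_derivative_mult[OF gauge_has_derivative[of s y] phi_has_derivative[of j y]]
  by (simp add: algebra_simps)

lemma dE_has_derivative:
  "(dE j s has_vector_derivative r j s y - of_real (eigval j) * E j s y) (at y)"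
proof -
  have "((\<lambda>y. s * M' y) has_real_derivative s * M'' y) (at y)"
    using M'[of y] by (auto intro!: derivative_eq_intros)
  from has_vector_derivative_of_real[OF this]
  have "((\<lambda>y. \<i> * complex_of_real (s * M' y)) has_vector_derivative \<i> * of_real (s * M'' y)) (at y)"
    by (rule has_vector_derivative_mult_right)
  from has_vector_derivative_mult[OF gauge_has_derivative[of s y]
      has_vector_derivative_add[OF has_vector_derivative_mult[OF this phi_has_derivative[of j y]]
        dphi_has_derivative[of j y]]]
  show ?thesis
    unfolding dE_def[abs_def] r_def E_def
    by (rule has_vector_derivative_eq_rhs) (simp add: algebra_simps power2_eq_square)
qed

lemma E_cont: "continuous_on A (E j s)"
  unfolding E_def[abs_def] by (intro continuous_intros M_continuous continuous_on_phi)

lemma r_cont: "continuous_on A (r j s)"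
  unfolding r_def[abs_def]
  by (intro continuous_intros M_continuous continuous_on_phi continuous_on_dphi)

lemmas sqint_E = sqint_continuous[OF E_cont] and sqint_r = sqint_continuous[OF r_cont]

text \<open>Green's identity: the Wronskian of \<open>E j s\<close> and \<open>\<phi> k\<close> is
  zero at both endpoints because both functions are. It replaces the second space derivative by
  coefficients.\<close>

lemma ip_r_phi: "ip (r j s) (\<phi> k) = of_real (eigval j - eigval k) * ip (E j s) (\<phi> k)"
proof -
  let ?D = "\<lambda>y. r j s y * \<phi> k y - of_real (eigval j - eigval k) * (E j s y * \<phi> k y)"
  have "primitive_on 1 (\<lambda>y. dE j s y * \<phi> k y - E j s y * dphi k y) ?D"
  proof (rule primitive_on_FTC)
    fix y
    from has_vector_derivative_diff[OF has_vector_derivative_mult[OF dE_has_derivative[of j s y] phi_has_derivative[of k y]]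
        has_vector_derivative_mult[OF E_has_derivative[of j s y] dphi_has_derivative[of k y]]]
    show "((\<lambda>y. dE j s y * \<phi> k y - E j s y * dphi k y) has_vector_derivative ?D y) (at y)"
      by (rule has_vector_derivative_eq_rhs) (simp add: algebra_simps)
  qed (intro continuous_intros r_cont E_cont continuous_on_phi)
  from primitive_onD(2)[OF this, of 1]
  have "lint 0 1 ?D = 0"
    by (simp add: phi_boundary E_def)
  moreover have "integrable (leb 0 1) (\<lambda>y. r j s y * \<phi> k y)" "integrable (leb 0 1) (\<lambda>y. E j s y * \<phi> k y)"
    using integrable_ip[OF sqint_r sqint_phi] integrable_ip[OF sqint_E sqint_phi] by simp_all
  ultimately show ?thesis by (simp add: ip_def)
qed

text \<open>The exponentials cancel, and the terms linear in \<open>s\<close> form the derivative of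
  \<open>M'\<close> times the square of \<open>\<phi> j\<close>, whose integral is zero. Only the
  quadratic term is left, and it is real.\<close>

lemma ip_E_r: "ip (E j s) (r j s) = - of_real (s\<^sup>2 * diag (\<lambda>x. (M' x)\<^sup>2) j)"
proof -
  let ?q = "\<lambda>y. of_real (M' y) * (\<phi> j y * \<phi> j y)"
  let ?dq = "\<lambda>y. of_real (M'' y) * (\<phi> j y * \<phi> j y) + of_real (M' y) * (2 * dphi j y * \<phi> j y)"
  let ?m = "\<lambda>y. complex_of_real ((M' y)\<^sup>2) * \<phi> j y * cnj (\<phi> j y)"
  have "primitive_on 1 ?q ?dq"
  proof (rule primitive_on_FTC)
    fix y
    from has_vector_derivative_mult[OF has_vector_derivative_of_real[OF M'[of y]]
        has_vector_derivative_mult[OF phi_has_derivative[of j y] phi_has_derivative[of j y]]]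
    show "(?q has_vector_derivative ?dq y) (at y)"
      by (rule has_vector_derivative_eq_rhs) (simp add: algebra_simps)
  qed (intro continuous_intros M_continuous continuous_on_phi continuous_on_dphi)
  note dq = primitive_onD[OF this]
  have dq0: "lint 0 1 ?dq = 0" using dq(2)[of 1] by (simp add: phi_boundary)
  have mi: "integrable (leb 0 1) ?m"
    by (intro integrable_continuous_leb continuous_intros M_continuous continuous_on_phi)
  have pt: "E j s y * cnj (r j s y) = (- \<i> * of_real s) * ?dq y - of_real (s\<^sup>2) * ?m y" for y
  proof -
    have e: "exp (\<i> * complex_of_real (s * M y)) * cnj (exp (\<i> * complex_of_real (s * M y))) = 1"
      by (simp add: exp_cnj exp_add[symmetric])
    have "E j s y * cnj (r j s y) = (exp (\<i> * complex_of_real (s * M y)) * cnj (exp (\<i> * complex_of_real (s * M y))))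
        * (\<phi> j y * cnj (2 * \<i> * of_real (s * M' y) * dphi j y
      + \<i> * of_real (s * M'' y) * \<phi> j y - of_real (s\<^sup>2 * (M' y)\<^sup>2) * \<phi> j y))"
      unfolding E_def r_def complex_cnj_mult[of "exp _"] by (simp only: mult_ac)
    also have "\<dots> = (- \<i> * of_real s) * ?dq y - of_real (s\<^sup>2) * ?m y"
      unfolding e by (simp add: algebra_simps)
    finally show ?thesis .
  qed
  have "ip (E j s) (r j s) = (- \<i> * of_real s) * lint 0 1 ?dq - of_real (s\<^sup>2) * lint 0 1 ?m"
    unfolding ip_def pt using dq(1) mi by (simp only: Bochner_Integration.integral_diff
        integrable_mult_right integral_mult_right_zero)
  also have "lint 0 1 ?m = of_real (diag (\<lambda>x. (M' x)\<^sup>2) j)"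
    unfolding of_real_diag ip_def ..
  finally show ?thesis using dq0 by simp
qed

lemma cmod_E: "cmod (E j s y) = cmod (\<phi> j y)"
  by (simp add: E_def norm_mult)

lemma nrm_E: "j \<ge> 1 \<Longrightarrow> nrm (E j s) = 1"
  using nrm_phi[of j] by (simp add: L2norm_def cmod_E)

lemma nrm_r_le:
  obtains C where "C > 0" "\<And>s. \<bar>s\<bar> \<le> 1 \<Longrightarrow> nrm (r j s) \<le> C * \<bar>s\<bar>"
proof -
  obtain B1 where B1: "B1 \<ge> 0" "\<And>y. y \<in> {0..1} \<Longrightarrow> \<bar>M' y\<bar> \<le> B1"
    using continuous_bound_Icc[OF M'_cont] by auto
  obtain B2 where B2: "B2 \<ge> 0" "\<And>y. y \<in> {0..1} \<Longrightarrow> \<bar>M'' y\<bar> \<le> B2"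
    using continuous_bound_Icc[OF M_continuous(3)] by auto
  obtain P where P: "P \<ge> 0" "\<And>y. y \<in> {0..1} \<Longrightarrow> cmod (\<phi> j y) \<le> P"
    using continuous_bound_Icc[OF continuous_on_phi] by blast
  obtain Q where Q: "Q \<ge> 0" "\<And>y. y \<in> {0..1} \<Longrightarrow> cmod (dphi j y) \<le> Q"
    using continuous_bound_Icc[OF continuous_on_dphi] by blast
  define C where "C = 2 * B1 * Q + B2 * P + B1\<^sup>2 * P"
  have C: "C \<ge> 0" using B1 B2 P Q by (simp add: C_def)
  have "nrm (r j s) \<le> (C + 1) * \<bar>s\<bar>" if s: "\<bar>s\<bar> \<le> 1" for s
  proof (rule nrm_le_sup)
    show "r j s \<in> borel_measurable (leb 0 1)" by (rule sqint_measurable[OF sqint_r])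
    fix y :: real assume "0 < y" "y < 1"
    then have y: "y \<in> {0..1}" by simp
    \<comment> \<open>This is what \<open>\<bar>s\<bar> \<le> 1\<close> is for: the quadratic part
      of \<open>r\<close> is also linear in |s| at worst.\<close>
    have s2: "s\<^sup>2 \<le> \<bar>s\<bar>" using s mult_left_le[of "\<bar>s\<bar>" "\<bar>s\<bar>"] by (simp add: power2_eq_square)
    have m2: "(M' y)\<^sup>2 \<le> B1\<^sup>2" using B1(2)[OF y] by (metis abs_ge_zero power2_abs power_mono)
    have "cmod (r j s y) = cmod (2 * \<i> * of_real (s * M' y) * dphi j y
        + \<i> * of_real (s * M'' y) * \<phi> j y - of_real (s\<^sup>2 * (M' y)\<^sup>2) * \<phi> j y)"
      unfolding r_def norm_mult[of "exp _"] by simp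
    also have "\<dots> \<le> cmod (2 * \<i> * of_real (s * M' y) * dphi j y) + cmod (\<i> * of_real (s * M'' y) * \<phi> j y)
        + cmod (of_real (s\<^sup>2 * (M' y)\<^sup>2) * \<phi> j y)"
      by (rule order_trans[OF norm_triangle_ineq4 add_right_mono[OF norm_triangle_ineq]])
    also have "\<dots> = \<bar>s\<bar> * (2 * \<bar>M' y\<bar> * cmod (dphi j y)) + \<bar>s\<bar> * (\<bar>M'' y\<bar> * cmod (\<phi> j y)) + s\<^sup>2 * ((M' y)\<^sup>2 * cmod (\<phi> j y))"
      by (simp add: norm_mult abs_mult norm_power)
    also have "\<dots> \<le> \<bar>s\<bar> * (2 * B1 * Q) + \<bar>s\<bar> * (B2 * P) + \<bar>s\<bar> * (B1\<^sup>2 * P)"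
      using B1 B2 P Q B1(2)[OF y] B2(2)[OF y] P(2)[OF y] Q(2)[OF y] s2 m2
      by (intro add_mono mult_mono) auto
    also have "\<dots> \<le> (C + 1) * \<bar>s\<bar>" by (simp add: C_def algebra_simps)
    finally show "cmod (r j s y) \<le> (C + 1) * \<bar>s\<bar>" .
  qed (use C in simp)
  then show thesis using that[of "C + 1"] C by simp
qed

text \<open>Taylor expansion of the exponential in the parameter, uniform in \<open>y\<close>, gives
  the hypotheses of \<open>primitive_on_chain\<close> for every coefficient.\<close>

lemma E_coefficient_chain:
  assumes s: "primitive_on T s u" and k: "k \<ge> 1"
  shows "primitive_on T (\<lambda>t. ip (E j (s t)) (\<phi> k))
    (\<lambda>t. of_real (u t) * (\<i> * ip (\<lambda>y. of_real (M y) * E j (s t) y) (\<phi> k)))"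
proof -
  obtain B where B: "B \<ge> 0" "\<And>y. y \<in> {0..1} \<Longrightarrow> \<bar>M y\<bar> \<le> B"
    using continuous_bound_Icc[OF M_cont] by auto
  obtain P where P: "P \<ge> 0" "\<And>y. y \<in> {0..1} \<Longrightarrow> cmod (\<phi> j y) \<le> P"
    using continuous_bound_Icc[OF continuous_on_phi] by blast
  \<comment> \<open>One constant for both bounds: the Taylor remainder contributes the square of
    \<open>B\<close>, while for \<open>G'\<close> one \<open>B\<close> comes from the factor
    \<open>M\<close> and one from the exponent.\<close>
  define C where "C = B\<^sup>2 * P"
  define ME where "ME = (\<lambda>x y. \<i> * of_real (M y) * E j x y)"
  have MEc: "continuous_on {0..1} (ME x)" for x
    unfolding ME_def by (intro continuous_intros M_cont E_cont)
  note sME = sqint_continuous[OF MEc]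
  have ipb: "cmod (ip f (\<phi> k)) \<le> C * c" if "continuous_on {0..1} f" "c \<ge> 0"
    "\<And>y. y \<in> {0..1} \<Longrightarrow> cmod (f y) \<le> C * c" for f c
  proof -
    have "cmod (ip f (\<phi> k)) \<le> nrm f * nrm (\<phi> k)"
      by (intro cmod_ip_le sqint_continuous sqint_phi that(1))
    also have "\<dots> \<le> C * c"
      using nrm_le_sup[of f "C * c"] borel_measurable_continuous_leb[OF that(1)] that(2,3) P B k
      by (simp add: nrm_phi C_def)
    finally show ?thesis .
  qed
  have shift: "E j x' y = E j x y * exp (\<i> * of_real ((x' - x) * M y))" for x x' y
  proof -
    have "\<i> * complex_of_real (x' * M y) = \<i> * complex_of_real (x * M y) + \<i> * complex_of_real ((x' - x) * M y)"
      by (simp add: algebra_simps)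
    then show ?thesis unfolding E_def by (simp only: exp_add mult_ac)
  qed
  have "primitive_on T (\<lambda>t. ip (E j (s t)) (\<phi> k)) (\<lambda>t. of_real (u t) * ip (ME (s t)) (\<phi> k))"
  proof (rule primitive_on_chain[OF s])
    fix x x' :: real
    let ?f = "\<lambda>y. E j x' y - E j x y - of_real (x' - x) * ME x y"
    have "ip (E j x') (\<phi> k) - ip (E j x) (\<phi> k) - of_real (x' - x) * ip (ME x) (\<phi> k) = ip ?f (\<phi> k)"
      by (simp only: ip_diff_left sqint_diff sqint_E sqint_cmult sME sqint_phi ip_cmult_left)
    moreover have "cmod (ip ?f (\<phi> k)) \<le> C * (x' - x)\<^sup>2"
    proof (rule ipb)
      show "continuous_on {0..1} ?f" by (intro continuous_intros E_cont MEc)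
      fix y :: real assume y: "y \<in> {0..1}"
      have "?f y = E j x y * (exp (\<i> * of_real ((x' - x) * M y)) - 1 - \<i> * of_real ((x' - x) * M y))"
        unfolding shift[of x' y x] ME_def by (simp add: algebra_simps)
      then have "cmod (?f y) = cmod (\<phi> j y) * cmod (exp (\<i> * of_real ((x' - x) * M y)) - 1 - \<i> * of_real ((x' - x) * M y))"
        by (simp only: norm_mult cmod_E)
      also have "\<dots> \<le> P * ((x' - x) * M y)\<^sup>2"
        by (intro mult_mono P(2)[OF y] norm_exp_i_taylor P(1)) auto
      also have "\<dots> \<le> P * ((x' - x)\<^sup>2 * B\<^sup>2)"
        unfolding power_mult_distrib using P(1) B(2)[OF y] power_mono[OF B(2)[OF y], of 2]
        by (intro mult_left_mono) auto
      finally show "cmod (?f y) \<le> C * (x' - x)\<^sup>2" by (simp add: C_def mult_ac)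
    qed simp
    ultimately show "cmod (ip (E j x') (\<phi> k) - ip (E j x) (\<phi> k) - of_real (x' - x) * ip (ME x) (\<phi> k)) \<le> C * (x' - x)\<^sup>2"
      by simp
    let ?g = "\<lambda>y. ME x' y - ME x y"
    have "ip (ME x') (\<phi> k) - ip (ME x) (\<phi> k) = ip ?g (\<phi> k)"
      by (simp only: ip_diff_left sME sqint_phi)
    moreover have "cmod (ip ?g (\<phi> k)) \<le> C * \<bar>x' - x\<bar>"
    proof (rule ipb)
      show "continuous_on {0..1} ?g" by (intro continuous_intros MEc)
      fix y :: real assume y: "y \<in> {0..1}"
      have "?g y = \<i> * of_real (M y) * E j x y * (exp (\<i> * of_real ((x' - x) * M y)) - 1)"
        unfolding ME_def shift[of x' y x] by (simp add: algebra_simps)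
      then have "cmod (?g y) = \<bar>M y\<bar> * cmod (\<phi> j y) * cmod (exp (\<i> * of_real ((x' - x) * M y)) - 1)"
        by (simp only: norm_mult cmod_E norm_of_real norm_ii mult_1)
      also have "\<dots> \<le> B * P * \<bar>(x' - x) * M y\<bar>"
        using B P by (intro mult_mono P(2)[OF y] B(2)[OF y] norm_exp_i_minus_1) auto
      also have "\<dots> \<le> B * P * (\<bar>x' - x\<bar> * B)"
        unfolding abs_mult using B P B(2)[OF y] by (intro mult_left_mono) auto
      finally show "cmod (?g y) \<le> C * \<bar>x' - x\<bar>" by (simp add: C_def power2_eq_square mult_ac)
    qed simp
    ultimately show "cmod (ip (ME x') (\<phi> k) - ip (ME x) (\<phi> k)) \<le> C * \<bar>x' - x\<bar>" by simp
  qed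
  moreover have "ip (ME x) (\<phi> k) = \<i> * ip (\<lambda>y. of_real (M y) * E j x y) (\<phi> k)" for x
    unfolding ME_def mult.assoc by (rule ip_cmult_left)
  ultimately show ?thesis by simp
qed

section \<open>The comparison function in time\<close>

definition \<Theta> :: "nat \<Rightarrow> (real \<Rightarrow> real) \<Rightarrow> real \<Rightarrow> real \<Rightarrow> complex" where
  "\<Theta> j s t y = exp (- \<i> * complex_of_real (eigval j * t)) * E j (s t) y"

definition R :: "nat \<Rightarrow> (real \<Rightarrow> real) \<Rightarrow> real \<Rightarrow> real \<Rightarrow> complex" where
  "R j s t y = exp (- \<i> * complex_of_real (eigval j * t)) * r j (s t) y"

lemma sqint_\<Theta>: "sqint (\<Theta> j s t)" and sqint_R: "sqint (R j s t)"
  unfolding \<Theta>_def[abs_def] R_def[abs_def] by (intro sqint_cmult sqint_E sqint_r)+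

lemma nrm_\<Theta>: "j \<ge> 1 \<Longrightarrow> nrm (\<Theta> j s t) = 1"
  unfolding \<Theta>_def[abs_def] nrm_cmult by (simp add: nrm_E)

lemma nrm_R: "nrm (R j s t) = nrm (r j (s t))"
  unfolding R_def[abs_def] nrm_cmult by simp

lemma ip_\<Theta>_R: "ip (\<Theta> j s t) (R j s t) = - of_real ((s t)\<^sup>2 * diag (\<lambda>x. (M' x)\<^sup>2) j)"
proof -
  have "exp (- \<i> * complex_of_real (eigval j * t)) * cnj (exp (- \<i> * complex_of_real (eigval j * t))) = 1"
    by (simp add: exp_cnj exp_add[symmetric])
  then have "ip (\<Theta> j s t) (R j s t) = ip (E j (s t)) (r j (s t))"
    unfolding \<Theta>_def[abs_def] R_def[abs_def] ip_cmult_left ip_cmult_right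
    by (simp only: mult.assoc[symmetric] mult_1)
  then show ?thesis by (simp only: ip_E_r)
qed

text \<open>Differentiating the phase produces \<open>eigval j\<close> where coefficient
  \<open>k\<close> calls for \<open>eigval k\<close>. By \<open>ip_r_phi\<close> the difference is
  the coefficient of \<open>R\<close>, so the source is \<open>- R\<close>; it is written as a
  scalar multiple for the lemmas on \<open>ip\<close> and \<open>nrm\<close>.\<close>

lemma \<Theta>_evolves:
  assumes s: "primitive_on T s u" and s1: "\<And>t. t \<in> {0..T} \<Longrightarrow> \<bar>s t\<bar> \<le> 1" and j: "j \<ge> 1"
  shows "evolves T M u (\<Theta> j s) (\<lambda>t y. - 1 * R j s t y)"
  unfolding evolves_def
proof (intro conjI ballI allI impI)
  show "\<exists>B. \<forall>t\<in>{0..T}. nrm (\<Theta> j s t) \<le> B" using nrm_\<Theta>[OF j] by (metis order_refl)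
  obtain C where C: "C > 0" "\<And>s. \<bar>s\<bar> \<le> 1 \<Longrightarrow> nrm (r j s) \<le> C * \<bar>s\<bar>" using nrm_r_le by blast
  have "nrm (\<lambda>y. - 1 * R j s t y) \<le> C" if "t \<in> {0..T}" for t
    unfolding nrm_cmult nrm_R
    using order_trans[OF C(2)[OF s1[OF that]] mult_left_le[OF s1[OF that] less_imp_le[OF C(1)]]] by simp
  then show "\<exists>B. \<forall>t\<in>{0..T}. nrm (\<lambda>y. - 1 * R j s t y) \<le> B" by blast
  fix k :: nat assume k: "k \<ge> 1"
  let ?e = "\<lambda>t. exp (- \<i> * complex_of_real (eigval j * t))"
  show "primitive_on T (\<lambda>t. ip (\<Theta> j s t) (\<phi> k))
        (\<lambda>t. - \<i> * of_real (eigval k) * ip (\<Theta> j s t) (\<phi> k)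
           + \<i> * of_real (u t) * ip (\<lambda>y. of_real (M y) * \<Theta> j s t y) (\<phi> k) + \<i> * ip (\<lambda>y. - 1 * R j s t y) (\<phi> k))"
  proof (rule primitive_on_cong[OF primitive_on_mult[OF primitive_on_exp_phase[of T "eigval j"] E_coefficient_chain[OF s k, of j]]])
    fix t
    show th: "ip (\<Theta> j s t) (\<phi> k) = ?e t * ip (E j (s t)) (\<phi> k)"
      unfolding \<Theta>_def[abs_def] by (rule ip_cmult_left)
    have 1: "ip (\<lambda>y. - 1 * R j s t y) (\<phi> k) = - (?e t * (of_real (eigval j - eigval k) * ip (E j (s t)) (\<phi> k)))"
      unfolding R_def[abs_def] ip_cmult_left ip_r_phi by simp
    have 2: "ip (\<lambda>y. of_real (M y) * \<Theta> j s t y) (\<phi> k) = ?e t * ip (\<lambda>y. of_real (M y) * E j (s t) y) (\<phi> k)"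
    proof -
      have "(\<lambda>y. of_real (M y) * \<Theta> j s t y) = (\<lambda>y. ?e t * (of_real (M y) * E j (s t) y))"
        by (simp add: \<Theta>_def mult_ac)
      then show ?thesis by (simp only: ip_cmult_left)
    qed
    show "- \<i> * of_real (eigval k) * ip (\<Theta> j s t) (\<phi> k)
           + \<i> * of_real (u t) * ip (\<lambda>y. of_real (M y) * \<Theta> j s t y) (\<phi> k) + \<i> * ip (\<lambda>y. - 1 * R j s t y) (\<phi> k)
      = - \<i> * of_real (eigval j) * ?e t * ip (E j (s t)) (\<phi> k)
        + ?e t * (of_real (u t) * (\<i> * ip (\<lambda>y. of_real (M y) * E j (s t) y) (\<phi> k)))"
      unfolding th 1 2 of_real_diff by (simp add: algebra_simps)
  qed
qed (use sqint_\<Theta> sqint_R sqint_cmult in blast)+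

end

subsection \<open>The expansion at the final time\<close>

text \<open>Used for the control, to make \<open>s\<close> small, and for \<open>s\<close> itself,
  to compare the integral of |s| with that of its square at the gain of a factor
  \<open>T\<close>.\<close>

lemma L2_integral_le:
  fixes u :: "real \<Rightarrow> real"
  assumes u: "L2 0 T u" and T: "0 \<le> T"
  shows "lint 0 T (\<lambda>t. \<bar>u t\<bar>) \<le> sqrt T * L2norm 0 T u"
proof -
  have "lint 0 T (\<lambda>t. 1 * \<bar>u t\<bar>) \<le> sqrt (lint 0 T (\<lambda>t. 1\<^sup>2)) * sqrt (lint 0 T (\<lambda>t. \<bar>u t\<bar>\<^sup>2))"
    by (rule Cauchy_Schwarz_integral) (use u in \<open>auto simp: L2_def\<close>)
  then show ?thesis using integral_leb_const[OF T, of 1] by (simp add: L2norm_def)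
qed

context C2_potential
begin

lemma final_overlap:
  assumes j: "j \<ge> 1"
  obtains K where "K > 0"
    "\<And>T u \<psi>. 0 < T \<Longrightarrow> T \<le> 1 \<Longrightarrow> L2 0 T u \<Longrightarrow> L2norm 0 T u \<le> 1 \<Longrightarrow>
       evolves T M u \<psi> (\<lambda>t y. 0) \<Longrightarrow> (AE y in leb 0 1. \<psi> 0 y = \<phi> j y) \<Longrightarrow>
       cmod (ip (\<psi> T) (\<Theta> j (\<lambda>t. lint 0 t u) T)
         - (1 - \<i> * of_real (diag (\<lambda>x. (M' x)\<^sup>2) j * lint 0 T (\<lambda>t. (lint 0 t u)\<^sup>2))))
       \<le> K * T * lint 0 T (\<lambda>t. (lint 0 t u)\<^sup>2)"
proof -
  obtain C where C: "C > 0" "\<And>s. \<bar>s\<bar> \<le> 1 \<Longrightarrow> nrm (r j s) \<le> C * \<bar>s\<bar>" using nrm_r_le by blast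
  have main: "cmod (ip (\<psi> T) (\<Theta> j (\<lambda>t. lint 0 t u) T)
         - (1 - \<i> * of_real (diag (\<lambda>x. (M' x)\<^sup>2) j * lint 0 T (\<lambda>t. (lint 0 t u)\<^sup>2))))
       \<le> 2 * C\<^sup>2 * T * lint 0 T (\<lambda>t. (lint 0 t u)\<^sup>2)"
    if T: "0 < T" "T \<le> 1" and u: "L2 0 T u" "L2norm 0 T u \<le> 1"
      and ev: "evolves T M u \<psi> (\<lambda>t y. 0)" and init: "AE y in leb 0 1. \<psi> 0 y = \<phi> j y" for T u \<psi>
  proof -
    define s where "s = (\<lambda>t. lint 0 t u)"
    define D where "D = diag (\<lambda>x. (M' x)\<^sup>2) j"
    define S where "S = lint 0 T (\<lambda>t. (s t)\<^sup>2)"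
    define J where "J = lint 0 T (\<lambda>t. \<bar>s t\<bar>)"
    have ui: "integrable (leb 0 T) u" by (rule L2_imp_integrable[OF u(1)])
    have sp: "primitive_on T s u" unfolding s_def using primitive_on_integral[OF ui, of 0] by simp
    note sc = primitive_on_continuous[OF sp]
    \<comment> \<open>The restrictions on \<open>T\<close> and on the norm of \<open>u\<close> bring
      \<open>s\<close> into the range of \<open>nrm_r_le\<close>.\<close>
    have s1: "\<bar>s t\<bar> \<le> 1" if t: "t \<in> {0..T}" for t
    proof -
      have "\<bar>s t\<bar> \<le> lint 0 t (\<lambda>t. \<bar>u t\<bar>)"
        unfolding s_def using norm_integral_leb_le[of 0 t "\<lambda>t. \<bar>u t\<bar>" u] integrable_leb_subset[OF ui, of 0 t] t by auto
      also have "\<dots> \<le> lint 0 t (\<lambda>t. \<bar>u t\<bar>) + lint t T (\<lambda>t. \<bar>u t\<bar>)"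
        by (simp add: integral_nonneg_AE)
      also have "\<dots> = lint 0 T (\<lambda>t. \<bar>u t\<bar>)"
        by (rule integral_leb_split[symmetric]) (use ui t in auto)
      also have "\<dots> \<le> sqrt T * L2norm 0 T u" using L2_integral_le[OF u(1)] T by simp
      also have "\<dots> \<le> 1 * 1"
        by (rule mult_mono) (use T u(2) in \<open>auto simp: L2norm_def intro: integral_nonneg_AE\<close>)
      finally show ?thesis by simp
    qed
    have s2i: "integrable (leb 0 T) (\<lambda>t. (s t)\<^sup>2)" and sai: "integrable (leb 0 T) (\<lambda>t. \<bar>s t\<bar>)"
      by (intro integrable_continuous_leb continuous_intros sc)+
    have J0: "J \<ge> 0" unfolding J_def by (rule integral_nonneg_AE) simp
    \<comment> \<open>The origin of the factor \<open>T\<close>: the remainder will be quadratic in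
      \<open>J\<close>, while the main term is linear in \<open>S\<close>.\<close>
    have JS: "J\<^sup>2 \<le> T * S"
    proof -
      have "L2 0 T s"
        unfolding L2_def using s2i borel_measurable_continuous_leb[OF sc] by simp
      then have "J \<le> sqrt T * L2norm 0 T s" using L2_integral_le T by (simp add: J_def)
      then have "J\<^sup>2 \<le> (sqrt T * L2norm 0 T s)\<^sup>2" using J0 by (rule power_mono)
      also have "\<dots> = T * S"
      proof -
        have "S \<ge> 0" unfolding S_def by (rule integral_nonneg_AE) simp
        then show ?thesis using T by (simp add: power_mult_distrib L2norm_def S_def)
      qed
      finally show ?thesis .
    qed
    have ev\<Theta>: "evolves T M u (\<Theta> j s) (\<lambda>t y. - 1 * R j s t y)" by (rule \<Theta>_evolves[OF sp s1 j])
    have sq: "sqint (\<psi> t)" if "t \<in> {0..T}" for t using ev that by (simp add: evolves_def)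
    have \<psi>0: "ip (\<psi> 0) g = ip (\<phi> j) g" if "sqint g" for g
      by (rule ip_cong_AE[OF init _ sq that sqint_phi that]) (use T in auto)
    \<comment> \<open>Conservation of the norm is \<open>evolves_ip\<close> for the solution paired
      with itself, where both sources are zero.\<close>
    have nrm\<psi>: "nrm (\<psi> t) = 1" if t: "t \<in> {0..T}" for t
    proof -
      have "ip (\<psi> t) (\<psi> t) = ip (\<psi> 0) (\<psi> 0)"
        using primitive_onD(2)[OF evolves_ip[OF ev ev M_cont ui], of t] t
        by (simp add: ip_zero_left ip_commute[of _ "\<lambda>_. 0"])
      also have "\<dots> = cnj (ip (\<psi> 0) (\<phi> j))"
        using \<psi>0[OF sq[of 0]] T ip_commute[of "\<phi> j" "\<psi> 0"] by simp
      also have "\<dots> = 1" using \<psi>0[OF sqint_phi] ip_phi_phi[OF j j] by simp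
      finally have "(nrm (\<psi> t))\<^sup>2 = 1" unfolding ip_self using of_real_eq_1_iff by blast
      then show ?thesis using nrm_nonneg[of "\<psi> t"] by (simp add: power2_eq_1_iff)
    qed
    have \<Theta>0: "\<Theta> j s 0 = \<phi> j"
      by (auto simp: \<Theta>_def E_def s_def)
    have pr: "primitive_on T (\<lambda>t. ip (\<psi> t) (\<Theta> j s t)) (\<lambda>t. \<i> * ip (\<psi> t) (R j s t))"
      by (rule primitive_on_cong[OF evolves_ip[OF ev ev\<Theta> M_cont ui]])
        (auto simp: ip_zero_left ip_cmult_right[of _ "- 1", simplified])
    define w where "w t = nrm (\<lambda>y. \<psi> t y - \<Theta> j s t y)" for t
    \<comment> \<open>Writing \<open>\<psi>\<close> as \<open>\<Theta>\<close> plus the difference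
      isolates the explicit term with \<open>D\<close>; \<open>q\<close> is what the difference
      contributes.\<close>
    define q where "q t = ip (\<lambda>y. \<psi> t y - \<Theta> j s t y) (R j s t)" for t
    have qeq: "ip (\<psi> t) (R j s t) = q t - of_real (D * (s t)\<^sup>2)" if t: "t \<in> {0..T}" for t
      unfolding q_def D_def
      using ip_\<Theta>_R[of j s t] by (simp add: ip_diff_left[OF sq[OF t] sqint_\<Theta> sqint_R] mult.commute)
    have s2c: "integrable (leb 0 t) (\<lambda>t. complex_of_real (D * (s t)\<^sup>2))" if t: "t \<in> {0..T}" for t
      by (rule integrable_leb_subset[where a = 0 and b = T])
        (use s2i t in \<open>auto simp del: of_real_power of_real_mult\<close>)
    have qi: "integrable (leb 0 t) q" if t: "t \<in> {0..T}" for t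
    proof -
      have "integrable (leb 0 T) (\<lambda>t. (- \<i>) * (\<i> * ip (\<psi> t) (R j s t)))"
        using primitive_onD(1)[OF pr] by (rule integrable_mult_right)
      then have "integrable (leb 0 T) (\<lambda>t. ip (\<psi> t) (R j s t))"
        by (simp add: mult.assoc[symmetric])
      from integrable_leb_subset[OF this, of 0 t] have "integrable (leb 0 t) (\<lambda>t. ip (\<psi> t) (R j s t))"
        using t by simp
      from Bochner_Integration.integrable_add[OF this s2c[OF t]] show ?thesis
        by (subst Bochner_Integration.integrable_cong[OF refl, of _ q "\<lambda>\<tau>. ip (\<psi> \<tau>) (R j s \<tau>) + complex_of_real (D * (s \<tau>)\<^sup>2)"])
          (use qeq t in auto)
    qed
    have val: "ip (\<psi> t) (\<Theta> j s t) = 1 + \<i> * lint 0 t q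
        - \<i> * of_real (D * lint 0 t (\<lambda>t. (s t)\<^sup>2))" if t: "t \<in> {0..T}" for t
    proof -
      have "ip (\<psi> t) (\<Theta> j s t) = 1 + lint 0 t (\<lambda>t. \<i> * ip (\<psi> t) (R j s t))"
        using primitive_onD(2)[OF pr, of t] t \<psi>0[OF sqint_phi, of j] ip_phi_phi[OF j j] by (simp add: \<Theta>0)
      also have "lint 0 t (\<lambda>t. \<i> * ip (\<psi> t) (R j s t)) = \<i> * lint 0 t (\<lambda>t. ip (\<psi> t) (R j s t))"
        by (rule integral_mult_right_zero)
      also have "lint 0 t (\<lambda>t. ip (\<psi> t) (R j s t)) = lint 0 t (\<lambda>t. q t - of_real (D * (s t)\<^sup>2))"
        by (rule Bochner_Integration.integral_cong) (use qeq t in auto)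
      also have "\<dots> = lint 0 t q - lint 0 t (\<lambda>t. of_real (D * (s t)\<^sup>2))"
        by (rule Bochner_Integration.integral_diff[OF qi[OF t] s2c[OF t]])
      also have "lint 0 t (\<lambda>t. complex_of_real (D * (s t)\<^sup>2)) = of_real (D * lint 0 t (\<lambda>t. (s t)\<^sup>2))"
        by (simp del: of_real_mult of_real_power)
      finally show ?thesis by (simp add: algebra_simps)
    qed
    have nR: "nrm (R j s t) \<le> C * \<bar>s t\<bar>" if t: "t \<in> {0..T}" for t
      unfolding nrm_R by (rule C(2)[OF s1[OF t]])
    have qle: "cmod (lint 0 t q) \<le> W * (C * J)"
      if t: "t \<in> {0..T}" and W: "\<And>\<tau>. \<tau> \<in> {0..T} \<Longrightarrow> w \<tau> \<le> W" for t W
    proof -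
      have W0: "W \<ge> 0" using order_trans[OF nrm_nonneg W[OF t, unfolded w_def]] .
      have sai': "integrable (leb 0 t) (\<lambda>t. \<bar>s t\<bar>)"
        by (rule integrable_leb_subset[OF sai]) (use t in auto)
      have "cmod (lint 0 t q) \<le> lint 0 t (\<lambda>t. W * C * \<bar>s t\<bar>)"
      proof (rule norm_integral_leb_le)
        show "integrable (leb 0 t) (\<lambda>t. W * C * \<bar>s t\<bar>)" using sai' by simp
        show "q \<in> borel_measurable (leb 0 t)" using qi[OF t] by auto
        fix \<tau> assume "0 < \<tau>" "\<tau> < t"
        then have \<tau>: "\<tau> \<in> {0..T}" using t by simp
        have "cmod (q \<tau>) \<le> w \<tau> * nrm (R j s \<tau>)"
          unfolding q_def w_def by (rule cmod_ip_le[OF sqint_diff[OF sq[OF \<tau>] sqint_\<Theta>] sqint_R])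
        also have "\<dots> \<le> W * (C * \<bar>s \<tau>\<bar>)"
          by (rule mult_mono[OF W[OF \<tau>] nR[OF \<tau>] W0 nrm_nonneg])
        finally show "cmod (q \<tau>) \<le> W * C * \<bar>s \<tau>\<bar>" by (simp add: mult.assoc)
      qed
      also have "\<dots> = W * C * lint 0 t (\<lambda>t. \<bar>s t\<bar>)" by simp
      also have "lint 0 t (\<lambda>t. \<bar>s t\<bar>) \<le> J"
      proof -
        have "J = lint 0 t (\<lambda>t. \<bar>s t\<bar>) + lint t T (\<lambda>t. \<bar>s t\<bar>)"
          unfolding J_def by (rule integral_leb_split[OF sai]) (use t in auto)
        then show ?thesis by (simp add: integral_nonneg_AE)
      qed
      finally show ?thesis using W0 C(1) by (simp add: mult.assoc mult_left_mono)
    qed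
    \<comment> \<open>The term with \<open>D\<close> is purely imaginary in the overlap, so the
      distance is governed by \<open>q\<close> alone, and \<open>q\<close> contains the distance
      itself as a factor.\<close>
    have wsq: "(w t)\<^sup>2 \<le> 2 * cmod (lint 0 t q)" if t: "t \<in> {0..T}" for t
    proof -
      have "(w t)\<^sup>2 = 2 - 2 * Re (ip (\<psi> t) (\<Theta> j s t))"
        unfolding w_def nrm_diff_square[OF sq[OF t] sqint_\<Theta>] nrm\<psi>[OF t] nrm_\<Theta>[OF j] by simp
      also have "\<dots> = 2 * Im (lint 0 t q)"
        unfolding val[OF t] by simp
      also have "\<dots> \<le> 2 * cmod (lint 0 t q)"
        using abs_Im_le_cmod[of "lint 0 t q"] by simp
      finally show ?thesis .
    qed
    \<comment> \<open>Bootstrapping: with \<open>W\<close> as supremum, the two preceding bounds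
      give \<open>W\<^sup>2 \<le> 2 * (W * (C * J))\<close>, hence a bound linear in
      \<open>J\<close>.\<close>
    define W where "W = Sup (w ` {0..T})"
    \<comment> \<open>A crude bound, needed only to make the supremum meaningful.\<close>
    have w2: "w t \<le> 2" if t: "t \<in> {0..T}" for t
    proof -
      have "\<bar>Re (ip (\<psi> t) (\<Theta> j s t))\<bar> \<le> nrm (\<psi> t) * nrm (\<Theta> j s t)"
        using cmod_ip_le[OF sq[OF t] sqint_\<Theta>] abs_Re_le_cmod order_trans by blast
      then have "(w t)\<^sup>2 \<le> 2\<^sup>2"
        unfolding w_def nrm_diff_square[OF sq[OF t] sqint_\<Theta>] using nrm\<psi>[OF t] nrm_\<Theta>[OF j] by (simp add: abs_le_iff)
      then show ?thesis by (rule power2_le_imp_le) simp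
    qed
    have bdd: "bdd_above (w ` {0..T})" using w2 by (auto intro: bdd_aboveI[of _ 2])
    have wW: "w t \<le> W" if "t \<in> {0..T}" for t
      unfolding W_def using bdd that by (intro cSup_upper) auto
    have W0: "0 \<le> W" using order_trans[OF nrm_nonneg wW[of 0, unfolded w_def]] T by simp
    have "W \<le> sqrt (2 * (W * (C * J)))"
      unfolding W_def
    proof (rule cSup_least)
      fix x assume "x \<in> w ` {0..T}"
      then obtain t where t: "t \<in> {0..T}" "x = w t" by blast
      have "(w t)\<^sup>2 \<le> 2 * (W * (C * J))" using wsq[OF t(1)] qle[OF t(1) wW] by linarith
      then show "x \<le> sqrt (2 * (Sup (w ` {0..T}) * (C * J)))"
        using real_le_rsqrt t(2) by (simp add: W_def)
    qed (use T in auto)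
    then have "W\<^sup>2 \<le> 2 * (W * (C * J))"
      using W0 J0 C(1) by (metis real_sqrt_le_iff real_sqrt_pow2_iff power_mono real_sqrt_ge_0_iff order_trans real_sqrt_pow2 mult_nonneg_nonneg less_imp_le zero_le_numeral)
    then have W2: "W \<le> 2 * (C * J)"
      using W0 J0 C(1) by (cases "W = 0") (auto simp: power2_eq_square mult.left_commute[of _ W])
    have "cmod (ip (\<psi> T) (\<Theta> j s T) - (1 - \<i> * of_real (D * S))) = cmod (lint 0 T q)"
      using val[of T] T by (simp add: S_def norm_mult)
    also have "\<dots> \<le> W * (C * J)" by (rule qle[OF _ wW]) (use T in auto)
    also have "\<dots> \<le> 2 * (C * J) * (C * J)" using W2 C(1) J0 by (intro mult_right_mono) auto
    also have "\<dots> = 2 * C\<^sup>2 * J\<^sup>2" by (simp add: power2_eq_square)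
    also have "\<dots> \<le> 2 * C\<^sup>2 * (T * S)" by (rule mult_left_mono[OF JS]) simp
    finally show ?thesis unfolding s_def D_def S_def by (simp add: mult.assoc)
  qed
  show thesis by (rule that[of "2 * C\<^sup>2"]) (use C(1) main in auto)
qed

text \<open>First order Taylor expansion of the exponential; the minus sign comes from conjugation
  in the second slot of \<open>ip\<close>.\<close>

lemma phase_overlap:
  assumes j: "j \<ge> 1"
  obtains K where "K > 0"
    "\<And>\<sigma>. cmod (ip (\<phi> j) (E j \<sigma>) - (1 - \<i> * of_real (\<sigma> * diag M j))) \<le> K * \<sigma>\<^sup>2"
proof -
  obtain B where B: "B \<ge> 0" "\<And>y. y \<in> {0..1} \<Longrightarrow> \<bar>M y\<bar> \<le> B"
    using continuous_bound_Icc[OF M_cont] by auto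
  obtain P where P: "P \<ge> 0" "\<And>y. y \<in> {0..1} \<Longrightarrow> cmod (\<phi> j y) \<le> P"
    using continuous_bound_Icc[OF continuous_on_phi] by blast
  have le: "cmod (ip (\<phi> j) (E j \<sigma>) - (1 - \<i> * of_real (\<sigma> * diag M j))) \<le> (P * B\<^sup>2 + 1) * \<sigma>\<^sup>2" for \<sigma>
  proof -
    let ?M\<phi> = "\<lambda>y. of_real (M y) * \<phi> j y"
    let ?f = "\<lambda>y. E j \<sigma> y - \<phi> j y - (\<i> * of_real \<sigma>) * ?M\<phi> y"
    have sM: "sqint ?M\<phi>" by (intro sqint_continuous continuous_intros M_cont continuous_on_phi)
    have fc: "continuous_on {0..1} ?f"
      by (intro continuous_intros E_cont M_cont continuous_on_phi)
    have "ip (\<phi> j) ?f = ip (\<phi> j) (E j \<sigma>) - ip (\<phi> j) (\<phi> j) - cnj (\<i> * of_real \<sigma>) * ip (\<phi> j) ?M\<phi>"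
      by (simp only: ip_diff_right ip_cmult_right sqint_diff sqint_E sqint_phi sqint_cmult sM)
    also have "ip (\<phi> j) ?M\<phi> = of_real (diag M j)"
      using ip_mult_real_left[of M "\<phi> j" "\<phi> j"] of_real_diag[of M j] by simp
    finally have eq: "ip (\<phi> j) (E j \<sigma>) - (1 - \<i> * of_real (\<sigma> * diag M j)) = ip (\<phi> j) ?f"
      using ip_phi_phi[OF j j] by (simp add: algebra_simps)
    have "nrm ?f \<le> (P * B\<^sup>2) * \<sigma>\<^sup>2"
    proof (rule nrm_le_sup[OF borel_measurable_continuous_leb[OF fc]])
      fix y :: real assume "0 < y" "y < 1"
      then have y: "y \<in> {0..1}" by simp
      have "?f y = \<phi> j y * (exp (\<i> * of_real (\<sigma> * M y)) - 1 - \<i> * of_real (\<sigma> * M y))"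
        by (simp add: E_def algebra_simps)
      then have "cmod (?f y) = cmod (\<phi> j y) * cmod (exp (\<i> * of_real (\<sigma> * M y)) - 1 - \<i> * of_real (\<sigma> * M y))"
        by (simp only: norm_mult)
      also have "\<dots> \<le> P * (\<sigma> * M y)\<^sup>2"
        by (intro mult_mono P(2)[OF y] norm_exp_i_taylor P(1)) auto
      also have "\<dots> \<le> P * (\<sigma>\<^sup>2 * B\<^sup>2)"
        unfolding power_mult_distrib using P(1) power_mono[OF B(2)[OF y], of 2]
        by (intro mult_left_mono) auto
      finally show "cmod (?f y) \<le> (P * B\<^sup>2) * \<sigma>\<^sup>2" by (simp add: mult_ac)
    qed (use P in simp)
    moreover have "cmod (ip (\<phi> j) ?f) \<le> nrm (\<phi> j) * nrm ?f"
      by (rule cmod_ip_le[OF sqint_phi sqint_continuous[OF fc]])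
    ultimately have "cmod (ip (\<phi> j) ?f) \<le> (P * B\<^sup>2) * \<sigma>\<^sup>2"
      unfolding nrm_phi[OF j] mult_1 by (meson order_trans)
    then show ?thesis unfolding eq distrib_right by (rule order_trans) simp
  qed
  show thesis by (rule that[of "P * B\<^sup>2 + 1", OF _ le]) (use P B in \<open>simp add: add_nonneg_pos\<close>)
qed

end

subsection \<open>The contradiction\<close>

text \<open>Here \<sigma> stands for s(T), \<open>S\<close> for the integral of
  \<open>s\<^sup>2\<close>, and \<open>e1\<close>, \<open>e2\<close> for the overlaps of
  \<open>\<phi> j\<close> with \<open>E j \<sigma>\<close>. The threshold \<eta> does not depend on
  \<delta>, so the elimination has to be exact in \<delta> over all of (0,1].\<close>

lemma final_algebra:
  fixes d1 d2 D1 D2 K :: real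
  assumes d1: "d1 \<noteq> 0" and A: "d1 * D2 - d2 * D1 \<noteq> 0" and K: "K > 0"
  obtains \<eta> where "\<eta> > 0"
    "\<And>T \<sigma> S \<delta> e1 e2. 0 < T \<Longrightarrow> T \<le> \<eta> \<Longrightarrow> \<bar>\<sigma>\<bar> \<le> \<eta> \<Longrightarrow> S \<ge> 0 \<Longrightarrow> 0 < \<delta> \<Longrightarrow> \<delta> \<le> 1 \<Longrightarrow>
      cmod (e1 - (1 - \<i> * of_real (\<sigma> * d1))) \<le> K * \<sigma>\<^sup>2 \<Longrightarrow>
      cmod (e2 - (1 - \<i> * of_real (\<sigma> * d2))) \<le> K * \<sigma>\<^sup>2 \<Longrightarrow>
      cmod (e1 - (1 - \<i> * of_real (D1 * S))) \<le> K * T * S \<Longrightarrow>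
      cmod ((of_real (sqrt (1 - \<delta>\<^sup>2)) + \<i> * of_real (sgn ((d1 * D2 - d2 * D1) * d1)) * of_real \<delta>) * e2
        - (1 - \<i> * of_real (D2 * S))) \<le> K * T * S \<Longrightarrow> False"
proof -
  define A where "A = d1 * D2 - d2 * D1"
  \<comment> \<open>For \<sigma> small, the error \<open>K * \<sigma>\<^sup>2\<close> is absorbed by
    half of |d1 \<sigma>|; this gives \<open>\<bar>\<sigma>\<bar> \<le> L * S\<close> and accounts
    for the factor 2.\<close>
  define L where "L = 2 * (\<bar>D1\<bar> + K) / \<bar>d1\<bar>"
  \<comment> \<open>The sum of the coefficients of \<open>\<eta> * S\<close> in the error of the
    final identity: \<open>d2\<close> times the first equation and \<open>d1\<close> times the
    imaginary part of \<open>err\<close>.\<close>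
  define Q where "Q = \<bar>d2\<bar> * (K * (L + 1)) + \<bar>d1\<bar> * ((1 + \<bar>d2\<bar>) * (K * (L + 1)))"
  have L: "L > 0" using d1 K by (simp add: L_def add_nonneg_pos)
  have "0 < K * (L + 1)" using K L by simp
  then have "0 \<le> \<bar>d2\<bar> * (K * (L + 1))" "0 < \<bar>d1\<bar> * ((1 + \<bar>d2\<bar>) * (K * (L + 1)))"
    using d1 by (auto intro!: mult_pos_pos simp: add_pos_nonneg)
  then have Q: "Q > 0" unfolding Q_def by simp
  \<comment> \<open>The three entries bound \<open>T\<close> and \<sigma> by 1, allow the absorption
    behind \<open>L\<close>, and keep the total error below
    \<open>\<bar>A\<bar> * S\<close>.\<close>
  define \<eta> where "\<eta> = Min {1, \<bar>d1\<bar> / (2 * K), \<bar>A\<bar> / Q}"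
  have A0: "\<bar>A\<bar> > 0" using A by (simp add: A_def)
  have \<eta>: "\<eta> > 0" "\<eta> \<le> 1" "\<eta> \<le> \<bar>d1\<bar> / (2 * K)" "\<eta> \<le> \<bar>A\<bar> / Q"
    unfolding \<eta>_def using d1 K A0 Q by auto
  show thesis
  proof (rule that[OF \<eta>(1)])
    fix T \<sigma> S \<delta> :: real and e1 e2 :: complex
    assume T: "0 < T" "T \<le> \<eta>" and \<sigma>: "\<bar>\<sigma>\<bar> \<le> \<eta>" and S: "S \<ge> 0" and \<delta>: "0 < \<delta>" "\<delta> \<le> 1"
      and e1: "cmod (e1 - (1 - \<i> * of_real (\<sigma> * d1))) \<le> K * \<sigma>\<^sup>2"
      and e2: "cmod (e2 - (1 - \<i> * of_real (\<sigma> * d2))) \<le> K * \<sigma>\<^sup>2"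
      and o1: "cmod (e1 - (1 - \<i> * of_real (D1 * S))) \<le> K * T * S"
      and o2: "cmod ((of_real (sqrt (1 - \<delta>\<^sup>2)) + \<i> * of_real (sgn ((d1 * D2 - d2 * D1) * d1)) * of_real \<delta>) * e2
        - (1 - \<i> * of_real (D2 * S))) \<le> K * T * S"
    define \<alpha> where "\<alpha> = sgn (A * d1)"
    define c where "c = of_real (sqrt (1 - \<delta>\<^sup>2)) + \<i> * complex_of_real (\<alpha> * \<delta>)"
    have \<alpha>d: "\<alpha> * d1 = sgn A * \<bar>d1\<bar>" by (simp add: \<alpha>_def sgn_mult abs_sgn mult.assoc)
    have \<alpha>1: "\<alpha>\<^sup>2 = 1" using A0 d1 by (auto simp: \<alpha>_def sgn_if)
    have o2': "cmod (c * e2 - (1 - \<i> * of_real (D2 * S))) \<le> K * T * S"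
      using o2 by (simp add: c_def \<alpha>_def A_def mult.assoc)
    have c1: "cmod c = 1"
    proof -
      have "\<delta>\<^sup>2 \<le> 1" using \<delta> by (simp add: power_le_one)
      then show ?thesis by (simp add: c_def cmod_def power_mult_distrib \<alpha>1)
    qed
    have first: "\<bar>\<sigma> * d1 - D1 * S\<bar> \<le> K * \<sigma>\<^sup>2 + K * T * S"
    proof -
      have "\<bar>\<sigma> * d1 - D1 * S\<bar> = cmod ((e1 - (1 - \<i> * of_real (\<sigma> * d1))) - (e1 - (1 - \<i> * of_real (D1 * S))))"
      proof -
        have "(e1 - (1 - \<i> * of_real (\<sigma> * d1))) - (e1 - (1 - \<i> * of_real (D1 * S))) = \<i> * of_real (\<sigma> * d1 - D1 * S)"
          by (simp add: algebra_simps)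
        then show ?thesis by (simp only: norm_mult norm_ii norm_of_real mult_1)
      qed
      also have "\<dots> \<le> K * \<sigma>\<^sup>2 + K * T * S"
        using norm_triangle_ineq4 e1 o1 by (meson add_mono order_trans)
      finally show ?thesis .
    qed
    have \<sigma>S: "\<bar>\<sigma>\<bar> \<le> L * S"
    proof -
      have "K * \<sigma>\<^sup>2 \<le> \<bar>d1\<bar> / 2 * \<bar>\<sigma>\<bar>"
      proof -
        have "K * \<bar>\<sigma>\<bar> \<le> \<bar>d1\<bar> / 2" using order_trans[OF \<sigma> \<eta>(3)] K by (simp add: field_simps)
        from mult_right_mono[OF this abs_ge_zero[of \<sigma>]] show ?thesis by (simp add: power2_eq_square mult.assoc)
      qed
      moreover have "\<bar>\<sigma>\<bar> * \<bar>d1\<bar> \<le> \<bar>\<sigma> * d1 - D1 * S\<bar> + \<bar>D1\<bar> * S"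
        using abs_triangle_ineq[of "\<sigma> * d1 - D1 * S" "D1 * S"] S by (simp add: abs_mult)
      moreover have "K * T * S \<le> K * S"
        using T \<eta>(2) K S mult_right_mono[of T 1 "K * S"] by (simp add: mult_ac)
      ultimately have "\<bar>\<sigma>\<bar> * \<bar>d1\<bar> \<le> 2 * ((\<bar>D1\<bar> + K) * S)" using first by (simp add: algebra_simps)
      then show ?thesis using d1 by (simp add: L_def field_simps)
    qed
    have small: "K * \<sigma>\<^sup>2 + K * T * S \<le> K * (L + 1) * (\<eta> * S)"
    proof -
      have "\<sigma>\<^sup>2 \<le> \<eta> * (L * S)"
        using mult_mono[OF \<sigma> \<sigma>S] \<eta>(1) by (simp add: power2_eq_square)
      moreover have "T * S \<le> \<eta> * S" using T S by (rule_tac mult_right_mono) auto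
      ultimately have "\<sigma>\<^sup>2 + T * S \<le> (L + 1) * (\<eta> * S)" by (simp add: algebra_simps)
      from mult_left_mono[OF this less_imp_le[OF K]] show ?thesis by (simp add: algebra_simps)
    qed
    \<comment> \<open>The conjugate of the first order part of \<open>e2\<close>. Multiplying by it
      leaves \<open>c\<close> with a positive real factor, so taking imaginary parts eliminates the
      square root.\<close>
    define p where "p = 1 + \<i> * complex_of_real (\<sigma> * d2)"
    define err where "err = p * (c * (1 - \<i> * of_real (\<sigma> * d2)) - (1 - \<i> * of_real (D2 * S)))"
    have p: "cmod p \<le> 1 + \<bar>d2\<bar>"
    proof -
      have "cmod p \<le> 1 + \<bar>\<sigma>\<bar> * \<bar>d2\<bar>"
        unfolding p_def by (rule order_trans[OF norm_triangle_ineq]) (simp add: norm_mult)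
      also have "\<dots> \<le> 1 + 1 * \<bar>d2\<bar>" using \<sigma> \<eta>(2) by (intro add_left_mono mult_right_mono) auto
      finally show ?thesis by simp
    qed
    have errle: "cmod err \<le> (1 + \<bar>d2\<bar>) * (K * (L + 1) * (\<eta> * S))"
    proof -
      have "c * (1 - \<i> * of_real (\<sigma> * d2)) - (1 - \<i> * of_real (D2 * S))
          = (c * e2 - (1 - \<i> * of_real (D2 * S))) - c * (e2 - (1 - \<i> * of_real (\<sigma> * d2)))"
        by (simp add: algebra_simps)
      also have "cmod \<dots> \<le> K * T * S + 1 * (K * \<sigma>\<^sup>2)"
        using norm_triangle_ineq4[of "c * e2 - (1 - \<i> * of_real (D2 * S))" "c * (e2 - (1 - \<i> * of_real (\<sigma> * d2)))"]
          o2' e2 c1 by (simp only: norm_mult mult_1)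
      finally have "cmod (c * (1 - \<i> * of_real (\<sigma> * d2)) - (1 - \<i> * of_real (D2 * S))) \<le> K * (L + 1) * (\<eta> * S)"
        using small by simp
      then show ?thesis unfolding err_def norm_mult using p by (intro mult_mono) auto
    qed
    have im: "\<alpha> * \<delta> * (1 + (\<sigma> * d2)\<^sup>2) = \<sigma> * d2 - D2 * S + Im err"
      by (simp add: err_def p_def c_def algebra_simps power2_eq_square)
    \<comment> \<open>Multiplying by \<open>d1\<close> allows \<open>d1 * \<sigma>\<close> to be
      replaced by \<open>D1 * S\<close> up to the first error, and the coefficient of
      \<open>S\<close> becomes \<open>- A\<close>.\<close>
    have "\<delta> * (\<alpha> * d1) * (1 + (\<sigma> * d2)\<^sup>2) = d1 * (\<sigma> * d2 - D2 * S + Im err)"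
      unfolding im[symmetric] by (simp add: algebra_simps)
    also have "\<dots> = - A * S + (d2 * (\<sigma> * d1 - D1 * S) + d1 * Im err)"
      by (simp add: A_def algebra_simps)
    finally have eq: "\<delta> * (sgn A * \<bar>d1\<bar>) * (1 + (\<sigma> * d2)\<^sup>2) = - A * S + (d2 * (\<sigma> * d1 - D1 * S) + d1 * Im err)"
      unfolding \<alpha>d .
    have rest: "\<bar>d2 * (\<sigma> * d1 - D1 * S) + d1 * Im err\<bar> \<le> \<bar>A\<bar> * S"
    proof -
      have "\<bar>d2 * (\<sigma> * d1 - D1 * S) + d1 * Im err\<bar> \<le> \<bar>d2\<bar> * \<bar>\<sigma> * d1 - D1 * S\<bar> + \<bar>d1\<bar> * \<bar>Im err\<bar>"
        by (rule order_trans[OF abs_triangle_ineq]) (simp add: abs_mult)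
      also have "\<dots> \<le> \<bar>d2\<bar> * (K * (L + 1) * (\<eta> * S)) + \<bar>d1\<bar> * ((1 + \<bar>d2\<bar>) * (K * (L + 1) * (\<eta> * S)))"
        using first small errle abs_Im_le_cmod[of err] by (intro add_mono mult_left_mono) auto
      also have "\<dots> = \<eta> * Q * S" by (simp add: Q_def algebra_simps)
      also have "\<dots> \<le> \<bar>A\<bar> * S" using \<eta>(4) Q S by (intro mult_right_mono) (auto simp: field_simps)
      finally show ?thesis .
    qed
    have dist: "g * (- a * b + x) = - (a * g) * b + g * x" for g a b x :: real
      by (simp add: algebra_simps)
    have sA: "sgn A * sgn A = 1" using A0 by (simp add: sgn_if)
    \<comment> \<open>After multiplication by the sign of \<open>A\<close> the left side is strictly
      positive, while the error cannot outweigh \<open>- \<bar>A\<bar> * S\<close>. For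
      \<open>S = 0\<close> the contradiction comes from \<open>\<delta> > 0\<close> alone.\<close>
    have "\<delta> * \<bar>d1\<bar> * (1 + (\<sigma> * d2)\<^sup>2) = (sgn A * sgn A) * (\<delta> * \<bar>d1\<bar> * (1 + (\<sigma> * d2)\<^sup>2))"
      by (simp only: sA mult_1)
    also have "\<dots> = sgn A * (\<delta> * (sgn A * \<bar>d1\<bar>) * (1 + (\<sigma> * d2)\<^sup>2))"
      by (simp only: mult_ac)
    also have "\<dots> = - (A * sgn A) * S + sgn A * (d2 * (\<sigma> * d1 - D1 * S) + d1 * Im err)"
      unfolding eq by (rule dist)
    also have "A * sgn A = \<bar>A\<bar>" by (simp only: abs_sgn)
    also have "- \<bar>A\<bar> * S + sgn A * (d2 * (\<sigma> * d1 - D1 * S) + d1 * Im err) \<le> 0"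
    proof -
      have "sgn A * (d2 * (\<sigma> * d1 - D1 * S) + d1 * Im err) \<le> \<bar>d2 * (\<sigma> * d1 - D1 * S) + d1 * Im err\<bar>"
        by (rule order_trans[OF abs_ge_self]) (use A0 in \<open>simp add: abs_mult abs_sgn_eq\<close>)
      then show ?thesis using rest by simp
    qed
    finally have "\<delta> * \<bar>d1\<bar> * (1 + (\<sigma> * d2)\<^sup>2) \<le> 0" .
    moreover have "0 < \<delta> * \<bar>d1\<bar> * (1 + (\<sigma> * d2)\<^sup>2)"
      using \<delta>(1) d1 by (intro mult_pos_pos add_pos_nonneg) auto
    ultimately show False by simp
  qed
qed

section \<open>Transfer to the smooth representative, and the conclusion\<close>

lemma borel_measurable_leb_cong_AE:
  fixes f g :: "real \<Rightarrow> real"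
  assumes ae: "AE x in leb 0 1. f x = g x" and g: "g \<in> borel_measurable (leb 0 1)"
  shows "f \<in> borel_measurable (leb 0 1)"
proof -
  obtain N where N: "N \<in> null_sets (leb 0 1)" "{x \<in> space (leb 0 1). f x \<noteq> g x} \<subseteq> N"
    using ae unfolding eventually_ae_filter by blast
  \<comment> \<open>Off the null set the functions agree; completeness of Lebesgue measure allows
    the null set to be put back.\<close>
  have "g \<in> borel_measurable (lebesgue_on ({0<..<1} - N))"
    using borel_measurable_diff_null[OF N(1), of g] g by simp
  then have "f \<in> borel_measurable (lebesgue_on ({0<..<1} - N))"
    by (rule measurable_lebesgue_cong[THEN iffD1, rotated]) (use N(2) in auto)
  then show ?thesis using borel_measurable_diff_null[OF N(1), of f] by simp
qed

lemma diag_cong_AE: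
  assumes ae: "AE x in leb 0 1. f x = g x" and g: "continuous_on {0..1} g"
  shows "diag f k = diag g k"
proof -
  have gm: "g \<in> borel_measurable (leb 0 1)" by (rule borel_measurable_continuous_leb[OF g])
  have fm: "f \<in> borel_measurable (leb 0 1)" by (rule borel_measurable_leb_cong_AE[OF ae gm])
  have pm: "\<phi> k \<in> borel_measurable (leb 0 1)" by (rule sqint_measurable[OF sqint_phi])
  show ?thesis
    unfolding diag_def ip_def cnj_phi
    by (rule arg_cong[of _ _ Re], rule integral_cong_AE)
      (use fm gm pm ae in auto)
qed

theorem theorem1p1:
  fixes \<mu> \<mu>' :: "real \<Rightarrow> real" and \<alpha> :: real
  assumes "sobolev 3 \<mu>"
    and "weak_deriv 1 \<mu> \<mu>'"
    and "coeff_A \<mu> \<mu>' \<noteq> 0"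
    and "diag \<mu> 1 \<noteq> 0"
    and "\<alpha> = sgn (coeff_A \<mu> \<mu>' * diag \<mu> 1)"
  shows "\<exists>Tstar > 0. \<exists>\<epsilon> > 0. \<forall>T \<in> {0<..<Tstar}. \<forall>u :: real \<Rightarrow> real.
    L2 0 T u \<longrightarrow> L2norm 0 T u < \<epsilon> \<longrightarrow>
    (\<forall>\<psi>1 \<psi>2. mild_solution T \<mu> u (\<phi> 1) \<psi>1 \<longrightarrow> mild_solution T \<mu> u (\<phi> 2) \<psi>2 \<longrightarrow>
      (\<forall>\<delta> \<in> {0<..1}.
        \<not> (eq_ae (\<psi>1 T) (\<Phi> 1 T) \<and>
           eq_ae (\<psi>2 T) (\<lambda>x. (complex_of_real (sqrt (1 - \<delta>\<^sup>2)) +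
             \<i> * complex_of_real \<alpha> * complex_of_real \<delta>) * \<Phi> 2 T x))))"
proof -
  obtain M M' M'' where rep: "\<And>x. (M has_real_derivative M' x) (at x)"
    "\<And>x. (M' has_real_derivative M'' x) (at x)" "continuous_on UNIV M''"
    "AE x in leb 0 1. \<mu> x = M x" "AE x in leb 0 1. \<mu>' x = M' x"
    using sobolev_3_C2_representative[OF assms(1,2)] by blast
  interpret C2_potential M M' M'' by unfold_locales (rule rep)+
  have \<mu>m: "\<mu> \<in> borel_measurable (leb 0 1)" using assms(1) by (simp add: sobolev_def L2_def)
  have "\<mu>' \<in> borel_measurable (leb 0 1)"
    by (rule borel_measurable_leb_cong_AE[OF rep(5) borel_measurable_continuous_leb[OF M'_cont]])
  have dM: "diag \<mu> k = diag M k" "diag (\<lambda>x. (\<mu>' x)\<^sup>2) k = diag (\<lambda>x. (M' x)\<^sup>2) k" for k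
  proof -
    have "AE x in leb 0 1. (\<mu>' x)\<^sup>2 = (M' x)\<^sup>2" using rep(5) by eventually_elim simp
    then show "diag \<mu> k = diag M k" "diag (\<lambda>x. (\<mu>' x)\<^sup>2) k = diag (\<lambda>x. (M' x)\<^sup>2) k"
      by (intro diag_cong_AE rep(4) M_cont M'_cont continuous_on_power; assumption)+
  qed
  define d where "d = diag M"
  define D where "D = diag (\<lambda>x. (M' x)\<^sup>2)"
  have A: "coeff_A \<mu> \<mu>' = d 1 * D 2 - d 2 * D 1" by (simp add: coeff_A_def dM d_def D_def)
  have d1: "d 1 \<noteq> 0" using assms(4) by (simp add: dM d_def)
  have \<alpha>: "\<alpha> = sgn ((d 1 * D 2 - d 2 * D 1) * d 1)" using assms(5) by (simp only: A dM(1) d_def)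
  define S where "S T u = lint 0 T (\<lambda>t. (lint 0 t u)\<^sup>2)" for T and u :: "real \<Rightarrow> real"
  \<comment> \<open>The factor \<open>c\<close> is left free: it is 1 for \<open>j = 1\<close> and
    the unit number with argument fixed by \<alpha> and \<delta> for \<open>j = 2\<close>.\<close>
  have two: "\<exists>K>0. (\<forall>\<sigma>. cmod (ip (\<phi> j) (E j \<sigma>) - (1 - \<i> * of_real (\<sigma> * d j))) \<le> K * \<sigma>\<^sup>2) \<and>
      (\<forall>T u \<psi> c. 0 < T \<longrightarrow> T \<le> 1 \<longrightarrow> L2 0 T u \<longrightarrow> L2norm 0 T u \<le> 1 \<longrightarrow> mild_solution T \<mu> u (\<phi> j) \<psi> \<longrightarrow>
        eq_ae (\<psi> T) (\<lambda>x. c * \<Phi> j T x) \<longrightarrow>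
        cmod (c * ip (\<phi> j) (E j (lint 0 T u)) - (1 - \<i> * of_real (D j * S T u))) \<le> K * T * S T u)"
    if j: "j \<ge> 1" for j
  proof -
    obtain K1 where K1: "K1 > 0" "\<And>\<sigma>. cmod (ip (\<phi> j) (E j \<sigma>) - (1 - \<i> * of_real (\<sigma> * d j))) \<le> K1 * \<sigma>\<^sup>2"
      unfolding d_def using phase_overlap[OF j] by blast
    obtain K2 where K2: "K2 > 0"
      "\<And>T u \<psi>. 0 < T \<Longrightarrow> T \<le> 1 \<Longrightarrow> L2 0 T u \<Longrightarrow> L2norm 0 T u \<le> 1 \<Longrightarrow>
       evolves T M u \<psi> (\<lambda>t y. 0) \<Longrightarrow> (AE y in leb 0 1. \<psi> 0 y = \<phi> j y) \<Longrightarrow>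
       cmod (ip (\<psi> T) (\<Theta> j (\<lambda>t. lint 0 t u) T) - (1 - \<i> * of_real (D j * S T u))) \<le> K2 * T * S T u"
      unfolding D_def S_def using final_overlap[OF j] by blast
    have S0: "S T u \<ge> 0" for T u unfolding S_def by (rule integral_nonneg_AE) simp
    show ?thesis
    proof (intro exI[of _ "K1 + K2"] conjI allI impI)
      fix \<sigma>
      show "cmod (ip (\<phi> j) (E j \<sigma>) - (1 - \<i> * of_real (\<sigma> * d j))) \<le> (K1 + K2) * \<sigma>\<^sup>2"
        by (rule order_trans[OF K1(2)]) (use K2(1) in \<open>simp add: distrib_right\<close>)
    next
      fix T u \<psi> c
      assume T: "0 < T" "T \<le> 1" and u: "L2 0 T u" "L2norm 0 T u \<le> 1"
        and mild: "mild_solution T \<mu> u (\<phi> j) \<psi>" and fin: "eq_ae (\<psi> T) (\<lambda>x. c * \<Phi> j T x)"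
      let ?e = "exp (- \<i> * complex_of_real (eigval j * T))"
      note ev = mild_solution_evolves[OF mild sqint_phi _ \<mu>m rep(4) M_cont]
      \<comment> \<open>The target and the comparison function carry the same phase at time
        \<open>T\<close>, so their overlap reduces to that of \<open>\<phi> j\<close> with
        \<open>E j\<close>.\<close>
      have e: "?e * cnj ?e = 1" by (simp add: exp_cnj exp_add[symmetric])
      have \<Phi>: "\<Phi> j T = (\<lambda>x. ?e * \<phi> j x)" by (simp add: \<Phi>_def fun_eq_iff)
      have "sqint (\<psi> T)" using ev(1) T by (simp add: evolves_def)
      have "ip (\<psi> T) (\<Theta> j (\<lambda>t. lint 0 t u) T)
          = ip (\<lambda>x. c * \<Phi> j T x) (\<Theta> j (\<lambda>t. lint 0 t u) T)"
        by (rule ip_cong_AE) (use fin \<open>sqint (\<psi> T)\<close> sqint_\<Theta> sqint_phi in \<open>auto simp: eq_ae_def \<Phi> intro!: sqint_cmult\<close>)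
      also have "\<dots> = c * ((?e * cnj ?e) * ip (\<phi> j) (E j (lint 0 T u)))"
        unfolding \<Phi> \<Theta>_def[abs_def] ip_cmult_left ip_cmult_right by (simp only: mult_ac)
      finally have eq: "ip (\<psi> T) (\<Theta> j (\<lambda>t. lint 0 t u) T) = c * ip (\<phi> j) (E j (lint 0 T u))"
        unfolding e by simp
      have "cmod (ip (\<psi> T) (\<Theta> j (\<lambda>t. lint 0 t u) T) - (1 - \<i> * of_real (D j * S T u))) \<le> K2 * T * S T u"
        by (rule K2(2)[OF T u]) (use ev T in auto)
      also have "\<dots> \<le> (K1 + K2) * T * S T u"
        using K1(1) T S0[of T u] by (intro mult_right_mono) auto
      finally show "cmod (c * ip (\<phi> j) (E j (lint 0 T u)) - (1 - \<i> * of_real (D j * S T u))) \<le> (K1 + K2) * T * S T u"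
        unfolding eq .
    qed (use K1 K2 in simp)
  qed
  have S0: "S T u \<ge> 0" for T u unfolding S_def by (rule integral_nonneg_AE) simp
  obtain K1 where K1: "K1 > 0" "\<And>\<sigma>. cmod (ip (\<phi> 1) (E 1 \<sigma>) - (1 - \<i> * of_real (\<sigma> * d 1))) \<le> K1 * \<sigma>\<^sup>2"
    "\<And>T u \<psi> c. 0 < T \<Longrightarrow> T \<le> 1 \<Longrightarrow> L2 0 T u \<Longrightarrow> L2norm 0 T u \<le> 1 \<Longrightarrow> mild_solution T \<mu> u (\<phi> 1) \<psi> \<Longrightarrow>
      eq_ae (\<psi> T) (\<lambda>x. c * \<Phi> 1 T x) \<Longrightarrow>
      cmod (c * ip (\<phi> 1) (E 1 (lint 0 T u)) - (1 - \<i> * of_real (D 1 * S T u))) \<le> K1 * T * S T u"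
    using two[of 1] by blast
  obtain K2 where K2: "K2 > 0" "\<And>\<sigma>. cmod (ip (\<phi> 2) (E 2 \<sigma>) - (1 - \<i> * of_real (\<sigma> * d 2))) \<le> K2 * \<sigma>\<^sup>2"
    "\<And>T u \<psi> c. 0 < T \<Longrightarrow> T \<le> 1 \<Longrightarrow> L2 0 T u \<Longrightarrow> L2norm 0 T u \<le> 1 \<Longrightarrow> mild_solution T \<mu> u (\<phi> 2) \<psi> \<Longrightarrow>
      eq_ae (\<psi> T) (\<lambda>x. c * \<Phi> 2 T x) \<Longrightarrow>
      cmod (c * ip (\<phi> 2) (E 2 (lint 0 T u)) - (1 - \<i> * of_real (D 2 * S T u))) \<le> K2 * T * S T u"
    using two[of 2] by auto
  define K where "K = max K1 K2"
  have K: "K > 0" "K1 \<le> K" "K2 \<le> K" using K1(1) by (auto simp: K_def)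
  have Kx: "K1 * x \<le> K * x" "K2 * x \<le> K * x" if "x \<ge> 0" for x
    using K that by (auto intro: mult_right_mono)
  from final_algebra[OF d1 _ K(1), of "D 2" "d 2" "D 1"] assms(3) A
  obtain \<eta> where \<eta>: "\<eta> > 0"
    "\<And>T \<sigma> S \<delta> e1 e2. 0 < T \<Longrightarrow> T \<le> \<eta> \<Longrightarrow> \<bar>\<sigma>\<bar> \<le> \<eta> \<Longrightarrow> S \<ge> 0 \<Longrightarrow> 0 < \<delta> \<Longrightarrow> \<delta> \<le> 1 \<Longrightarrow>
      cmod (e1 - (1 - \<i> * of_real (\<sigma> * d 1))) \<le> K * \<sigma>\<^sup>2 \<Longrightarrow>
      cmod (e2 - (1 - \<i> * of_real (\<sigma> * d 2))) \<le> K * \<sigma>\<^sup>2 \<Longrightarrow>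
      cmod (e1 - (1 - \<i> * of_real (D 1 * S))) \<le> K * T * S \<Longrightarrow>
      cmod ((of_real (sqrt (1 - \<delta>\<^sup>2)) + \<i> * of_real \<alpha> * of_real \<delta>) * e2
        - (1 - \<i> * of_real (D 2 * S))) \<le> K * T * S \<Longrightarrow> False"
    unfolding \<alpha> by metis
  \<comment> \<open>One number bounds both the time and the control: since \<open>T\<close> is at
    most 1, Cauchy-Schwarz bounds |\<sigma>| by the norm of \<open>u\<close>, hence by
    \<eta>.\<close>
  show ?thesis
  proof (rule exI[of _ "min 1 \<eta>"], rule conjI, use \<eta>(1) in simp, rule exI[of _ "min 1 \<eta>"],
      rule conjI, use \<eta>(1) in simp, intro ballI allI impI notI, elim conjE)
    fix T \<delta> :: real and u :: "real \<Rightarrow> real" and \<psi>1 \<psi>2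
    assume T: "T \<in> {0<..<min 1 \<eta>}" and u: "L2 0 T u" "L2norm 0 T u < min 1 \<eta>"
      and mild: "mild_solution T \<mu> u (\<phi> 1) \<psi>1" "mild_solution T \<mu> u (\<phi> 2) \<psi>2" and \<delta>: "\<delta> \<in> {0<..1}"
      and fin: "eq_ae (\<psi>1 T) (\<Phi> 1 T)"
        "eq_ae (\<psi>2 T) (\<lambda>x. (complex_of_real (sqrt (1 - \<delta>\<^sup>2)) + \<i> * complex_of_real \<alpha> * complex_of_real \<delta>) * \<Phi> 2 T x)"
    have T': "0 < T" "T \<le> 1" "T \<le> \<eta>" and u': "L2norm 0 T u \<le> 1" "L2norm 0 T u \<le> \<eta>" and \<delta>': "0 < \<delta>" "\<delta> \<le> 1"
      using T u \<delta> by auto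
    define \<sigma> where "\<sigma> = lint 0 T u"
    have "\<bar>\<sigma>\<bar> \<le> lint 0 T (\<lambda>t. \<bar>u t\<bar>)"
      unfolding \<sigma>_def by (rule integral_abs_bound)
    also have "\<dots> \<le> sqrt T * L2norm 0 T u" using L2_integral_le[OF u(1)] T' by simp
    also have "\<dots> \<le> 1 * \<eta>"
      by (rule mult_mono) (use T' u' in \<open>auto simp: L2norm_def intro: integral_nonneg_AE\<close>)
    finally have \<sigma>: "\<bar>\<sigma>\<bar> \<le> \<eta>" by simp
    have TS: "T * S T u \<ge> 0" using T' S0 by simp
    have o1: "cmod (ip (\<phi> 1) (E 1 \<sigma>) - (1 - \<i> * of_real (D 1 * S T u))) \<le> K1 * (T * S T u)"
      using K1(3)[OF T'(1,2) u(1) u'(1) mild(1), of 1] fin(1) by (simp add: \<sigma>_def mult.assoc)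
    have o2: "cmod ((of_real (sqrt (1 - \<delta>\<^sup>2)) + \<i> * of_real \<alpha> * of_real \<delta>) * ip (\<phi> 2) (E 2 \<sigma>)
        - (1 - \<i> * of_real (D 2 * S T u))) \<le> K2 * (T * S T u)"
      using K2(3)[OF T'(1,2) u(1) u'(1) mild(2) fin(2)] by (simp only: \<sigma>_def mult.assoc)
    show False
      by (rule \<eta>(2)[OF T'(1,3) \<sigma> S0 \<delta>'
            order_trans[OF K1(2) Kx(1)] order_trans[OF K2(2) Kx(2)]
            order_trans[OF o1 order_trans[OF Kx(1)[OF TS]]] order_trans[OF o2 order_trans[OF Kx(2)[OF TS]]]])
        (simp_all add: mult.assoc)
  qed
qed

end
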